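(* Let $f\in C(I,I)$ with $h(f)=0$ and $x<y$ in $I$. The following are equivalent: (1) $\langle x,y\rangle$ is $f$-nonseparable; (2) $\langle x,y\rangle$ is an IT-pair; (3) $\langle x,y\rangle$ is an IN-pair.
   Context: $I=[0,1]$, $C(I,I)$ continuous self-maps of $I$, $h(f)$ topological entropy, $\omega_f(x)$ the $\omega$-limit set of $x$. For subsets $A_1,A_2\subset I$, $J\subset\mathbb Z_+$ is an independence set for $(A_1,A_2)$ if for every nonempty finite $F\subset J$ and every $s\in\{1,2\}^F$, $\bigcap_{i\in F}f^{-i}A_{s(i)}\ne\emptyset$. $\langle x_1,x_2\rangle$ is an IT-pair (resp. IN-pair) if for all neighborhoods $U_1\ni x_1$, $U_2\ni x_2$, $(U_1,U_2)$ has an infinite independence set (resp. arbitrarily long finite independence sets). Periodic portion: for $h(f)=0$ and $\omega_f(z)$ infinite, $J_k^i=[\min\omega_{f^{2^k}}(f^i(z)),\max\omega_{f^{2^k}}(f^i(z))]$ for $k\ge1$, $0\le i<2^k$; for fixed $k$ pairwise disjoint, with $J_{k+1}^i\cup J_{k+1}^{2^k+i}\subset J_k^i$. A nested sequence is a choice of $i_k$ with $J_1^{i_1}\supset J_2^{i_2}\supset\cdots$. A pair $\langle u,v\rangle$, $u\ne v$, is $f$-nonseparable if for some $z$ with $\omega_f(z)$ infinite there is a nested sequence with $\bigcap_kJ_k^{i_k}=[u,v]$ or $[v,u]$. *)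

theory Defs
  imports "HOL-Analysis.Analysis" "HOL-Library.Extended_Real"
begin

text \<open>Maps of I = [0,1] are represented as real functions; only their values on I matter.\<close>

definition interval_map :: "(real \<Rightarrow> real) \<Rightarrow> bool" where
  "interval_map f \<longleftrightarrow> continuous_on {0..1} f \<and> f ` {0..1} \<subseteq> {0..1}"

definition separated_set :: "(real \<Rightarrow> real) \<Rightarrow> nat \<Rightarrow> real \<Rightarrow> real set \<Rightarrow> bool" where
  "separated_set f n \<epsilon> E \<longleftrightarrow> E \<subseteq> {0..1} \<and>
     (\<forall>x\<in>E. \<forall>y\<in>E. x \<noteq> y \<longrightarrow> (\<exists>k<n. \<bar>(f^^k) x - (f^^k) y\<bar> > \<epsilon>))"

definition max_sep :: "(real \<Rightarrow> real) \<Rightarrow> nat \<Rightarrow> real \<Rightarrow> ereal" where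
  "max_sep f n \<epsilon> = (SUP E \<in> {E. finite E \<and> separated_set f n \<epsilon> E}. ereal (real (card E)))"

definition top_entropy :: "(real \<Rightarrow> real) \<Rightarrow> ereal" where
  "top_entropy f = (SUP \<epsilon> \<in> {0<..}.
      limsup (\<lambda>n. if max_sep f n \<epsilon> = \<infinity> then \<infinity>
                   else ereal (ln (real_of_ereal (max_sep f n \<epsilon>)) / real n)))"

definition omega_limit :: "(real \<Rightarrow> real) \<Rightarrow> real \<Rightarrow> real set" where
  "omega_limit f x = {y. \<exists>r. strict_mono r \<and> (\<lambda>n. (f^^(r n)) x) \<longlonglongrightarrow> y}"

definition indep_set :: "(real \<Rightarrow> real) \<Rightarrow> real set \<Rightarrow> real set \<Rightarrow> nat set \<Rightarrow> bool" where
  "indep_set f A1 A2 J \<longleftrightarrow>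
     (\<forall>F. F \<subseteq> J \<and> finite F \<and> F \<noteq> {} \<longrightarrow>
        (\<forall>s :: nat \<Rightarrow> bool. \<exists>x\<in>{0..1}. \<forall>i\<in>F. (f^^i) x \<in> (if s i then A1 else A2)))"

definition IT_pair :: "(real \<Rightarrow> real) \<Rightarrow> real \<Rightarrow> real \<Rightarrow> bool" where
  "IT_pair f x1 x2 \<longleftrightarrow> (\<forall>U1 U2. open U1 \<and> x1 \<in> U1 \<and> open U2 \<and> x2 \<in> U2 \<longrightarrow>
      (\<exists>J. infinite J \<and> indep_set f U1 U2 J))"

definition IN_pair :: "(real \<Rightarrow> real) \<Rightarrow> real \<Rightarrow> real \<Rightarrow> bool" where
  "IN_pair f x1 x2 \<longleftrightarrow> (\<forall>U1 U2. open U1 \<and> x1 \<in> U1 \<and> open U2 \<and> x2 \<in> U2 \<longrightarrow>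
      (\<forall>m. \<exists>J. finite J \<and> card J \<ge> m \<and> indep_set f U1 U2 J))"

definition periodic_portion :: "(real \<Rightarrow> real) \<Rightarrow> real \<Rightarrow> nat \<Rightarrow> nat \<Rightarrow> real set" where
  "periodic_portion f z k i =
     {Inf (omega_limit (f^^(2^k)) ((f^^i) z)) .. Sup (omega_limit (f^^(2^k)) ((f^^i) z))}"

definition nonseparable :: "(real \<Rightarrow> real) \<Rightarrow> real \<Rightarrow> real \<Rightarrow> bool" where
  "nonseparable f u v \<longleftrightarrow> u \<noteq> v \<and>
     (\<exists>z \<in> {0..1}. infinite (omega_limit f z) \<and>
       (\<exists>ik :: nat \<Rightarrow> nat.
          (\<forall>k\<ge>1. ik k < 2^k \<and> periodic_portion f z (k+1) (ik (k+1)) \<subseteq> periodic_portion f z k (ik k)) \<and>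
          ((\<Inter>k\<in>{1..}. periodic_portion f z k (ik k)) = {u..v} \<or>
           (\<Inter>k\<in>{1..}. periodic_portion f z k (ik k)) = {v..u})))"

end

theory Submission
  imports Defs
begin

text \<open>
  Zero entropy enters only through the absence of horseshoes: no iterate of \<open>f\<close> has a fixed point
  \<open>c\<close> and points \<open>c < p < q\<close> such that it maps \<open>p\<close> to or above \<open>q\<close> and \<open>q\<close> to or below \<open>c\<close>,
  nor the reflected configuration. Consequently a preimage of \<open>c\<close> can never be reached again from the
  points between it and \<open>c\<close>.

  For an orbit that is not asymptotically periodic this makes it alternate eventually around a fixed
  point, and the same for all iterates of order a power of two. So the portions of an infinite
  \<open>\<omega>\<close>-limit set are separated by periodic points, and the intersection \<open>[x, y]\<close> of a nested
  sequence of portions is wandering.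

  The three properties of the pair all amount to this: for every \<open>e > 0\<close> some iterate stretches both
  \<open>[x - e, x]\<close> and \<open>[y, y + e]\<close> over a neighbourhood of \<open>[x, y]\<close>. For a nonseparable pair the iterate
  is found by looking at the sibling portions, which accumulate at \<open>x\<close> or at \<open>y\<close>. For an IN-pair, four
  independent times suffice once \<open>(x, y)\<close> is known to be wandering. If \<open>(x, y)\<close> were not wandering,
  orbits oscillating between neighbourhoods of \<open>x\<close> and \<open>y\<close> at even times would have to break the
  alternation around a fixed point again and again, and each break costs an oscillation of \<open>f\<close> of
  fixed size, of which uniform continuity allows only boundedly many. Iterating the stretching gives
  an infinite independence set and also a point whose \<open>\<omega>\<close>-limit set contains \<open>x\<close> and \<open>y\<close>.
\<close>

section \<open>Maps without homoclinic points\<close>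

text \<open>The excluded configuration gives a horseshoe only for the doubled iterate:
  \<open>p\<close> has a preimage on either side of itself, and after two steps two disjoint
  intervals cover \<open>[c, q]\<close>. With a single step the two intervals would share
  \<open>p\<close>, while counting separated points needs a gap.

  The main obstacle is the passage from IN-pairs to orbits. The independent times are finite in
  number and come with a new point for each length, so facts about what happens eventually along one
  orbit do not help. The breaks of alternation have to be bounded uniformly over all orbits and all
  separating fixed points. Even times make the breaks visible: along a strictly alternating orbit,
  times of equal parity lie on the same side of \<open>c\<close>.

  Maps are extended constantly to the line because the collars \<open>[x - e, x]\<close> and
  \<open>[y, y + e]\<close> may leave I. A starting point outside I is brought back by one
  application of the map, which accounts for the shifts of time by one.\<close>

definition homoclinic_free :: "(real \<Rightarrow> real) \<Rightarrow> bool" where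
  "homoclinic_free f \<longleftrightarrow> (\<forall>n\<ge>1. \<forall>c p q. (f^^n) c = c \<longrightarrow>
     \<not> (c < p \<and> p < q \<and> q \<le> (f^^n) p \<and> (f^^n) q \<le> c) \<and>
     \<not> (q < p \<and> p < c \<and> (f^^n) p \<le> q \<and> c \<le> (f^^n) q))"

text \<open>The symmetric bound makes the class invariant under \<open>mirror\<close>, so every one-sided statement
  comes with its reflection for free.\<close>

definition tame :: "(real \<Rightarrow> real) \<Rightarrow> bool" where
  "tame f \<longleftrightarrow> continuous_on UNIV f \<and> (\<forall>t. \<bar>f t\<bar> \<le> 1) \<and> homoclinic_free f"

definition mirror :: "(real \<Rightarrow> real) \<Rightarrow> real \<Rightarrow> real" where
  "mirror f t = - f (- t)"

lemma funpow_mirror: "(mirror f ^^ n) t = - (f^^n) (- t)"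
  by (induction n arbitrary: t) (auto simp: mirror_def)

lemma homoclinic_free_mirror: "homoclinic_free f \<Longrightarrow> homoclinic_free (mirror f)"
  unfolding homoclinic_free_def funpow_mirror
proof (intro allI impI)
  fix n c p q
  assume h: "\<forall>n\<ge>1. \<forall>c p q. (f^^n) c = c \<longrightarrow>
     \<not> (c < p \<and> p < q \<and> q \<le> (f^^n) p \<and> (f^^n) q \<le> c) \<and>
     \<not> (q < p \<and> p < c \<and> (f^^n) p \<le> q \<and> c \<le> (f^^n) q)"
    and n: "1 \<le> (n::nat)" and c: "- (f^^n) (-c) = c"
  have "(f^^n) (-c) = -c" using c by simp
  from h[rule_format, OF n this, of "-p" "-q"]
  show "\<not> (c < p \<and> p < q \<and> q \<le> - (f ^^ n) (- p) \<and> - (f ^^ n) (- q) \<le> c) \<and>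
     \<not> (q < p \<and> p < c \<and> - (f ^^ n) (- p) \<le> q \<and> c \<le> - (f ^^ n) (- q))"
    by auto
qed

lemma tame_mirror:
  assumes "tame f" shows "tame (mirror f)"
proof -
  have "continuous_on UNIV (\<lambda>t. - f (- t))"
    using assms unfolding tame_def
    by (intro continuous_intros continuous_on_compose2[of UNIV f UNIV uminus]) auto
  then show ?thesis
    using assms homoclinic_free_mirror[of f] by (auto simp: tame_def mirror_def[abs_def])
qed

lemma tame_continuous: "tame f \<Longrightarrow> continuous_on S f"
  by (auto simp: tame_def intro: continuous_on_subset)

lemma continuous_on_funpow:
  fixes f :: "'a::topological_space \<Rightarrow> 'a"
  assumes "continuous_on UNIV f" shows "continuous_on S (f^^n)"
proof (induction n arbitrary: S)
  case 0
  then show ?case by (simp add: id_def)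
next
  case (Suc n)
  have "continuous_on S (f \<circ> (f^^n))"
    by (intro continuous_on_compose Suc continuous_on_subset[OF assms]) auto
  then show ?case by simp
qed

lemma tame_funpow_continuous: "tame f \<Longrightarrow> continuous_on S (f^^n)"
  by (rule continuous_on_funpow) (simp add: tame_def)

lemma tame_funpow_bound: "tame f \<Longrightarrow> 1 \<le> n \<Longrightarrow> \<bar>(f^^n) t\<bar> \<le> 1"
  by (cases n) (auto simp: tame_def)

lemma tame_funpow:
  assumes "tame f" "1 \<le> n" shows "tame (f^^n)"
proof -
  have "homoclinic_free (f^^n)"
    unfolding homoclinic_free_def funpow_mult
  proof (intro allI impI)
    fix m :: nat and c p q
    assume "1 \<le> m" and c: "(f ^^ (n * m)) c = c"
    then have "1 \<le> n * m" using assms(2) by simp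
    then show "\<not> (c < p \<and> p < q \<and> q \<le> (f ^^ (n * m)) p \<and> (f ^^ (n * m)) q \<le> c) \<and>
        \<not> (q < p \<and> p < c \<and> (f ^^ (n * m)) p \<le> q \<and> c \<le> (f ^^ (n * m)) q)"
      using assms(1) c unfolding tame_def homoclinic_free_def by blast
  qed
  then show ?thesis
    using assms tame_funpow_continuous[OF assms(1)] tame_funpow_bound[OF assms] by (simp add: tame_def)
qed

lemma funpow_fixed: "f c = c \<Longrightarrow> (f^^n) c = c"
  by (induction n) auto

lemma funpow_apply: "(f^^m) ((f^^n) z) = (f^^(m + n)) z"
  by (simp add: funpow_add)

lemma ivt_between:
  fixes f :: "real \<Rightarrow> real"
  assumes "continuous_on UNIV f"
    and "(f a \<le> v \<and> v \<le> f b) \<or> (f b \<le> v \<and> v \<le> f a)" and "a \<le> b"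
  obtains t where "a \<le> t" "t \<le> b" "f t = v"
  using assms(2)
proof
  assume "f a \<le> v \<and> v \<le> f b"
  then show ?thesis
    using IVT'[of f a v b] assms that continuous_on_subset[OF assms(1)] by blast
next
  assume "f b \<le> v \<and> v \<le> f a"
  then show ?thesis
    using IVT2'[of f b v a] assms that continuous_on_subset[OF assms(1)] by blast
qed

text \<open>The times \<open>j\<close> and \<open>i\<close> of the two hypotheses are replaced by
  the common time \<open>i * j\<close>. As \<open>f^^i\<close> maps \<open>[p, c]\<close> over
  \<open>[q, c]\<close>, hence over itself, \<open>q\<close> has a preimage in \<open>[p, c]\<close>
  under every positive multiple of \<open>i\<close>; and \<open>q\<close>, once sent to
  \<open>c\<close>, stays there. So \<open>f^^(i * j)\<close> has the forbidden
  configuration.\<close>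

lemma no_homoclinic_left:
  assumes tf: "tame f" and c: "f c = c" and "q < p" "p < c" and q: "(f^^j) q = c" and p: "(f^^i) p \<le> q"
  shows False
proof -
  have i: "1 \<le> i" using assms(3) p by (cases i) auto
  have j: "1 \<le> j" using assms(3,4) q by (cases j) auto
  have "\<exists>r. p \<le> r \<and> r \<le> c \<and> (f^^(i * Suc k)) r = q" for k
  proof (induction k)
    case 0
    obtain r where "p \<le> r" "r \<le> c" "(f^^i) r = q"
      using ivt_between[OF tame_funpow_continuous[OF tf], of i p q c] funpow_fixed[of f c i] c p assms(3,4)
      by (metis less_imp_le order.trans)
    then show ?case by auto
  next
    case (Suc k)
    then obtain s where s: "p \<le> s" "s \<le> c" "(f^^(i * Suc k)) s = q" by blast
    obtain r where r: "p \<le> r" "r \<le> c" "(f^^i) r = s"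
      using ivt_between[OF tame_funpow_continuous[OF tf], of i p s c] funpow_fixed[of f c i] c p assms(3,4) s
      by (metis less_imp_le order.trans)
    have "(f^^(i * Suc k + i)) r = q"
      using s r by (metis funpow_apply)
    then show ?case using r by (auto simp: algebra_simps)
  qed
  from this[of "j - 1"] obtain r where r: "p \<le> r" "r \<le> c" "(f^^(i * j)) r = q" using j by auto
  have rc: "r \<noteq> c" using r funpow_fixed[of f c] c assms(3,4) by force
  have "i * j = (i - 1) * j + j" using i by (cases i) auto
  then have "(f^^(i * j)) q = (f^^((i - 1) * j)) ((f^^j) q)" by (simp only: funpow_apply)
  then have "(f^^(i * j)) q = c" using q c funpow_fixed by metis
  moreover have "1 \<le> i * j" using i j by simp
  moreover have "(f^^(i * j)) c = c" using c by (rule funpow_fixed)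
  moreover have "q < r" "r < c" using r rc assms(3) by auto
  moreover have "homoclinic_free f" using tf by (simp add: tame_def)
  ultimately show False using r(3) unfolding homoclinic_free_def by (metis order.refl)
qed

lemma no_homoclinic_right:
  assumes "tame f" and "f c = c" and "c < p" "p < q" and "(f^^j) q = c" and "q \<le> (f^^i) p"
  shows False
  using no_homoclinic_left[OF tame_mirror[OF assms(1)], of "-c" "-q" "-p" j i] assms
  by (simp add: funpow_mirror mirror_def)

text \<open>The rising point \<open>z\<close> lies in the unstable set of the last fixed point before it, and an orbit
  that leads from \<open>z\<close> to the other side of that fixed point produces a homoclinic point.\<close>

lemma up_then_down_left:
  assumes tf: "tame f" and up: "z < f z" and down: "f ((f^^n) z) < (f^^n) z" and less: "(f^^n) z < z"
  shows False
proof -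
  define w where "w = (f^^n) z"
  define S where "S = {t \<in> {w..z}. f t \<le> t}"
  define a where "a = Sup S"
  have wS: "w \<in> S" using less down by (auto simp: S_def w_def)
  have bdd: "bdd_above S" by (auto simp: S_def intro!: bdd_aboveI[of _ z])
  have "S = {w..z} \<inter> {t. f t \<le> t}" by (auto simp: S_def)
  then have "closed S"
    by (auto intro!: closed_Int closed_Collect_le continuous_intros tame_continuous[OF tf])
  then have aS: "a \<in> S" unfolding a_def using closed_contains_Sup[OF _ bdd] wS by blast
  have fa_le: "f a \<le> a" and wa: "w \<le> a" and az: "a < z"
    using aS up by (auto simp: S_def less_le)
  have above: "t < f t" if "a < t" "t \<le> z" for t
    using that cSup_upper[OF _ bdd, of t] wa unfolding a_def[symmetric] by (force simp: S_def)
  have fa: "f a = a"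
  proof (rule ccontr)
    assume "f a \<noteq> a"
    then have "f a < a" using fa_le by simp
    have "continuous_on UNIV (\<lambda>t. f t - t)" by (intro continuous_intros tame_continuous[OF tf])
    then obtain t where t: "a \<le> t" "t \<le> z" "f t - t = 0"
      using ivt_between[of "\<lambda>t. f t - t" a 0 z] \<open>f a < a\<close> up az by force
    then show False using above[of t] \<open>f a < a\<close> by (cases "t = a") auto
  qed
  have ne: "(f^^l) z \<noteq> a" if "l \<le> n" for l
  proof
    assume "(f^^l) z = a"
    then have "(f^^n) z = a" using funpow_apply[of "n - l" f l z] that funpow_fixed[where f=f, OF fa] by simp
    then show False using down fa by simp
  qed
  have "\<exists>l<n. a < (f^^l) z \<and> (f^^Suc l) z \<le> a"
  proof (rule ccontr)
    assume "\<not> ?thesis"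
    then have step: "a < (f^^l) z \<Longrightarrow> l < n \<Longrightarrow> a < (f^^Suc l) z" for l by force
    have "l \<le> n \<Longrightarrow> a < (f^^l) z" for l
      by (induction l) (use az step in auto)
    from this[of n] show False using wa by (auto simp: w_def)
  qed
  then obtain l where l: "l < n" "a < (f^^l) z" "(f^^Suc l) z \<le> a" by blast
  then have l3: "f ((f^^l) z) < a" using ne[of "Suc l"] by auto
  have zl: "z < (f^^l) z" using above[of "(f^^l) z"] l l3 by force
  obtain q where q: "z \<le> q" "q \<le> (f^^l) z" "f q = a"
    by (rule ivt_between[OF tame_continuous[OF tf], of z a "(f^^l) z"]) (use l3 up az zl in auto)
  have "z \<noteq> q" using q up az by auto
  then show False
    using no_homoclinic_right[OF tf fa az, of q 1 l] q by simp
qed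

lemma down_then_up_right:
  assumes "tame f" and "f z < z" and "(f^^n) z < f ((f^^n) z)" and "z < (f^^n) z"
  shows False
  using up_then_down_left[OF tame_mirror[OF assms(1)], of "-z" n] assms
  by (simp add: funpow_mirror mirror_def)

lemma ups_below_downs:
  assumes tf: "tame f" and up: "(f^^i) z < (f^^Suc i) z" and down: "(f^^Suc j) z < (f^^j) z"
  shows "(f^^i) z < (f^^j) z"
proof (rule ccontr)
  assume "\<not> ?thesis"
  moreover have "(f^^i) z \<noteq> (f^^j) z" using up down by auto
  ultimately have less: "(f^^j) z < (f^^i) z" by simp
  show False
  proof (cases "i \<le> j")
    case True
    then show False
      using up_then_down_left[OF tf, of "(f^^i) z" "j - i"] up down less by (simp add: funpow_apply)
  next
    case False
    then show False
      using down_then_up_right[OF tf, of "(f^^j) z" "i - j"] up down less by (simp add: funpow_apply)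
  qed
qed

section \<open>Fixed points separating an orbit, and runs of the orbit on one side\<close>

definition separates :: "(real \<Rightarrow> real) \<Rightarrow> real \<Rightarrow> real \<Rightarrow> bool" where
  "separates f c z \<longleftrightarrow> f c = c \<and>
     (\<forall>i. ((f^^i) z < (f^^Suc i) z \<longrightarrow> (f^^i) z < c) \<and> ((f^^Suc i) z < (f^^i) z \<longrightarrow> c < (f^^i) z))"

lemma separates_mirror: "separates f c z \<Longrightarrow> separates (mirror f) (- c) (- z)"
  by (auto simp: separates_def funpow_mirror mirror_def)

lemma separating_fixed_point:
  assumes tf: "tame f" and up: "(f^^i) z < (f^^Suc i) z" and down: "(f^^Suc j) z < (f^^j) z"
  obtains c where "separates f c z"
proof -
  define U where "U = {(f^^i) z | i. (f^^i) z < (f^^Suc i) z}"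
  define a where "a = Sup U"
  define b where "b = (f^^j) z"
  have ne: "U \<noteq> {}" using up by (auto simp: U_def)
  have Ule: "u \<le> (f^^k) z" if "u \<in> U" "(f^^Suc k) z < (f^^k) z" for u k
    using that ups_below_downs[OF tf] by (fastforce simp: U_def)
  have bdd: "bdd_above U" using Ule down by (auto intro!: bdd_aboveI)
  have "U \<subseteq> {t. t \<le> f t}" by (auto simp: U_def)
  moreover have "closed {t. t \<le> f t}"
    by (intro closed_Collect_le continuous_intros tame_continuous[OF tf])
  ultimately have "closure U \<subseteq> {t. t \<le> f t}" by (rule closure_minimal)
  then have fa: "a \<le> f a" using closure_contains_Sup[OF ne bdd] by (auto simp: a_def)
  \<comment> \<open>The bound \<open>1 + \<bar>a\<bar>\<close> makes \<open>V\<close> nonempty,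
    since \<open>f\<close> is at most 1. Falling points beyond it, such as a starting point outside
    \<open>[-1, 1]\<close>, lie above \<open>c\<close> anyway.\<close>
  define V where "V = {t. a \<le> t \<and> t \<le> 1 + \<bar>a\<bar> \<and> f t \<le> t}"
  define c where "c = Inf V"
  have fb: "f t \<le> 1" for t using tf by (auto simp: tame_def abs_le_iff)
  have V: "1 + \<bar>a\<bar> \<in> V" using fb[of "1 + \<bar>a\<bar>"] by (auto simp: V_def)
  have bV: "bdd_below V" by (auto simp: V_def intro!: bdd_belowI[of _ a])
  have "closed V"
  proof -
    have "V = {a..1 + \<bar>a\<bar>} \<inter> {t. f t \<le> t}" by (auto simp: V_def)
    then show ?thesis
      by (auto intro!: closed_Int closed_Collect_le continuous_intros tame_continuous[OF tf])
  qed
  then have cV: "c \<in> V" unfolding c_def using closed_contains_Inf[OF _ bV] V by blast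
  have fc: "f c = c"
  proof (rule ccontr)
    assume "f c \<noteq> c"
    then have "f c < c" using cV by (auto simp: V_def)
    have "continuous_on UNIV (\<lambda>t. f t - t)" by (intro continuous_intros tame_continuous[OF tf])
    then obtain t where t: "a \<le> t" "t \<le> c" "f t - t = 0"
      using ivt_between[of "\<lambda>t. f t - t" a 0 c] \<open>f c < c\<close> fa cV by (force simp: V_def)
    then have "t \<in> V" using cV by (auto simp: V_def)
    then have "c \<le> t" unfolding c_def by (rule cInf_lower[OF _ bV])
    then show False using t \<open>f c < c\<close> by auto
  qed
  have cle: "c \<le> (f^^k) z" if d: "(f^^Suc k) z < (f^^k) z" for k
  proof (cases "(f^^k) z \<le> 1 + \<bar>a\<bar>")
    case True
    have "a \<le> (f^^k) z" unfolding a_def using Ule[OF _ d] ne by (intro cSup_least) auto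
    then have "(f^^k) z \<in> V" using True d by (auto simp: V_def)
    then show ?thesis unfolding c_def by (rule cInf_lower[OF _ bV])
  next
    case False
    then show ?thesis using cV by (auto simp: V_def)
  qed
  have "separates f c z"
    unfolding separates_def
  proof (intro conjI allI impI fc)
    fix k assume u: "(f^^k) z < (f^^Suc k) z"
    then have "(f^^k) z \<le> a" unfolding a_def by (intro cSup_upper[OF _ bdd]) (auto simp: U_def)
    moreover have "(f^^k) z \<noteq> c" using u fc by auto
    ultimately show "(f^^k) z < c" using cV by (auto simp: V_def)
  next
    fix k assume d: "(f^^Suc k) z < (f^^k) z"
    moreover have "(f^^k) z \<noteq> c" using d fc by auto
    ultimately show "c < (f^^k) z" using cle[OF d] by auto
  qed
  then show ?thesis by (rule that)
qed

text \<open>Left of \<open>c\<close> the orbit rises, since \<open>c\<close> separates it and a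
  stationary point would never get to the right. The last two points before the crossing are
  therefore in increasing order, the first mapped left of \<open>c\<close> and the second right of
  it, and \<open>q\<close> is found between them. Both belong to the run because it has length at
  least two.\<close>

lemma left_run_event:
  assumes tf: "tame f" and sep: "separates f c z"
    and L: "(f^^i) z < c" "(f^^Suc i) z < c" and j: "i < j" "c < (f^^j) z"
  obtains r q where "i \<le> r" "r + 2 \<le> j" "(f^^i) z \<le> (f^^r) z" "(f^^r) z < q" "q < (f^^Suc r) z"
    "(f^^Suc r) z < c" "c < (f^^(r + 2)) z" "f q = c"
proof -
  have fc: "f c = c" using sep by (simp add: separates_def)
  define l where "l = (LEAST l. i < l \<and> c \<le> (f^^l) z)"
  have ex: "i < j \<and> c \<le> (f^^j) z" using j by simp
  have l: "i < l" "c \<le> (f^^l) z" "l \<le> j"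
    unfolding l_def using LeastI[of "\<lambda>l. i < l \<and> c \<le> (f^^l) z", OF ex] Least_le[of "\<lambda>l. i < l \<and> c \<le> (f^^l) z", OF ex] by auto
  have before: "(f^^k) z < c" if "i \<le> k" "k < l" for k
    using that L(1) not_less_Least[of k "\<lambda>l. i < l \<and> c \<le> (f^^l) z"] unfolding l_def by (cases "k = i") force+
  have stuck: "(f^^k) z \<noteq> (f^^Suc k) z" if "i \<le> k" "k < l" for k
  proof
    assume e: "(f^^k) z = (f^^Suc k) z"
    then have "(f^^(j - k)) ((f^^k) z) = (f^^k) z" by (intro funpow_fixed[where f=f]) simp
    then have "(f^^j) z = (f^^k) z" using that l by (simp add: funpow_apply)
    then show False using before[OF that] j by simp
  qed
  have up: "(f^^k) z < (f^^Suc k) z" if "i \<le> k" "k < l" for k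
    using stuck[OF that] before[OF that] sep unfolding separates_def by (metis not_less_iff_gr_or_eq)
  have ll: "Suc i < l" using L(2) l by (metis Suc_lessI not_less)
  define r where "r = l - 2"
  have r: "i \<le> r" "l = r + 2" using ll by (auto simp: r_def)
  have "(f^^l) z \<noteq> c"
  proof
    assume "(f^^l) z = c"
    then have "(f^^j) z = c" using funpow_apply[of "j - l" f l z] l funpow_fixed[where f=f, OF fc] by simp
    then show False using j by simp
  qed
  then have lc: "c < (f^^(r + 2)) z" using l r by auto
  have ir: "(f^^i) z \<le> (f^^k) z" if "i \<le> k" "k \<le> r" for k
    using that
  proof (induction k rule: dec_induct)
    case (step k)
    then show ?case using up[of k] r by force
  qed simp
  have s: "(f^^r) z < (f^^Suc r) z" "(f^^Suc r) z < c" using up[of r] before[of "Suc r"] r by auto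
  obtain q where q: "(f^^r) z \<le> q" "q \<le> (f^^Suc r) z" "f q = c"
    by (rule ivt_between[OF tame_continuous[OF tf], of "(f^^r) z" c "(f^^Suc r) z"]) (use s lc in auto)
  have "q \<noteq> (f^^r) z" using q s by auto
  moreover have "q \<noteq> (f^^Suc r) z" using q lc by auto
  ultimately show ?thesis
    using that[of r q] r l ir[of r] q s lc by auto
qed

lemma later_right_of_preimage:
  assumes "tame f" "f c = c" "q < (f^^i) z" "(f^^i) z < c" "f q = c" "i < k"
  shows "q < (f^^k) z"
proof (rule ccontr)
  assume "\<not> ?thesis"
  then have "(f^^(k - i)) ((f^^i) z) \<le> q" using assms(6) by (simp add: funpow_apply)
  then show False using no_homoclinic_left[of f c q "(f^^i) z" 1 "k - i"] assms by simp
qed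

lemma right_run_event:
  assumes tf: "tame f" and sep: "separates f c z"
    and L: "c < (f^^i) z" "c < (f^^Suc i) z" and j: "i < j" "(f^^j) z < c"
  obtains r q where "i \<le> r" "r + 2 \<le> j" "(f^^r) z \<le> (f^^i) z" "q < (f^^r) z" "(f^^Suc r) z < q"
    "c < (f^^Suc r) z" "(f^^(r + 2)) z < c" "f q = c"
proof -
  obtain r q where "i \<le> r" "r + 2 \<le> j" "(mirror f^^i) (-z) \<le> (mirror f^^r) (-z)"
    "(mirror f^^r) (-z) < q" "q < (mirror f^^Suc r) (-z)"
    "(mirror f^^Suc r) (-z) < -c" "-c < (mirror f^^(r + 2)) (-z)" "mirror f q = -c"
    using left_run_event[OF tame_mirror[OF tf] separates_mirror[OF sep], of i j] L j
    by (auto simp: funpow_mirror simp del: funpow.simps)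
  then show ?thesis
    using that[of r "-q"] by (auto simp: funpow_mirror mirror_def simp del: funpow.simps)
qed

lemma later_left_of_preimage:
  assumes "tame f" "f c = c" "(f^^i) z < q" "c < (f^^i) z" "f q = c" "i < k"
  shows "(f^^k) z < q"
  using later_right_of_preimage[OF tame_mirror[OF assms(1)], of "-c" "-q" i "-z" k] assms
  by (simp add: funpow_mirror mirror_def)

section \<open>Alternation around a fixed point\<close>

lemma LIMSEQ_real_I: 
  fixes X :: "nat \<Rightarrow> real"
  assumes "\<And>e. 0 < e \<Longrightarrow> \<exists>N. \<forall>n\<ge>N. \<bar>X n - L\<bar> < e"
  shows "X \<longlonglongrightarrow> L"
  using assms by (auto simp: LIMSEQ_def dist_real_def)

lemma continuous_on_UNIV_delta:
  fixes f :: "real \<Rightarrow> real"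
  assumes "continuous_on UNIV f" "0 < e"
  obtains d where "0 < d" "\<And>s. \<bar>s - t\<bar> < d \<Longrightarrow> \<bar>f s - f t\<bar> < e"
  using assms unfolding continuous_on_iff dist_real_def by blast

text \<open>Each run of at least two consecutive orbit points left of \<open>c\<close> ends with a preimage \<open>q\<close> of \<open>c\<close>
  that the orbit never passes again; their supremum is \<open>c\<close>, by continuity.\<close>

lemma left_runs_imp_liminf:
  assumes tf: "tame f" and sep: "separates f c z"
    and left: "\<forall>N. \<exists>i\<ge>N. (f^^i) z < c \<and> (f^^Suc i) z < c"
    and right: "\<forall>N. \<exists>i\<ge>N. c < (f^^i) z" and "0 < e"
  shows "\<exists>N. \<forall>k\<ge>N. c - e < (f^^k) z"
proof -
  have fc: "f c = c" using sep by (simp add: separates_def)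
  define ev where "ev r q \<longleftrightarrow> (f^^r) z < q \<and> q < (f^^Suc r) z \<and> (f^^Suc r) z < c \<and> f q = c" for r q
  have evs: "\<exists>r\<ge>N. \<exists>q. ev r q" for N
  proof -
    obtain i where i: "N \<le> i" "(f^^i) z < c" "(f^^Suc i) z < c" using left by blast
    obtain j where j: "Suc i \<le> j" "c < (f^^j) z" using right by blast
    then have "i < j" by simp
    from left_run_event[OF tf sep i(2,3) this j(2)] show ?thesis
      using i(1) unfolding ev_def by (metis order.trans)
  qed
  have later: "q < (f^^k) z" if "ev r q" "Suc r < k" for r q k
    using later_right_of_preimage[OF tf fc, of q "Suc r" z k] that unfolding ev_def by blast
  have apart: "(f^^Suc r) z \<le> q'" if "ev r q" "ev r' q'" "Suc r < r'" for r q r' q'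
  proof (rule ccontr)
    assume "\<not> ?thesis"
    then have "q' < (f^^r') z"
      using later_right_of_preimage[OF tf fc, of q' "Suc r" z r'] that unfolding ev_def by force
    then show False using that by (simp add: ev_def)
  qed
  define S where "S = {q. \<exists>r. ev r q}"
  define l where "l = Sup S"
  have ne: "S \<noteq> {}" using evs[of 0] by (auto simp: S_def)
  have Sc: "q < c" if "q \<in> S" for q using that by (auto simp: S_def ev_def)
  have bdd: "bdd_above S" using Sc by (auto intro!: bdd_aboveI[of _ c] less_imp_le)
  have up: "q \<le> l" if "ev r q" for r q
    unfolding l_def using that by (intro cSup_upper[OF _ bdd]) (auto simp: S_def)
  \<comment> \<open>Otherwise \<open>f l = c > l\<close> by closedness. A late event starts at a
    point trapped between some \<open>q0\<close> near \<open>l\<close> and \<open>l\<close> itself;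
    its image does not pass the barrier \<open>q'\<close> of a still later event, so it is at most
    \<open>l\<close>. This contradicts continuity at \<open>l\<close>.\<close>
  have lc: "l = c"
  proof (rule ccontr)
    assume "l \<noteq> c"
    moreover have "l \<le> c" unfolding l_def using Sc by (intro cSup_least[OF ne]) (auto intro: less_imp_le)
    ultimately have "l < c" by simp
    have "S \<subseteq> {t. f t = c}" by (auto simp: S_def ev_def)
    moreover have "closed {t. f t = c}"
      by (intro closed_Collect_eq continuous_intros tame_continuous[OF tf])
    ultimately have "closure S \<subseteq> {t. f t = c}" by (rule closure_minimal)
    then have fl: "f l = c" using closure_contains_Sup[OF ne bdd] by (auto simp: l_def)
    obtain d where d: "0 < d" "\<And>s. \<bar>s - l\<bar> < d \<Longrightarrow> \<bar>f s - f l\<bar> < c - l"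
      using continuous_on_UNIV_delta[OF tame_continuous[OF tf], of "c - l"] \<open>l < c\<close> by (metis diff_gt_0_iff_gt)
    obtain q0 where "q0 \<in> S" "l - d < q0"
      using less_cSup_iff[OF ne bdd, of "l - d"] d(1) by (auto simp: l_def)
    then obtain r0 where r0: "ev r0 q0" by (auto simp: S_def)
    obtain r q where r: "r0 + 2 \<le> r" "ev r q" using evs by blast
    obtain r' q' where r': "r + 2 \<le> r'" "ev r' q'" using evs by blast
    have "q0 < (f^^r) z" using later[OF r0, of r] r by simp
    moreover have "(f^^r) z \<le> l" using up[OF r(2)] r(2) by (simp add: ev_def)
    ultimately have "\<bar>f ((f^^r) z) - f l\<bar> < c - l" using \<open>l - d < q0\<close> by (intro d) auto
    then have "l < (f^^Suc r) z" using fl by auto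
    moreover have "(f^^Suc r) z \<le> l" using apart[OF r(2) r'(2)] r'(1) up[OF r'(2)] by force
    ultimately show False by simp
  qed
  obtain q where "q \<in> S" "c - e < q"
    using less_cSup_iff[OF ne bdd, of "c - e"] \<open>0 < e\<close> lc by (auto simp: l_def)
  then obtain r where r: "ev r q" by (auto simp: S_def)
  have "c - e < (f^^k) z" if "r + 2 \<le> k" for k
    using later[OF r, of k] that \<open>c - e < q\<close> by simp
  then show ?thesis by blast
qed

lemma right_runs_imp_limsup:
  assumes tf: "tame f" and sep: "separates f c z"
    and "\<forall>N. \<exists>i\<ge>N. c < (f^^i) z \<and> c < (f^^Suc i) z"
    and "\<forall>N. \<exists>i\<ge>N. (f^^i) z < c" and "0 < e"
  shows "\<exists>N. \<forall>k\<ge>N. (f^^k) z < c + e"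
proof -
  have "\<exists>N. \<forall>k\<ge>N. - c - e < (mirror f^^k) (- z)"
    using assms(3-5)
    by (intro left_runs_imp_liminf[OF tame_mirror[OF tf] separates_mirror[OF sep]])
      (simp_all add: funpow_mirror del: funpow.simps)
  moreover have "- c - e < - x \<longleftrightarrow> x < c + e" for x by linarith
  ultimately show ?thesis by (simp add: funpow_mirror)
qed

lemma convergent_if_eventually_incseq:
  fixes X :: "nat \<Rightarrow> real"
  assumes "\<And>n. N \<le> n \<Longrightarrow> X n \<le> X (Suc n)" "\<And>n. N \<le> n \<Longrightarrow> X n \<le> B"
  shows "convergent X"
proof -
  have "incseq (\<lambda>n. X (n + N))" using assms(1) by (intro incseq_SucI) simp
  then have "convergent (\<lambda>n. X (n + N))"
    using assms(2) by (metis incseq_convergent convergentI le_add2)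
  then show ?thesis using convergent_ignore_initial_segment by blast
qed

lemma right_infinitely_often:
  assumes tf: "tame f" and sep: "separates f c z" and nc: "\<not> convergent (\<lambda>n. (f^^n) z)"
  shows "\<exists>i\<ge>N. c < (f^^i) z"
proof (rule ccontr)
  assume "\<not> ?thesis"
  then have "(f^^n) z \<le> (f^^Suc n) z" if "N \<le> n" for n
    using that sep unfolding separates_def by (meson linorder_not_less)
  moreover have "(f^^n) z \<le> 1" if "N + 1 \<le> n" for n
    using tame_funpow_bound[OF tf, of n z] that by auto
  ultimately show False
    using convergent_if_eventually_incseq[of "N + 1" "\<lambda>n. (f^^n) z" 1] nc by simp
qed

lemma convergent_mirror:
  fixes r :: "nat \<Rightarrow> nat"
  shows "convergent (\<lambda>n. (mirror f^^(r n)) (- z)) = convergent (\<lambda>n. (f^^(r n)) z)"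
  by (simp add: funpow_mirror convergent_minus_iff[symmetric])

lemma left_infinitely_often:
  assumes tf: "tame f" and sep: "separates f c z" and nc: "\<not> convergent (\<lambda>n. (f^^n) z)"
  shows "\<exists>i\<ge>N. (f^^i) z < c"
  using right_infinitely_often[OF tame_mirror[OF tf] separates_mirror[OF sep]]
    convergent_mirror[of "\<lambda>n. n" f z] nc by (simp add: funpow_mirror)

text \<open>Infinitely many runs on the left push the lower limit up to \<open>c\<close>. If there
  are infinitely many on the right as well, the orbit converges to \<open>c\<close>. Otherwise a
  late point right of \<open>c\<close> is the image of a point at or just left of \<open>c\<close>,
  and continuity at \<open>c\<close> again gives convergence.\<close>

lemma no_left_runs_eventually:
  assumes tf: "tame f" and sep: "separates f c z" and nc: "\<not> convergent (\<lambda>n. (f^^n) z)"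
  shows "\<exists>N. \<forall>n\<ge>N. \<not> ((f^^n) z < c \<and> (f^^Suc n) z < c)"
proof (rule ccontr)
  assume "\<not> ?thesis"
  then have LL: "\<forall>N. \<exists>n\<ge>N. (f^^n) z < c \<and> (f^^Suc n) z < c" by blast
  have fc: "f c = c" using sep by (simp add: separates_def)
  note low = left_runs_imp_liminf[OF tf sep LL allI[OF right_infinitely_often[OF tf sep nc]]]
  have "(\<lambda>n. (f^^n) z) \<longlonglongrightarrow> c"
  proof (rule LIMSEQ_real_I)
    fix e :: real assume e: "0 < e"
    show "\<exists>N. \<forall>n\<ge>N. \<bar>(f^^n) z - c\<bar> < e"
    proof (cases "\<forall>N. \<exists>i\<ge>N. c < (f^^i) z \<and> c < (f^^Suc i) z")
      case True
      obtain N1 where N1: "\<And>k. k \<ge> N1 \<Longrightarrow> c - e < (f^^k) z" using low[OF e] by blast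
      obtain N2 where N2: "\<And>k. k \<ge> N2 \<Longrightarrow> (f^^k) z < c + e"
        using right_runs_imp_limsup[OF tf sep True allI[OF left_infinitely_often[OF tf sep nc]] e] by blast
      show ?thesis using N1 N2 by (intro exI[of _ "max N1 N2"]) (auto simp: abs_less_iff algebra_simps)
    next
      case False
      then obtain N0 where N0: "\<And>i. N0 \<le> i \<Longrightarrow> \<not> (c < (f^^i) z \<and> c < (f^^Suc i) z)" by blast
      obtain d where d: "0 < d" "\<And>s. \<bar>s - c\<bar> < d \<Longrightarrow> \<bar>f s - f c\<bar> < e"
        using continuous_on_UNIV_delta[OF tame_continuous[OF tf] e] by blast
      obtain N1 where N1: "\<And>k. k \<ge> N1 \<Longrightarrow> c - min d e < (f^^k) z" using low[of "min d e"] d e by auto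
      have "\<bar>(f^^k) z - c\<bar> < e" if k: "k \<ge> Suc (max N0 N1)" for k
      proof (cases "c < (f^^k) z")
        case True
        obtain k' where k': "k = Suc k'" using k by (cases k) auto
        have "\<not> c < (f^^k') z" using N0[of k'] True k k' by auto
        then have "\<bar>(f^^k') z - c\<bar> < d" using N1[of k'] k k' by auto
        from d(2)[OF this] show ?thesis using k' fc by simp
      next
        case False
        moreover have "c - min d e < (f^^k) z" using N1[of k] k by simp
        ultimately show ?thesis by (simp add: min_def split: if_splits)
      qed
      then show ?thesis by blast
    qed
  qed
  then show False using nc by (auto simp: convergent_def)
qed

lemma no_right_runs_eventually:
  assumes tf: "tame f" and sep: "separates f c z" and nc: "\<not> convergent (\<lambda>n. (f^^n) z)"
  shows "\<exists>N. \<forall>n\<ge>N. \<not> (c < (f^^n) z \<and> c < (f^^Suc n) z)"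
  using no_left_runs_eventually[OF tame_mirror[OF tf] separates_mirror[OF sep]]
    convergent_mirror[of "\<lambda>n. n" f z] nc by (simp add: funpow_mirror del: funpow.simps)

definition alternates :: "(real \<Rightarrow> real) \<Rightarrow> real \<Rightarrow> nat \<Rightarrow> real \<Rightarrow> bool" where
  "alternates f c N z \<longleftrightarrow> f c = c \<and> (\<forall>n\<ge>N. (f^^n) z \<noteq> c \<and> ((f^^n) z < c \<longleftrightarrow> c < (f^^Suc n) z))"

lemma orbit_alternates:
  assumes tf: "tame f" and nc: "\<not> convergent (\<lambda>n. (f^^n) z)"
  obtains c N where "alternates f c N z"
proof -
  have "\<exists>i. (f^^i) z < (f^^Suc i) z"
  proof (rule ccontr)
    assume "\<not> ?thesis"
    then have "\<And>n. - (f^^n) z \<le> - (f^^Suc n) z" by (metis linorder_not_less neg_le_iff_le)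
    moreover have "\<And>n. n \<ge> 1 \<Longrightarrow> - (f^^n) z \<le> 1" using tame_funpow_bound[OF tf] by (auto simp: abs_le_iff)
    ultimately have "convergent (\<lambda>n. - (f^^n) z)"
      using convergent_if_eventually_incseq[of 1 "\<lambda>n. - (f^^n) z" 1] by blast
    then show False using nc by (simp add: convergent_minus_iff[symmetric])
  qed
  moreover have "\<exists>i. (f^^Suc i) z < (f^^i) z"
  proof (rule ccontr)
    assume "\<not> ?thesis"
    then have "\<And>n. (f^^n) z \<le> (f^^Suc n) z" by (metis linorder_not_less)
    moreover have "\<And>n. n \<ge> 1 \<Longrightarrow> (f^^n) z \<le> 1" using tame_funpow_bound[OF tf] by (auto simp: abs_le_iff)
    ultimately have "convergent (\<lambda>n. (f^^n) z)"
      using convergent_if_eventually_incseq[of 1 "\<lambda>n. (f^^n) z" 1] by blast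
    then show False using nc by simp
  qed
  ultimately obtain c where sep: "separates f c z" using separating_fixed_point[OF tf] by blast
  then have fc: "f c = c" by (simp add: separates_def)
  have ne: "(f^^n) z \<noteq> c" for n
  proof
    assume "(f^^n) z = c"
    then have "(f^^(k + n)) z = c" for k
      using funpow_apply[of k f n z] funpow_fixed[where f=f, OF fc] by simp
    then have "(\<lambda>k. (f^^(k + n)) z) \<longlonglongrightarrow> c" by simp
    then have "(\<lambda>k. (f^^k) z) \<longlonglongrightarrow> c" by (rule LIMSEQ_offset)
    then show False using nc by (auto simp: convergent_def)
  qed
  obtain N1 where N1: "\<And>n. n \<ge> N1 \<Longrightarrow> \<not> ((f^^n) z < c \<and> (f^^Suc n) z < c)"
    using no_left_runs_eventually[OF tf sep nc] by blast
  obtain N2 where N2: "\<And>n. n \<ge> N2 \<Longrightarrow> \<not> (c < (f^^n) z \<and> c < (f^^Suc n) z)"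
    using no_right_runs_eventually[OF tf sep nc] by blast
  have "alternates f c (max N1 N2) z"
    unfolding alternates_def
  proof (intro conjI allI impI fc ne)
    fix n assume n: "max N1 N2 \<le> n"
    show "((f^^n) z < c) = (c < (f^^Suc n) z)"
      using N1[of n] N2[of n] n ne[of n] ne[of "Suc n"] by force
  qed
  then show ?thesis by (rule that)
qed

section \<open>Limit sets and their convex hulls\<close>

lemma omega_limit_iff:
  "y \<in> omega_limit g z \<longleftrightarrow> (\<forall>e>0. \<forall>N. \<exists>n\<ge>N. \<bar>(g^^n) z - y\<bar> < e)"
proof
  assume "y \<in> omega_limit g z"
  then obtain r where r: "strict_mono r" "(\<lambda>n. (g^^(r n)) z) \<longlonglongrightarrow> y" by (auto simp: omega_limit_def)
  show "\<forall>e>0. \<forall>N. \<exists>n\<ge>N. \<bar>(g^^n) z - y\<bar> < e"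
  proof (intro allI impI)
    fix e :: real and N :: nat assume "0 < e"
    then obtain M where M: "\<And>n. n \<ge> M \<Longrightarrow> \<bar>(g^^(r n)) z - y\<bar> < e"
      using r(2) by (auto simp: LIMSEQ_def dist_real_def)
    show "\<exists>n\<ge>N. \<bar>(g^^n) z - y\<bar> < e"
      using M[of "max M N"] seq_suble[OF r(1), of "max M N"] by (intro exI[of _ "r (max M N)"]) auto
  qed
next
  assume h: "\<forall>e>0. \<forall>N. \<exists>n\<ge>N. \<bar>(g^^n) z - y\<bar> < e"
  have "\<exists>r. \<forall>n. \<bar>(g^^(r n)) z - y\<bar> < inverse (Suc n) \<and> r n < r (Suc n)"
  proof (rule dependent_nat_choice)
    show "\<exists>x. \<bar>(g^^x) z - y\<bar> < inverse (Suc 0)" using h[rule_format, of 1 0] by auto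
  next
    fix x n
    show "\<exists>y'. \<bar>(g^^y') z - y\<bar> < inverse (real (Suc (Suc n))) \<and> x < y'"
      using h[rule_format, of "inverse (real (Suc (Suc n)))" "Suc x"] by auto
  qed
  then obtain r where r: "\<And>n. \<bar>(g^^(r n)) z - y\<bar> < inverse (Suc n)" "\<And>n. r n < r (Suc n)" by blast
  have "strict_mono r" using r(2) by (simp add: strict_mono_Suc_iff)
  moreover have "(\<lambda>n. (g^^(r n)) z) \<longlonglongrightarrow> y"
  proof (rule LIM_zero_cancel, rule Lim_null_comparison)
    show "\<forall>\<^sub>F n in sequentially. norm ((g^^(r n)) z - y) \<le> inverse (real (Suc n))"
      using r(1) by (auto intro: always_eventually less_imp_le)
    show "(\<lambda>n. inverse (real (Suc n))) \<longlonglongrightarrow> 0" by (rule LIMSEQ_inverse_real_of_nat)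
  qed
  ultimately show "y \<in> omega_limit g z" by (auto simp: omega_limit_def)
qed

lemma omega_limitD: "y \<in> omega_limit g z \<Longrightarrow> 0 < e \<Longrightarrow> \<exists>n\<ge>N. \<bar>(g^^n) z - y\<bar> < e"
  by (simp add: omega_limit_iff)

definition ord_hull :: "real set \<Rightarrow> real set" where
  "ord_hull S = {t. \<exists>a\<in>S. \<exists>b\<in>S. a \<le> t \<and> t \<le> b}"

text \<open>The even orbit alternates under \<open>f^^2\<close> around a second fixed point \<open>c'\<close> of \<open>f^^2\<close>. A preimage of
  \<open>c\<close> inside the hull would be passed by this alternation from the side of \<open>c\<close>.\<close>

lemma hull_no_preimage:
  assumes tf: "tame f" and nc: "\<And>i. \<not> convergent (\<lambda>n. (f^^(2 * n + i)) z)"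
    and alt: "alternates f c N z" and N: "even N" "(f^^N) z < c"
    and t: "t \<in> ord_hull (omega_limit (f^^2) z)"
  shows "(f^^j) t \<noteq> c"
proof
  assume jt: "(f^^j) t = c"
  define y where "y n = (f^^(2 * n + N)) z" for n
  have fc: "f c = c" using alt by (simp add: alternates_def)
  have step: "(f^^k) z < c \<longleftrightarrow> c < (f^^Suc k) z" "(f^^k) z \<noteq> c" if "N \<le> k" for k
    using alt that by (auto simp: alternates_def)
  have yc: "y n < c" for n
  proof (induction n)
    case (Suc n)
    then have "c < (f^^Suc (2 * n + N)) z" using step(1)[of "2 * n + N"] by (simp add: y_def)
    then have "\<not> (c < (f^^Suc (Suc (2 * n + N))) z)" using step(1)[of "Suc (2 * n + N)"] by force
    moreover have "(f^^Suc (Suc (2 * n + N))) z \<noteq> c" by (intro step) simp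
    moreover have "2 * Suc n + N = Suc (Suc (2 * n + N))" by simp
    ultimately show ?case unfolding y_def by (metis not_less_iff_gr_or_eq)
  qed (use N in \<open>simp add: y_def\<close>)
  have tg: "tame (f^^2)" using tame_funpow[OF tf, of 2] by simp
  have gy: "((f^^2)^^k) (y n) = y (k + n)" for k n
    by (simp add: y_def funpow_mult funpow_apply algebra_simps)
  have y0: "((f^^2)^^k) (y 0) = y k" for k using gy[of k 0] by simp
  have "\<not> convergent (\<lambda>n. ((f^^2)^^n) (y 0))" unfolding y0 using nc[of N] by (simp add: y_def)
  then obtain c' M0 where alt2: "alternates (f^^2) c' M0 (y 0)" using orbit_alternates[OF tg] by blast
  then have ys: "y k < c' \<longleftrightarrow> c' < y (Suc k)" "y k \<noteq> c'" if "M0 \<le> k" for k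
    using that unfolding alternates_def y0 by auto
  obtain M where M: "M0 \<le> M" "c' < y M"
    using ys[of M0] ys[of "Suc M0"] by (metis le_SucI linorder_neqE_linordered_idom order.refl)
  have cc: "c' < c" using M yc[of M] by simp
  have next_left: "y (Suc m) < c'" if "M0 \<le> m" "c' < y m" for m
    using ys[of m] ys[of "Suc m"] that by force
  have later: "\<exists>m>K. \<bar>y m - a\<bar> < e" if ae: "a \<in> omega_limit (f^^2) z" "0 < e" for a e K
  proof -
    obtain n where n: "n \<ge> Suc (K + N div 2)" "\<bar>((f^^2)^^n) z - a\<bar> < e"
      using omega_limitD[OF ae] by blast
    have "2 * n = 2 * (n - N div 2) + N" using n N by auto
    then have "((f^^2)^^n) z = y (n - N div 2)" unfolding y_def funpow_mult by simp
    then show ?thesis using n by (intro exI[of _ "n - N div 2"]) auto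
  qed
  \<comment> \<open>Orbit points near \<open>t\<close> would be sent near \<open>c\<close>, hence
    right of \<open>c'\<close>, after \<open>j\<close> and after \<open>Suc j\<close> steps of
    \<open>f^^2\<close>, because \<open>c\<close> is fixed. Two consecutive points right of
    \<open>c'\<close> contradict the alternation of \<open>y\<close> around
    \<open>c'\<close>.\<close>
  have not_omega: "t \<notin> omega_limit (f^^2) z"
  proof
    assume to: "t \<in> omega_limit (f^^2) z"
    have "((f^^2)^^j) t = (f^^j) ((f^^j) t)" by (simp add: funpow_mult funpow_apply mult_2)
    then have g1: "((f^^2)^^j) t = c" using jt funpow_fixed[where f=f, OF fc] by simp
    then have g2: "((f^^2)^^Suc j) t = c" using fc by (simp add: numeral_2_eq_2)
    obtain d1 where d1: "0 < d1" "\<And>s. \<bar>s - t\<bar> < d1 \<Longrightarrow> \<bar>((f^^2)^^j) s - c\<bar> < c - c'"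
      using continuous_on_UNIV_delta[OF tame_funpow_continuous[OF tg, of _ j], of "c - c'" t] cc g1
      by (metis diff_gt_0_iff_gt)
    obtain d2 where d2: "0 < d2" "\<And>s. \<bar>s - t\<bar> < d2 \<Longrightarrow> \<bar>((f^^2)^^Suc j) s - c\<bar> < c - c'"
      using continuous_on_UNIV_delta[OF tame_funpow_continuous[OF tg, of _ "Suc j"], of "c - c'" t] cc g2
      by (metis diff_gt_0_iff_gt)
    obtain m where m: "m > M0" "\<bar>y m - t\<bar> < min d1 d2" using later[OF to, of "min d1 d2" M0] d1 d2 by auto
    have "\<bar>y (j + m) - c\<bar> < c - c'" using d1(2)[of "y m"] m gy[of j m] by simp
    moreover have "\<bar>y (Suc j + m) - c\<bar> < c - c'" using d2(2)[of "y m"] m gy[of "Suc j" m] by simp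
    ultimately show False using ys(1)[of "j + m"] next_left[of "j + m"] m by auto
  qed
  obtain a b where ab: "a \<in> omega_limit (f^^2) z" "b \<in> omega_limit (f^^2) z" "a \<le> t" "t \<le> b"
    using t by (auto simp: ord_hull_def)
  have ne: "a \<noteq> t" "b \<noteq> t" using ab not_omega by auto
  have fy: "(f^^(2 * k)) (y n) = y (k + n)" for k n using gy[of k n] by (simp add: funpow_mult)
  show False
  \<comment> \<open>If \<open>t \<le> c'\<close>, then \<open>y M\<close> lies between
    \<open>t\<close> and \<open>c\<close>, and the orbit later gets near \<open>a < t\<close>. If
    \<open>c' < t\<close>, a visit near \<open>b\<close> lies between \<open>t\<close> and
    \<open>c\<close>, and the next even point is left of \<open>c'\<close>. Either way the preimage
    \<open>t\<close> of \<open>c\<close> is passed from the inside.\<close>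
  proof (cases "t \<le> c'")
    case True
    obtain m where m: "m > M" "\<bar>y m - a\<bar> < t - a" using later[OF ab(1), of "t - a" M] ab ne by auto
    have "(f^^(2 * (m - M))) (y M) \<le> t" using m fy[of "m - M" M] by simp
    then show False using no_homoclinic_left[OF tf fc, of t "y M" j] True M yc jt by force
  next
    case False
    obtain m where m: "m > M" "\<bar>y m - b\<bar> < b - t" using later[OF ab(2), of "b - t" M] ab ne by auto
    then have "t < y m" by linarith
    moreover have "(f^^2) (y m) \<le> t" using fy[of 1 m] next_left[of m] m False M \<open>t < y m\<close> by auto
    ultimately show False using no_homoclinic_left[OF tf fc, of t "y m" j 2] yc jt by blast
  qed
qed

text \<open>Limit points inherit weak inequalities from the orbit, and
  \<open>hull_no_preimage\<close> makes them strict. Any \<open>t\<close> in the hull is joined to a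
  limit point \<open>a\<close> by a segment inside the hull; no iterate attains \<open>c\<close> on
  it, so \<open>t\<close> stays on the side of \<open>a\<close> at all times.\<close>

lemma hull_alternates_left:
  assumes tf: "tame f" and nc: "\<And>i. \<not> convergent (\<lambda>n. (f^^(2 * n + i)) z)"
    and alt: "alternates f c N z" and N: "even N" "(f^^N) z < c"
    and t: "t \<in> ord_hull (omega_limit (f^^2) z)"
  shows "(f^^(2 * j)) t < c" "c < (f^^(2 * j + 1)) t"
proof -
  note no = hull_no_preimage[OF tf nc alt N]
  have step: "(f^^k) z < c \<longleftrightarrow> c < (f^^Suc k) z" "(f^^k) z \<noteq> c" if "N \<le> k" for k
    using alt that by (auto simp: alternates_def)
  have side: "if even n then (f^^(n + N)) z < c else c < (f^^(n + N)) z" for n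
  proof (induction n)
    case (Suc n)
    then show ?case using step[of "n + N"] step[of "Suc n + N"] by (auto split: if_splits)
  qed (use N in simp)
  obtain a where a: "a \<in> omega_limit (f^^2) z" "a \<le> t" using t by (auto simp: ord_hull_def)
  have seg: "s \<in> ord_hull (omega_limit (f^^2) z)" if "a \<le> s" "s \<le> t" for s
    using t a that unfolding ord_hull_def by (auto intro: order.trans)
  have near: "\<exists>n. even n \<and> \<bar>(f^^(n + N)) z - a\<bar> < e" if e: "0 < e" for e
  proof -
    obtain n where n: "n \<ge> N" "\<bar>((f^^2)^^n) z - a\<bar> < e" using omega_limitD[OF a(1) e] by blast
    then have "2 * n = (2 * n - N) + N" by simp
    then show ?thesis using n N by (intro exI[of _ "2 * n - N"]) (auto simp: funpow_mult)
  qed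
  have image: "\<exists>n. even n \<and> \<bar>(f^^(i + n + N)) z - (f^^i) a\<bar> < e" if e: "0 < e" for i e
  proof -
    obtain d where "0 < d" "\<And>s. \<bar>s - a\<bar> < d \<Longrightarrow> \<bar>(f^^i) s - (f^^i) a\<bar> < e"
      using continuous_on_UNIV_delta[OF tame_funpow_continuous[OF tf] e] by blast
    then show ?thesis using near[of d] by (force simp: funpow_apply add.assoc)
  qed
  have ea: "(f^^i) a < c" if i: "even i" for i
  proof (rule ccontr)
    assume "\<not> ?thesis"
    then have "0 < (f^^i) a - c" using no[of a i] seg[of a] a by auto
    from image[OF this, of i] obtain n where "even n" "\<bar>(f^^(i + n + N)) z - (f^^i) a\<bar> < (f^^i) a - c" by blast
    then show False using side[of "i + n"] i by auto
  qed
  have oa: "c < (f^^i) a" if i: "odd i" for i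
  proof (rule ccontr)
    assume "\<not> ?thesis"
    then have "0 < c - (f^^i) a" using no[of a i] seg[of a] a by auto
    from image[OF this, of i] obtain n where "even n" "\<bar>(f^^(i + n + N)) z - (f^^i) a\<bar> < c - (f^^i) a" by blast
    then show False using side[of "i + n"] i by auto
  qed
  have no_seg: "(f^^i) s \<noteq> c" if "a \<le> s" "s \<le> t" for i s using no seg that by blast
  show "(f^^(2 * j)) t < c"
  proof (rule ccontr)
    assume "\<not> ?thesis"
    then have h: "(f^^(2 * j)) a \<le> c \<and> c \<le> (f^^(2 * j)) t" using ea[of "2 * j"] by auto
    show False
      by (rule ivt_between[OF tame_funpow_continuous[OF tf], of "2 * j" a c t]) (use h a no_seg in \<open>auto simp del: funpow.simps\<close>)
  qed
  show "c < (f^^(2 * j + 1)) t"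
  proof (rule ccontr)
    assume "\<not> ?thesis"
    then have h: "(f^^(2 * j + 1)) t \<le> c \<and> c \<le> (f^^(2 * j + 1)) a" using oa[of "2 * j + 1"] by auto
    show False
      by (rule ivt_between[OF tame_funpow_continuous[OF tf], of "2 * j + 1" a c t]) (use h a no_seg in \<open>auto simp del: funpow.simps\<close>)
  qed
qed

lemma omega_limit_mirror:
  "a \<in> omega_limit (mirror f ^^ k) (- z) \<longleftrightarrow> - a \<in> omega_limit (f^^k) z"
proof -
  have "\<bar>- x - a\<bar> = \<bar>x + a\<bar>" for x :: real by linarith
  then show ?thesis by (simp add: omega_limit_iff funpow_mult funpow_mirror)
qed

lemma ord_hull_mirror:
  "t \<in> ord_hull (omega_limit (mirror f ^^ k) (- z)) \<longleftrightarrow> - t \<in> ord_hull (omega_limit (f^^k) z)"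
proof -
  have "(\<exists>a\<in>omega_limit (mirror f ^^ k) (- z). P a) \<longleftrightarrow> (\<exists>a\<in>omega_limit (f^^k) z. P (- a))" for P
    by (metis minus_minus omega_limit_mirror)
  then show ?thesis by (auto simp: ord_hull_def) (metis minus_le_iff le_minus_iff)+
qed

lemma hull_alternates:
  assumes tf: "tame f" and nc: "\<And>i. \<not> convergent (\<lambda>n. (f^^(2 * n + i)) z)"
  obtains c where "f c = c"
    "(\<forall>t\<in>ord_hull (omega_limit (f^^2) z). \<forall>j. (f^^(2 * j)) t < c \<and> c < (f^^(2 * j + 1)) t) \<or>
     (\<forall>t\<in>ord_hull (omega_limit (f^^2) z). \<forall>j. c < (f^^(2 * j)) t \<and> (f^^(2 * j + 1)) t < c)"
proof -
  have "\<not> convergent (\<lambda>n. (f^^n) z)"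
  proof
    assume "convergent (\<lambda>n. (f^^n) z)"
    then obtain L where "(\<lambda>n. (f^^n) z) \<longlonglongrightarrow> L" by (auto simp: convergent_def)
    from LIMSEQ_subseq_LIMSEQ[OF this, of "\<lambda>n. 2 * n"]
    show False using nc[of 0] by (auto simp: strict_mono_def o_def convergent_def)
  qed
  then obtain c N0 where alt0: "alternates f c N0 z" using orbit_alternates[OF tf] by blast
  define N where "N = 2 * N0"
  have alt: "alternates f c N z" using alt0 unfolding alternates_def N_def by auto
  have fc: "f c = c" and ne: "(f^^N) z \<noteq> c" using alt by (auto simp: alternates_def)
  have eN: "even N" by (simp add: N_def)
  show ?thesis
  proof (cases "(f^^N) z < c")
    case True
    then show ?thesis using hull_alternates_left[OF tf nc alt eN True] fc that[of c] by blast
  next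
    case False
    have alt': "alternates (mirror f) (- c) N (- z)"
      using alt unfolding alternates_def funpow_mirror mirror_def by (auto simp: not_less)
        (metis funpow.simps(2) comp_apply linorder_neqE_linordered_idom not_less_iff_gr_or_eq le_SucI)+
    have nc': "\<not> convergent (\<lambda>n. (mirror f ^^(2 * n + i)) (- z))" for i
      using nc[of i] by (simp add: convergent_mirror)
    have "(mirror f ^^ N) (- z) < - c" using False ne by (simp add: funpow_mirror)
    note * = hull_alternates_left[OF tame_mirror[OF tf] nc' alt' eN this]
    have "c < (f^^(2 * j)) t \<and> (f^^(2 * j + 1)) t < c" if "t \<in> ord_hull (omega_limit (f^^2) z)" for t j
      using *[of "- t" j] that by (simp add: ord_hull_mirror funpow_mirror del: funpow.simps)
    then show ?thesis using fc that[of c] by blast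
  qed
qed

section \<open>Limit sets along residue classes\<close>

definition omega_class :: "(real \<Rightarrow> real) \<Rightarrow> real \<Rightarrow> nat \<Rightarrow> nat \<Rightarrow> real set" where
  "omega_class f z k i = omega_limit (f^^(2^k)) ((f^^i) z)"

text \<open>Only periods that are powers of two are excluded. For tame maps this already amounts to
  an infinite limit set, as \<open>nonperiodic_if_infinite_omega\<close> and
  \<open>infinite_omega_if_nonperiodic\<close> show.\<close>

definition nonperiodic :: "(real \<Rightarrow> real) \<Rightarrow> real \<Rightarrow> bool" where
  "nonperiodic f z \<longleftrightarrow> (\<forall>k i. \<not> convergent (\<lambda>n. (f^^(2^k * n + i)) z))"

lemma omega_class_iff:
  "a \<in> omega_class f z k i \<longleftrightarrow> (\<forall>e>0. \<forall>N. \<exists>n\<ge>N. n mod 2^k = i mod 2^k \<and> \<bar>(f^^n) z - a\<bar> < e)"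
proof
  assume a: "a \<in> omega_class f z k i"
  show "\<forall>e>0. \<forall>N. \<exists>n\<ge>N. n mod 2^k = i mod 2^k \<and> \<bar>(f^^n) z - a\<bar> < e"
  proof (intro allI impI)
    fix e :: real and N :: nat assume e: "0 < e"
    obtain n where n: "n \<ge> N" "\<bar>((f^^(2^k))^^n) ((f^^i) z) - a\<bar> < e"
      using omega_limitD[OF a[unfolded omega_class_def] e] by blast
    have "N \<le> 2^k * n + i"
      using n(1) by (metis add_leE le_add1 mult_le_mono1 nat_mult_1 one_le_numeral one_le_power order.trans trans_le_add1)
    then show "\<exists>n\<ge>N. n mod 2^k = i mod 2^k \<and> \<bar>(f^^n) z - a\<bar> < e"
      using n(2) by (intro exI[of _ "2^k * n + i"]) (simp add: funpow_mult funpow_apply)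
  qed
next
  assume h: "\<forall>e>0. \<forall>N. \<exists>n\<ge>N. n mod 2^k = i mod 2^k \<and> \<bar>(f^^n) z - a\<bar> < e"
  show "a \<in> omega_class f z k i"
    unfolding omega_class_def omega_limit_iff
  proof (intro allI impI)
    fix e :: real and N :: nat assume "0 < e"
    then obtain n where n: "n \<ge> 2^k * N + i" "n mod 2^k = i mod 2^k" "\<bar>(f^^n) z - a\<bar> < e" using h by blast
    then have "2^k dvd n - i" by (simp add: mod_eq_dvd_iff_nat)
    then obtain m where m: "n - i = 2^k * m" by (rule dvdE)
    then have nm: "n = 2^k * m + i" using n(1) by simp
    then have "N \<le> m" using n(1) by simp
    then show "\<exists>n\<ge>N. \<bar>((f^^(2^k))^^n) ((f^^i) z) - a\<bar> < e"
      using n(3) nm by (intro exI[of _ m]) (simp add: funpow_mult funpow_apply)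
  qed
qed

lemma omega_classD: "a \<in> omega_class f z k i \<Longrightarrow> 0 < e \<Longrightarrow> \<exists>n\<ge>N. n mod 2^k = i mod 2^k \<and> \<bar>(f^^n) z - a\<bar> < e"
  by (simp add: omega_class_iff)

lemma omega_class_cong: "i mod 2^k = j mod 2^k \<Longrightarrow> omega_class f z k i = omega_class f z k j"
  by (auto simp: omega_class_iff)

lemma mod_power2_mono: "k \<le> l \<Longrightarrow> i mod 2^l = j mod 2^l \<Longrightarrow> i mod 2^k = (j::nat) mod 2^k"
  by (metis le_imp_power_dvd mod_mod_cancel)

lemma mod_add_rcancel_nat:
  fixes a b j m :: nat
  assumes "(a + j) mod m = (b + j) mod m" shows "a mod m = b mod m"
proof (cases "a \<le> b")
  case True
  then show ?thesis using assms mod_eq_dvd_iff_nat[of "a + j" "b + j" m] mod_eq_dvd_iff_nat[of a b m] by auto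
next
  case False
  then show ?thesis using assms mod_eq_dvd_iff_nat[of "b + j" "a + j" m] mod_eq_dvd_iff_nat[of b a m] by auto
qed

lemma omega_class_mono: "k \<le> l \<Longrightarrow> omega_class f z l i \<subseteq> omega_class f z k i"
  unfolding subset_iff omega_class_iff by (meson mod_power2_mono)

lemma omega_class_bounded:
  assumes "tame f" "a \<in> omega_class f z k i" shows "\<bar>a\<bar> \<le> 1"
proof (rule ccontr)
  assume "\<not> ?thesis"
  then obtain n where "n \<ge> 1" "\<bar>(f^^n) z - a\<bar> < \<bar>a\<bar> - 1" using omega_classD[OF assms(2), of "\<bar>a\<bar> - 1" 1] by auto
  then show False using tame_funpow_bound[OF assms(1), of n z] by linarith
qed

lemma omega_class_closed:
  assumes "\<And>e. 0 < e \<Longrightarrow> \<exists>b\<in>omega_class f z k i. \<bar>b - a\<bar> < e"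
  shows "a \<in> omega_class f z k i"
  unfolding omega_class_iff
proof (intro allI impI)
  fix e :: real and N :: nat assume e: "0 < e"
  then obtain b where b: "b \<in> omega_class f z k i" "\<bar>b - a\<bar> < e / 2" using assms[of "e / 2"] by auto
  obtain n where n: "n \<ge> N" "n mod 2^k = i mod 2^k" "\<bar>(f^^n) z - b\<bar> < e / 2"
    using omega_classD[OF b(1), of "e / 2" N] e by auto
  have "\<bar>(f^^n) z - a\<bar> < e" using n(3) b(2) by linarith
  then show "\<exists>n\<ge>N. n mod 2^k = i mod 2^k \<and> \<bar>(f^^n) z - a\<bar> < e" using n by blast
qed

lemma omega_class_image:
  assumes tf: "tame f" and a: "a \<in> omega_class f z k i"
  shows "(f^^j) a \<in> omega_class f z k (i + j)"
  unfolding omega_class_iff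
proof (intro allI impI)
  fix e :: real and N :: nat assume e: "0 < e"
  obtain d where d: "0 < d" "\<And>s. \<bar>s - a\<bar> < d \<Longrightarrow> \<bar>(f^^j) s - (f^^j) a\<bar> < e"
    using continuous_on_UNIV_delta[OF tame_funpow_continuous[OF tf] e] by blast
  obtain n where n: "n \<ge> N" "n mod 2^k = i mod 2^k" "\<bar>(f^^n) z - a\<bar> < d"
    using omega_classD[OF a d(1)] by blast
  have "(j + n) mod 2^k = (i + j) mod 2^k" using n(2) by (metis add.commute mod_add_left_eq)
  then show "\<exists>n\<ge>N. n mod 2^k = (i + j) mod 2^k \<and> \<bar>(f^^n) z - (f^^j) a\<bar> < e"
    using d(2)[OF n(3)] n(1) by (intro exI[of _ "j + n"]) (auto simp: funpow_apply)
qed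

lemma orbit_cluster_point:
  assumes tf: "tame f" and P: "\<And>N. \<exists>n\<ge>N. P n"
  obtains a where "\<And>e N. 0 < e \<Longrightarrow> \<exists>n\<ge>N. P n \<and> \<bar>(f^^n) z - a\<bar> < e"
proof -
  have inf: "infinite {n. P n}" using P by (auto simp: infinite_nat_iff_unbounded_le)
  \<comment> \<open>Reading the enumeration from index 1 makes all times positive: only from time 1
    on is the orbit known to be in \<open>[-1, 1]\<close>.\<close>
  define r where "r n = enumerate {n. P n} (Suc n)" for n
  have r: "strict_mono r" unfolding r_def strict_mono_Suc_iff
    using inf enumerate_step by blast
  have Pr: "P (r n)" for n unfolding r_def using enumerate_in_set[OF inf] by auto
  have "1 \<le> r n" for n unfolding r_def using le_enumerate[OF inf, of "Suc n"] by simp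
  then have b: "(f^^(r n)) z \<in> {-1..1}" for n using tame_funpow_bound[OF tf, of "r n" z] by (auto simp: abs_le_iff)
  obtain a s where s: "strict_mono s" "((\<lambda>n. (f^^(r n)) z) \<circ> s) \<longlonglongrightarrow> a"
    using compact_imp_seq_compact[OF compact_Icc, of "-1::real" 1] b unfolding seq_compact_def by metis
  show ?thesis
  proof (rule that)
    fix e :: real and N :: nat assume "0 < e"
    then obtain M where M: "\<And>n. n \<ge> M \<Longrightarrow> \<bar>(f^^(r (s n))) z - a\<bar> < e"
      using s(2) by (auto simp: LIMSEQ_def dist_real_def)
    have "N \<le> r (s (max M N))"
      using seq_suble[OF r, of "s (max M N)"] seq_suble[OF s(1), of "max M N"] by linarith
    then show "\<exists>n\<ge>N. P n \<and> \<bar>(f^^n) z - a\<bar> < e" using M[of "max M N"] Pr by auto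
  qed
qed

lemma omega_class_eventually:
  assumes tf: "tame f" and U: "open U" "omega_class f z k i \<subseteq> U"
  shows "\<exists>N. \<forall>n\<ge>N. n mod 2^k = i mod 2^k \<longrightarrow> (f^^n) z \<in> U"
proof (rule ccontr)
  assume "\<not> ?thesis"
  then have P: "\<exists>n\<ge>N. n mod 2^k = i mod 2^k \<and> (f^^n) z \<notin> U" for N by blast
  obtain a where a: "\<And>e N. 0 < e \<Longrightarrow> \<exists>n\<ge>N. (n mod 2^k = i mod 2^k \<and> (f^^n) z \<notin> U) \<and> \<bar>(f^^n) z - a\<bar> < e"
    using orbit_cluster_point[OF tf, of "\<lambda>n. n mod 2^k = i mod 2^k \<and> (f^^n) z \<notin> U" z] P by metis
  then have "a \<in> omega_class f z k i" unfolding omega_class_iff by blast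
  then obtain e where e: "0 < e" "\<And>s. \<bar>s - a\<bar> < e \<Longrightarrow> s \<in> U"
    using U unfolding open_dist dist_real_def by blast
  then show False using a[OF e(1), of 0] by blast
qed

text \<open>If \<open>f^^j\<close> misses \<open>b\<close> on the class, compactness keeps it at
  distance more than some \<open>d\<close> from \<open>b\<close>. This persists on a neighbourhood
  of the class, hence at all late times congruent to \<open>i\<close>, whereas the orbit returns
  near \<open>b\<close> at times congruent to \<open>i + j\<close>.\<close>

lemma omega_class_preimage:
  assumes tf: "tame f" and b: "b \<in> omega_class f z k (i + j)"
  obtains a where "a \<in> omega_class f z k i" "(f^^j) a = b"
proof -
  have "\<exists>a\<in>omega_class f z k i. (f^^j) a = b"
  proof (rule ccontr)
    assume no: "\<not> ?thesis"
    have "\<exists>d>0. omega_class f z k i \<subseteq> {t. d < \<bar>(f^^j) t - b\<bar>}"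
    proof (rule ccontr)
      assume "\<not> ?thesis"
      then have near: "\<exists>a\<in>omega_class f z k i. \<bar>(f^^j) a - b\<bar> \<le> d" if "0 < d" for d
        using that by (force simp: not_less)
      have "\<forall>n. \<exists>a. a \<in> omega_class f z k i \<and> \<bar>(f^^j) a - b\<bar> \<le> inverse (Suc n)"
      proof
        fix n show "\<exists>a. a \<in> omega_class f z k i \<and> \<bar>(f^^j) a - b\<bar> \<le> inverse (Suc n)"
          using near[of "inverse (Suc n)"] by auto
      qed
      then obtain x where x: "\<And>n. x n \<in> omega_class f z k i" "\<And>n. \<bar>(f^^j) (x n) - b\<bar> \<le> inverse (Suc n)" by metis
      have "x n \<in> {-1..1}" for n using omega_class_bounded[OF tf x(1)[of n]] by (auto simp: abs_le_iff)
      then obtain a s where s: "strict_mono s" "(x \<circ> s) \<longlonglongrightarrow> a"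
        using compact_imp_seq_compact[OF compact_Icc, of "-1::real" 1] unfolding seq_compact_def by metis
      have "a \<in> omega_class f z k i"
      proof (rule omega_class_closed)
        fix e :: real assume "0 < e"
        then obtain n where "\<bar>x (s n) - a\<bar> < e" using s(2) by (auto simp: LIMSEQ_def dist_real_def)
        then show "\<exists>b\<in>omega_class f z k i. \<bar>b - a\<bar> < e" using x(1) by blast
      qed
      moreover have "(f^^j) a = b"
      proof (rule LIMSEQ_unique)
        show "(\<lambda>n. (f^^j) ((x \<circ> s) n)) \<longlonglongrightarrow> (f^^j) a"
          by (rule continuous_on_tendsto_compose[OF tame_funpow_continuous[OF tf, of UNIV] s(2)]) auto
        show "(\<lambda>n. (f^^j) ((x \<circ> s) n)) \<longlonglongrightarrow> b"
        proof (rule LIM_zero_cancel, rule Lim_null_comparison)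
          show "\<forall>\<^sub>F n in sequentially. norm ((f^^j) ((x \<circ> s) n) - b) \<le> inverse (real (Suc n))"
          proof (rule always_eventually, rule allI)
            fix n
            have "\<bar>(f^^j) (x (s n)) - b\<bar> \<le> inverse (Suc (s n))" by (rule x(2))
            also have "\<dots> \<le> inverse (Suc n)" using seq_suble[OF s(1), of n] by (simp add: le_imp_inverse_le)
            finally show "norm ((f^^j) ((x \<circ> s) n) - b) \<le> inverse (real (Suc n))" by simp
          qed
          show "(\<lambda>n. inverse (real (Suc n))) \<longlonglongrightarrow> 0" by (rule LIMSEQ_inverse_real_of_nat)
        qed
      qed
      ultimately show False using no by blast
    qed
    then obtain d where d: "0 < d" "omega_class f z k i \<subseteq> {t. d < \<bar>(f^^j) t - b\<bar>}" by blast
    have "open {t. d < \<bar>(f^^j) t - b\<bar>}"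
      by (intro open_Collect_less tame_funpow_continuous[OF tf] continuous_intros)
    from omega_class_eventually[OF tf this d(2)] obtain N where
      N: "\<And>n. n \<ge> N \<Longrightarrow> n mod 2^k = i mod 2^k \<Longrightarrow> d < \<bar>(f^^j) ((f^^n) z) - b\<bar>" by auto
    obtain n where n: "n \<ge> N + j" "n mod 2^k = (i + j) mod 2^k" "\<bar>(f^^n) z - b\<bar> < d"
      using omega_classD[OF b d(1)] by blast
    have "(n - j + j) mod 2^k = (i + j) mod 2^k" using n by simp
    then have "(n - j) mod 2^k = i mod 2^k" by (rule mod_add_rcancel_nat)
    moreover have "N \<le> n - j" using n(1) by simp
    ultimately show False using N[of "n - j"] n by (simp add: funpow_apply)
  qed
  then show ?thesis using that by blast
qed

section \<open>Separation of the portions\<close>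

text \<open>Alternation at level \<open>l\<close> concerns odd multiples of \<open>2^l\<close>; this
  decomposition assigns a level to each positive time.\<close>

lemma power2_times_odd:
  assumes "1 \<le> (e::nat)" obtains l j where "e = 2^l * (2 * j + 1)"
proof -
  have "\<exists>l j. e = 2^l * (2 * j + 1)" using assms
  proof (induction e rule: less_induct)
    case (less e)
    show ?case
    proof (cases "even e")
      case True
      then obtain d where d: "e = 2 * d" by blast
      then obtain l j where "d = 2^l * (2 * j + 1)" using less.IH[of d] less.prems by auto
      then have "e = 2^Suc l * (2 * j + 1)" using d by simp
      then show ?thesis by blast
    next
      case False
      then obtain j where "e = 2 * j + 1" by (rule oddE)
      then have "e = 2^0 * (2 * j + 1)" by simp
      then show ?thesis by blast
    qed
  qed
  then show ?thesis using that by blast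
qed

lemma omega_class_hull_alternates:
  assumes tf: "tame f" and np: "nonperiodic f z"
  obtains c where "(f^^(2^l)) c = c"
    "(\<forall>t\<in>ord_hull (omega_class f z (Suc l) i). \<forall>j. (f^^(2^l * (2 * j))) t < c \<and> c < (f^^(2^l * (2 * j + 1))) t) \<or>
     (\<forall>t\<in>ord_hull (omega_class f z (Suc l) i). \<forall>j. c < (f^^(2^l * (2 * j))) t \<and> (f^^(2^l * (2 * j + 1))) t < c)"
proof -
  have th: "tame (f^^(2^l))" by (rule tame_funpow[OF tf]) simp
  have nc: "\<not> convergent (\<lambda>n. ((f^^(2^l))^^(2 * n + r)) ((f^^i) z))" for r
  proof -
    have "((f^^(2^l))^^(2 * n + r)) ((f^^i) z) = (f^^(2^Suc l * n + (2^l * r + i))) z" for n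
      by (simp add: funpow_mult funpow_apply algebra_simps)
    then show ?thesis using np unfolding nonperiodic_def by presburger
  qed
  have "(f^^(2^l))^^2 = f^^(2^Suc l)" by (simp add: funpow_mult mult.commute)
  then have O: "omega_limit ((f^^(2^l))^^2) ((f^^i) z) = omega_class f z (Suc l) i" by (simp add: omega_class_def)
  obtain c where "(f^^(2^l)) c = c"
    "(\<forall>t\<in>ord_hull (omega_class f z (Suc l) i). \<forall>j. ((f^^(2^l))^^(2 * j)) t < c \<and> c < ((f^^(2^l))^^(2 * j + 1)) t) \<or>
     (\<forall>t\<in>ord_hull (omega_class f z (Suc l) i). \<forall>j. c < ((f^^(2^l))^^(2 * j)) t \<and> ((f^^(2^l))^^(2 * j + 1)) t < c)"
    using hull_alternates[OF th nc] unfolding O by blast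
  then show ?thesis unfolding funpow_mult by (rule that)
qed

lemma in_ord_hull: "a \<in> S \<Longrightarrow> a \<in> ord_hull S"
  by (auto simp: ord_hull_def)

lemma ord_hullI: "a \<in> S \<Longrightarrow> b \<in> S \<Longrightarrow> a \<le> t \<Longrightarrow> t \<le> b \<Longrightarrow> t \<in> ord_hull S"
  by (auto simp: ord_hull_def)

lemma ord_hull_mono: "S \<subseteq> T \<Longrightarrow> ord_hull S \<subseteq> ord_hull T"
  by (auto simp: ord_hull_def)

text \<open>Odd multiples of \<open>2^l\<close> carry the hull across the fixed point
  \<open>c\<close> of \<open>f^^(2^l)\<close>, so they cannot lead back into it.\<close>

lemma omega_class_hull_wandering:
  assumes tf: "tame f" and np: "nonperiodic f z"
    and s: "s \<in> ord_hull (omega_class f z (Suc l) i)" and t: "t \<in> ord_hull (omega_class f z (Suc l) i)"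
  shows "(f^^(2^l * (2 * j + 1))) s \<noteq> t"
proof -
  obtain c where c: "(\<forall>t\<in>ord_hull (omega_class f z (Suc l) i). \<forall>j. (f^^(2^l * (2 * j))) t < c \<and> c < (f^^(2^l * (2 * j + 1))) t) \<or>
     (\<forall>t\<in>ord_hull (omega_class f z (Suc l) i). \<forall>j. c < (f^^(2^l * (2 * j))) t \<and> (f^^(2^l * (2 * j + 1))) t < c)"
    using omega_class_hull_alternates[OF tf np] by metis
  then show ?thesis
  proof
    assume h: "\<forall>t\<in>ord_hull (omega_class f z (Suc l) i). \<forall>j. (f^^(2^l * (2 * j))) t < c \<and> c < (f^^(2^l * (2 * j + 1))) t"
    have "t < c" using h[rule_format, OF t, of 0] by simp
    then show ?thesis using h[rule_format, OF s, of j] by auto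
  next
    assume h: "\<forall>t\<in>ord_hull (omega_class f z (Suc l) i). \<forall>j. c < (f^^(2^l * (2 * j))) t \<and> (f^^(2^l * (2 * j + 1))) t < c"
    have "c < t" using h[rule_format, OF t, of 0] by simp
    then show ?thesis using h[rule_format, OF s, of j] by auto
  qed
qed

text \<open>Membership is required at all levels because the level to be used depends on the power
  of two dividing \<open>e\<close>.\<close>

lemma nested_hull_wandering:
  assumes tf: "tame f" and np: "nonperiodic f z" and "1 \<le> e"
    and st: "\<And>k. 1 \<le> k \<Longrightarrow> s \<in> ord_hull (omega_class f z k (ik k))" "\<And>k. 1 \<le> k \<Longrightarrow> t \<in> ord_hull (omega_class f z k (ik k))"
  shows "(f^^e) s \<noteq> t"
proof -
  obtain l j where "e = 2^l * (2 * j + 1)" using power2_times_odd[OF \<open>1 \<le> e\<close>] by blast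
  then show ?thesis using omega_class_hull_wandering[OF tf np st(1) st(2), of l j] by simp
qed

text \<open>The number \<open>l\<close> is the position of the lowest binary digit in which
  \<open>i\<close> and \<open>j\<close> differ. Modulo \<open>2^Suc l\<close> they differ by exactly
  \<open>2^l\<close>, half the period.\<close>

lemma split_level:
  assumes "i mod 2^k \<noteq> (j::nat) mod 2^k"
  obtains l where "l < k" "j mod 2^Suc l = (i + 2^l) mod 2^Suc l"
proof -
  define l where "l = (LEAST l. i mod 2^Suc l \<noteq> j mod 2^Suc l)"
  have "k \<noteq> 0" using assms by (auto intro: gr0I)
  then obtain k' where k': "k = Suc k'" by (cases k) auto
  have l: "i mod 2^Suc l \<noteq> j mod 2^Suc l" "l \<le> k'"
    unfolding l_def using LeastI[of "\<lambda>l. i mod 2^Suc l \<noteq> j mod 2^Suc l" k'] Least_le[of "\<lambda>l. i mod 2^Suc l \<noteq> j mod 2^Suc l" k'] assms k' by auto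
  have eq: "i mod 2^l = j mod 2^l"
  proof (cases l)
    case (Suc m)
    then show ?thesis using not_less_Least[of m "\<lambda>l. i mod 2^Suc l \<noteq> j mod 2^Suc l"] unfolding l_def by auto
  qed simp
  have i: "i mod 2^Suc l = 2^l * (i div 2^l mod 2) + i mod 2^l"
    using mod_mult2_eq[of i "2^l" 2] by (simp add: mult.commute)
  have j: "j mod 2^Suc l = 2^l * (j div 2^l mod 2) + j mod 2^l"
    using mod_mult2_eq[of j "2^l" 2] by (simp add: mult.commute)
  have i2: "(i + 2^l) mod 2^Suc l = 2^l * ((i div 2^l + 1) mod 2) + i mod 2^l"
    using mod_mult2_eq[of "i + 2^l" "2^l" 2] by (simp add: mult.commute)
  have "i div 2^l mod 2 \<noteq> j div 2^l mod 2" using l(1) i j eq by auto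
  moreover have "(u + 1) mod 2 = v mod 2" if "u mod 2 \<noteq> v mod 2" for u v :: nat using that by presburger
  ultimately have "(i div 2^l + 1) mod 2 = j div 2^l mod 2" by blast
  then have "j mod 2^Suc l = (i + 2^l) mod 2^Suc l" using j i2 eq by simp
  then show ?thesis using that[of l] l(2) k' by simp
qed

text \<open>At the level where the residues part, the class of \<open>j\<close> is the image under
  \<open>f^^(2^l)\<close> of the class of \<open>i\<close>, and alternation puts the two on opposite
  sides of \<open>c\<close>. The classes of level \<open>k\<close> are contained in these.\<close>

lemma omega_class_separated:
  assumes tf: "tame f" and np: "nonperiodic f z" and ij: "i mod 2^k \<noteq> j mod 2^k"
  obtains c l where "(f^^(2^l)) c = c"
    "(\<forall>a\<in>omega_class f z k i. \<forall>b\<in>omega_class f z k j. a < c \<and> c < b) \<or> (\<forall>a\<in>omega_class f z k i. \<forall>b\<in>omega_class f z k j. b < c \<and> c < a)"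
proof -
  obtain l where l: "l < k" "j mod 2^Suc l = (i + 2^l) mod 2^Suc l" using split_level[OF ij] by blast
  obtain c where c: "(f^^(2^l)) c = c"
     "(\<forall>t\<in>ord_hull (omega_class f z (Suc l) i). \<forall>j. (f^^(2^l * (2 * j))) t < c \<and> c < (f^^(2^l * (2 * j + 1))) t) \<or>
     (\<forall>t\<in>ord_hull (omega_class f z (Suc l) i). \<forall>j. c < (f^^(2^l * (2 * j))) t \<and> (f^^(2^l * (2 * j + 1))) t < c)"
    using omega_class_hull_alternates[OF tf np, of l i] by blast
  have a: "a \<in> ord_hull (omega_class f z (Suc l) i)" if "a \<in> omega_class f z k i" for a
    using that omega_class_mono[of "Suc l" k f z i] l by (intro in_ord_hull) auto
  have b: "\<exists>a\<in>ord_hull (omega_class f z (Suc l) i). b = (f^^(2^l)) a" if "b \<in> omega_class f z k j" for b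
  proof -
    have "b \<in> omega_class f z (Suc l) (i + 2^l)"
      using that omega_class_mono[of "Suc l" k f z j] l omega_class_cong[of j "Suc l" "i + 2^l" f z] by auto
    from omega_class_preimage[OF tf this] show ?thesis using in_ord_hull by metis
  qed
  from c(2) have "(\<forall>a\<in>omega_class f z k i. \<forall>b\<in>omega_class f z k j. a < c \<and> c < b) \<or> (\<forall>a\<in>omega_class f z k i. \<forall>b\<in>omega_class f z k j. b < c \<and> c < a)"
  proof
    assume h: "\<forall>t\<in>ord_hull (omega_class f z (Suc l) i). \<forall>j. (f^^(2^l * (2 * j))) t < c \<and> c < (f^^(2^l * (2 * j + 1))) t"
    have "a < c" if "a \<in> omega_class f z k i" for a using h[rule_format, OF a[OF that], of 0] by simp
    moreover have "c < b" if "b \<in> omega_class f z k j" for b using b[OF that] h[rule_format, of _ 0] by force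
    ultimately show ?thesis by blast
  next
    assume h: "\<forall>t\<in>ord_hull (omega_class f z (Suc l) i). \<forall>j. c < (f^^(2^l * (2 * j))) t \<and> (f^^(2^l * (2 * j + 1))) t < c"
    have "c < a" if "a \<in> omega_class f z k i" for a using h[rule_format, OF a[OF that], of 0] by simp
    moreover have "b < c" if "b \<in> omega_class f z k j" for b using b[OF that] h[rule_format, of _ 0] by force
    ultimately show ?thesis by blast
  qed
  then show ?thesis using that c(1) by blast
qed

section \<open>Finite and infinite limit sets\<close>

lemma omega_class_0: "omega_class f z 0 0 = omega_limit f z"
  by (simp add: omega_class_def)

lemma omega_limit_subset_omega_class:
  assumes a: "a \<in> omega_limit f z"
  obtains i where "i < 2^k" "a \<in> omega_class f z k i"
proof -
  have "\<exists>i<2^k. a \<in> omega_class f z k i"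
  proof (rule ccontr)
    assume "\<not> ?thesis"
    then have "\<forall>i. \<exists>e N. i < 2^k \<longrightarrow> 0 < e \<and> (\<forall>n\<ge>N. n mod 2^k = i mod 2^k \<longrightarrow> e \<le> \<bar>(f^^n) z - a\<bar>)"
      unfolding omega_class_iff by (metis linorder_not_less)
    then obtain e N where eN: "\<And>i. i < 2^k \<Longrightarrow> 0 < e i"
      "\<And>i n. i < 2^k \<Longrightarrow> N i \<le> n \<Longrightarrow> n mod 2^k = i mod 2^k \<Longrightarrow> e i \<le> \<bar>(f^^n) z - a\<bar>" by metis
    define E where "E = Min (e ` {..<2^k})"
    have "0 \<in> {..<(2::nat)^k}" by simp
    then have ne: "e ` {..<2^k} \<noteq> {}" by blast
    have E: "0 < E" unfolding E_def using eN(1) ne by (subst Min_gr_iff) auto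
    obtain n where n: "n \<ge> Max (N ` {..<2^k})" "\<bar>(f^^n) z - a\<bar> < E" using omega_limitD[OF a E] by blast
    have r: "n mod 2^k < 2^k" by simp
    have "N (n mod 2^k) \<le> Max (N ` {..<2^k})" using r by (intro Max_ge) auto
    then have "N (n mod 2^k) \<le> n" using n(1) by (rule order.trans)
    then have "e (n mod 2^k) \<le> \<bar>(f^^n) z - a\<bar>" using eN(2)[OF r] by simp
    moreover have "E \<le> e (n mod 2^k)" unfolding E_def using r by (intro Min_le) auto
    ultimately show False using n(2) by simp
  qed
  then show ?thesis using that by blast
qed

text \<open>One convergent residue class forces every class to be a single point, since classes are
  images of one another.\<close>

lemma convergent_class_omega:
  assumes tf: "tame f" and L: "(\<lambda>n. (f^^(2^k * n + i)) z) \<longlonglongrightarrow> L" and a: "a \<in> omega_limit f z"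
  shows "\<exists>j<2^k. a = (f^^j) L" "(f^^(2^k)) a = a"
proof -
  have one: "b = L" if b: "b \<in> omega_class f z k i" for b
  proof -
    obtain r where r: "strict_mono r" "(\<lambda>n. ((f^^(2^k))^^(r n)) ((f^^i) z)) \<longlonglongrightarrow> b"
      using b by (auto simp: omega_class_def omega_limit_def)
    from LIMSEQ_subseq_LIMSEQ[OF L r(1)] have "(\<lambda>n. (f^^(2^k * r n + i)) z) \<longlonglongrightarrow> L" by (simp add: o_def)
    moreover have "(\<lambda>n. (f^^(2^k * r n + i)) z) \<longlonglongrightarrow> b" using r(2) by (simp add: funpow_mult funpow_apply)
    ultimately show ?thesis using LIMSEQ_unique by blast
  qed
  obtain r where r: "r < 2^k" "a \<in> omega_class f z k r" using omega_limit_subset_omega_class[OF a] by blast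
  \<comment> \<open>This is \<open>r - i\<close> modulo \<open>2^k\<close>; the summand
    \<open>2^k * i\<close> avoids truncated subtraction.\<close>
  define j where "j = (r + 2^k * i - i) mod 2^k"
  have le: "i \<le> 2^k * i" by simp
  have "(i + j) mod 2^k = (i + (r + 2^k * i - i)) mod 2^k" by (simp add: j_def mod_simps)
  also have "i + (r + 2^k * i - i) = r + 2^k * i" using le by linarith
  finally have "(i + j) mod 2^k = r mod 2^k" by simp
  then have aj: "a \<in> omega_class f z k (i + j)" using r omega_class_cong by blast
  have all: "b = (f^^j) L" if "b \<in> omega_class f z k (i + j)" for b
    using omega_class_preimage[OF tf that] one by metis
  show "\<exists>j<2^k. a = (f^^j) L" using all[OF aj] by (intro exI[of _ j]) (simp add: j_def)
  have "(f^^(2^k)) a \<in> omega_class f z k (i + j + 2^k)" by (rule omega_class_image[OF tf aj])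
  moreover have "omega_class f z k (i + j + 2^k) = omega_class f z k (i + j)" by (rule omega_class_cong) simp
  ultimately have "(f^^(2^k)) a = (f^^j) L" by (intro all) simp
  then show "(f^^(2^k)) a = a" using all[OF aj] by (rule trans[OF _ sym])
qed

lemma nonperiodic_if_infinite_omega:
  assumes tf: "tame f" and inf: "infinite (omega_limit f z)"
  shows "nonperiodic f z"
  unfolding nonperiodic_def
proof (intro allI notI)
  fix k i assume "convergent (\<lambda>n. (f^^(2^k * n + i)) z)"
  then obtain L where L: "(\<lambda>n. (f^^(2^k * n + i)) z) \<longlonglongrightarrow> L" by (auto simp: convergent_def)
  have "omega_limit f z \<subseteq> (\<lambda>j. (f^^j) L) ` {..<2^k}"
    using convergent_class_omega(1)[OF tf L] by blast
  then show False using inf finite_subset by blast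
qed

text \<open>By wandering of the hulls, the orbit of \<open>x\<close> never repeats a point, and it
  stays in the limit set.\<close>

lemma infinite_omega_if_nonperiodic:
  assumes tf: "tame f" and np: "nonperiodic f z" and x: "x \<in> omega_limit f z"
  shows "infinite (omega_limit f z)"
proof -
  have ne: "(f^^n) x \<noteq> (f^^(n + e)) x" if "1 \<le> e" for n e
  proof -
    obtain l j where e: "e = 2^l * (2 * j + 1)" using power2_times_odd[OF \<open>1 \<le> e\<close>] by blast
    obtain i where "x \<in> omega_class f z (Suc l) i" using omega_limit_subset_omega_class[OF x] by blast
    then have "(f^^n) x \<in> ord_hull (omega_class f z (Suc l) (i + n))"
      by (intro in_ord_hull omega_class_image[OF tf])
    then have "(f^^e) ((f^^n) x) \<noteq> (f^^n) x" unfolding e using omega_class_hull_wandering[OF tf np] by blast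
    then show ?thesis by (metis add.commute funpow_apply)
  qed
  have "inj (\<lambda>n. (f^^n) x)"
  proof (rule linorder_injI)
    fix a b :: nat assume "a < b"
    then show "(f^^a) x \<noteq> (f^^b) x" using ne[of "b - a" a] by simp
  qed
  then have "infinite (range (\<lambda>n. (f^^n) x))" by (rule range_inj_infinite)
  moreover have "range (\<lambda>n. (f^^n) x) \<subseteq> omega_limit f z"
  proof
    fix y assume "y \<in> range (\<lambda>n. (f^^n) x)"
    then obtain n where "y = (f^^n) x" by blast
    moreover have "(f^^n) x \<in> omega_class f z 0 (0 + n)" using omega_class_image[OF tf] x by (metis omega_class_0)
    moreover have "omega_class f z 0 (0 + n) = omega_class f z 0 0" by (rule omega_class_cong) simp
    ultimately show "y \<in> omega_limit f z" by (simp add: omega_class_0)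
  qed
  ultimately show ?thesis using infinite_super by blast
qed

section \<open>Stretching at nonseparable pairs\<close>

text \<open>Common reformulation of the three properties of the pair.\<close>

definition spreads :: "(real \<Rightarrow> real) \<Rightarrow> real \<Rightarrow> real \<Rightarrow> bool" where
  "spreads f x y \<longleftrightarrow> (\<forall>e>0. \<exists>n\<ge>1. \<exists>d>0.
     {x - d..y + d} \<subseteq> (f^^n) ` {x - e..x} \<and> {x - d..y + d} \<subseteq> (f^^n) ` {y..y + e})"

text \<open>The working form of a nonseparable pair: \<open>x\<close> and \<open>y\<close> belong to
  the limit sets themselves and not merely to their hulls, indices matter only as residues, and the
  last clause says that the classes shrink to \<open>[x, y]\<close>.\<close>

definition solenoidal_pair :: "(real \<Rightarrow> real) \<Rightarrow> real \<Rightarrow> (nat \<Rightarrow> nat) \<Rightarrow> real \<Rightarrow> real \<Rightarrow> bool" where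
  "solenoidal_pair f z ik x y \<longleftrightarrow> nonperiodic f z \<and>
     (\<forall>k\<ge>1. ik (Suc k) mod 2^k = ik k mod 2^k) \<and>
     (\<forall>k\<ge>1. x \<in> omega_class f z k (ik k) \<and> y \<in> omega_class f z k (ik k)) \<and>
     (\<forall>e>0. \<exists>k\<ge>1. omega_class f z k (ik k) \<subseteq> {x - e<..<y + e})"

lemma segment_covered:
  fixes f :: "real \<Rightarrow> real"
  assumes "continuous_on UNIV f" and "s \<in> {a..b}" "t \<in> {a..b}" and "f s \<le> u" "v \<le> f t"
  shows "{u..v} \<subseteq> f ` {a..b}"
proof
  fix w assume w: "w \<in> {u..v}"
  show "w \<in> f ` {a..b}"
  proof (cases "s \<le> t")
    case True
    then obtain r where "s \<le> r" "r \<le> t" "f r = w"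
      using ivt_between[OF assms(1), of s w t] w assms by (metis atLeastAtMost_iff order.trans)
    then show ?thesis using assms(2,3) by (intro image_eqI[of _ _ r]) auto
  next
    case False
    then obtain r where "t \<le> r" "r \<le> s" "f r = w"
      using ivt_between[OF assms(1), of t w s] w assms by (metis atLeastAtMost_iff order.trans linear)
    then show ?thesis using assms(2,3) by (intro image_eqI[of _ _ r]) auto
  qed
qed

text \<open>Four points decide: in each collar, one that goes below \<open>x\<close> and one that
  goes above \<open>y\<close>. The margin \<open>d\<close> is the smallest of the four
  overshoots.\<close>

lemma spreads_step:
  assumes tf: "tame f" and s: "s1 \<in> {x - e..x}" "s2 \<in> {x - e..x}" "t1 \<in> {y..y + e}" "t2 \<in> {y..y + e}"
    and "(f^^n) s1 < x" "y < (f^^n) s2" "(f^^n) t1 < x" "y < (f^^n) t2"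
  shows "\<exists>d>0. {x - d..y + d} \<subseteq> (f^^n) ` {x - e..x} \<and> {x - d..y + d} \<subseteq> (f^^n) ` {y..y + e}"
proof -
  define d where "d = min (min (x - (f^^n) s1) ((f^^n) s2 - y)) (min (x - (f^^n) t1) ((f^^n) t2 - y))"
  have "0 < d" using assms by (simp add: d_def)
  moreover have "(f^^n) s1 \<le> x - d" "y + d \<le> (f^^n) s2" "(f^^n) t1 \<le> x - d" "y + d \<le> (f^^n) t2"
    by (auto simp: d_def min_def)
  then have "{x - d..y + d} \<subseteq> (f^^n) ` {x - e..x}" "{x - d..y + d} \<subseteq> (f^^n) ` {y..y + e}"
    using segment_covered[OF tame_funpow_continuous[OF tf]] s by blast+
  ultimately show ?thesis by blast
qed

lemma power2_dvd_imp_le: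
  assumes "(2::nat)^k dvd 2^l * (2 * j + 1)" shows "k \<le> l"
proof (rule ccontr)
  assume "\<not> ?thesis"
  then have "(2::nat)^Suc l dvd 2^k" by (intro le_imp_power_dvd) simp
  then have "2^l * 2 dvd 2^l * (2 * j + 1)" using assms by (simp add: dvd_trans mult.commute)
  then have "2 dvd 2 * j + 1" using nat_mult_dvd_cancel_disj[of "2^l" 2 "2 * j + 1"] by simp
  then show False by simp
qed

context
  fixes f z ik x y
  assumes tf: "tame f" and xy: "x < y" and sol: "solenoidal_pair f z ik x y"
begin

text \<open>The half of the portion of level \<open>k\<close> that does not contain \<open>[x, y]\<close>.\<close>

definition sibling :: "nat \<Rightarrow> real set" where "sibling k = omega_class f z (Suc k) (ik (Suc k) + 2^k)"

lemma nonperiodic_orbit: "nonperiodic f z"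
  using sol by (simp add: solenoidal_pair_def)

lemma xy_in_omega_class: "1 \<le> k \<Longrightarrow> x \<in> omega_class f z k (ik k)" "1 \<le> k \<Longrightarrow> y \<in> omega_class f z k (ik k)"
  using sol by (auto simp: solenoidal_pair_def)

lemma ik_coherent: "1 \<le> k \<Longrightarrow> k \<le> l \<Longrightarrow> ik l mod 2^k = ik k mod 2^k"
proof (induction l rule: nat_induct)
  case (Suc l)
  show ?case
  proof (cases "k = Suc l")
    case False
    then have "k \<le> l" using Suc by simp
    have "ik (Suc l) mod 2^l = ik l mod 2^l" using sol Suc \<open>k \<le> l\<close> by (auto simp: solenoidal_pair_def)
    then have "ik (Suc l) mod 2^k = ik l mod 2^k" using mod_power2_mono[OF \<open>k \<le> l\<close>] by blast
    then show ?thesis using Suc \<open>k \<le> l\<close> by simp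
  qed simp
qed simp

lemma omega_class_ik_mono: "1 \<le> k \<Longrightarrow> k \<le> l \<Longrightarrow> omega_class f z l (ik l) \<subseteq> omega_class f z k (ik k)"
  using omega_class_mono[of k l f z "ik l"] omega_class_cong[OF ik_coherent[of k l], of f z] by blast

lemma omega_class_ik_small:
  assumes "0 < e" obtains K where "1 \<le> K" "\<And>k. K \<le> k \<Longrightarrow> omega_class f z k (ik k) \<subseteq> {x - e<..<y + e}"
proof -
  obtain K where K: "1 \<le> K" "omega_class f z K (ik K) \<subseteq> {x - e<..<y + e}"
    using sol assms by (auto simp: solenoidal_pair_def)
  then show ?thesis using that[of K] omega_class_ik_mono[of K] by blast
qed

lemma sibling_subset: assumes "1 \<le> k" shows "sibling k \<subseteq> omega_class f z k (ik k)"
proof -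
  have "(ik (Suc k) + 2^k) mod 2^k = ik k mod 2^k" using ik_coherent[of k "Suc k"] assms by simp
  then show ?thesis
    unfolding sibling_def using omega_class_mono[of k "Suc k" f z "ik (Suc k) + 2^k"] omega_class_cong by (metis le_SucI order.refl)
qed

lemma sibling_left_or_right: "(\<forall>a\<in>sibling k. a < x) \<or> (\<forall>a\<in>sibling k. y < a)"
proof -
  have "ik (Suc k) mod 2^Suc k \<noteq> (ik (Suc k) + 2^k) mod 2^Suc k"
  proof
    assume "ik (Suc k) mod 2^Suc k = (ik (Suc k) + 2^k) mod 2^Suc k"
    then have "(0 + ik (Suc k)) mod 2^Suc k = (2^k + ik (Suc k)) mod 2^Suc k" by (simp add: add.commute)
    then have "0 mod 2^Suc k = (2::nat)^k mod 2^Suc k" by (rule mod_add_rcancel_nat)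
    then show False by simp
  qed
  from omega_class_separated[OF tf nonperiodic_orbit this] obtain c where
    "(\<forall>a\<in>omega_class f z (Suc k) (ik (Suc k)). \<forall>b\<in>sibling k. a < c \<and> c < b) \<or>
     (\<forall>a\<in>omega_class f z (Suc k) (ik (Suc k)). \<forall>b\<in>sibling k. b < c \<and> c < a)" unfolding sibling_def by metis
  then show ?thesis using xy_in_omega_class[of "Suc k"] by (metis le_add1 less_trans plus_1_eq_Suc)
qed

lemma segment_wandering:
  assumes "1 \<le> e" "s \<in> {x..y}" "t \<in> {x..y}" shows "(f^^e) s \<noteq> t"
proof (rule nested_hull_wandering[OF tf nonperiodic_orbit assms(1)])
  show "s \<in> ord_hull (omega_class f z k (ik k))" "t \<in> ord_hull (omega_class f z k (ik k))" if "1 \<le> k" for k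
    using xy_in_omega_class[OF that] assms by (auto simp: ord_hull_def)
qed

text \<open>Two visits near \<open>y\<close> that both failed to be right of \<open>y\<close> would
  lie in \<open>[x, y]\<close>, which is impossible as this segment is wandering. For this the
  radius is cut down to at most \<open>y - x\<close>.\<close>

lemma right_visit:
  assumes "0 < e" "1 \<le> k"
  obtains n where "n \<ge> N" "n mod 2^k = ik k mod 2^k" "(f^^n) z \<in> {y<..<y + e}"
proof (rule ccontr)
  assume no: "\<not> thesis"
  have e: "0 < min e (y - x)" using assms xy by simp
  obtain n1 where n1: "n1 \<ge> N" "n1 mod 2^k = ik k mod 2^k" "\<bar>(f^^n1) z - y\<bar> < min e (y - x)"
    using omega_classD[OF xy_in_omega_class(2)[OF assms(2)] e] by blast
  obtain n2 where n2: "n2 \<ge> N + n1 + 1" "n2 mod 2^k = ik k mod 2^k" "\<bar>(f^^n2) z - y\<bar> < min e (y - x)"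
    using omega_classD[OF xy_in_omega_class(2)[OF assms(2)] e] by blast
  have "\<not> y < (f^^n1) z" using no that[of n1] n1 by auto
  then have 1: "(f^^n1) z \<in> {x..y}" using n1(3) by (auto simp: abs_less_iff)
  have "\<not> y < (f^^n2) z" using no that[of n2] n2 by auto
  then have 2: "(f^^n2) z \<in> {x..y}" using n2(3) by (auto simp: abs_less_iff)
  have "(f^^(n2 - n1)) ((f^^n1) z) = (f^^n2) z" using n2(1) by (simp add: funpow_apply)
  then show False using segment_wandering[OF _ 1 2, of "n2 - n1"] n2(1) by simp
qed

text \<open>An odd multiple \<open>d\<close> of \<open>2^k\<close> exchanges the class of
  \<open>x\<close> and \<open>y\<close> with its sibling. So \<open>x\<close> and \<open>y\<close>
  themselves are mapped left of \<open>x\<close>, and an orbit point in the class of the sibling,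
  just left of \<open>x\<close>, is mapped to a point right of \<open>y\<close> supplied by
  \<open>right_visit\<close>. The fourth point, from the right collar to the right, is the one
  assumed at time \<open>n\<close>.\<close>

lemma spread_at_left_sibling:
  assumes left: "\<forall>a\<in>sibling k. a < x" and small: "sibling k \<subseteq> {x - e<..<y + e}"
    and d: "d = 2^k * (2 * j + 1)" and n: "(f^^n) z \<in> {y..y + e}" "y < (f^^(d + n)) z"
  shows "\<exists>d'>0. {x - d'..y + d'} \<subseteq> (f^^d) ` {x - e..x} \<and> {x - d'..y + d'} \<subseteq> (f^^d) ` {y..y + e}"
proof -
  have "(ik (Suc k) + d) mod 2^Suc k = (ik (Suc k) + 2^k + 2^Suc k * j) mod 2^Suc k"
    by (simp add: d algebra_simps)
  then have shift: "(ik (Suc k) + d) mod 2^Suc k = (ik (Suc k) + 2^k) mod 2^Suc k" by simp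
  have xd: "(f^^d) x \<in> sibling k" "(f^^d) y \<in> sibling k"
    using omega_class_image[OF tf xy_in_omega_class(1)[of "Suc k"], of d] omega_class_image[OF tf xy_in_omega_class(2)[of "Suc k"], of d] omega_class_cong[OF shift, of f z]
    by (auto simp: sibling_def)
  have e: "0 \<le> e" using n by auto
  have "open {x - e<..<x}" by simp
  moreover have "sibling k \<subseteq> {x - e<..<x}" using left small by auto
  ultimately obtain N where N: "\<And>m. m \<ge> N \<Longrightarrow> m mod 2^Suc k = (ik (Suc k) + 2^k) mod 2^Suc k \<Longrightarrow> (f^^m) z \<in> {x - e<..<x}"
    using omega_class_eventually[OF tf, of "{x - e<..<x}" z "Suc k" "ik (Suc k) + 2^k"] unfolding sibling_def by blast
  obtain m where m: "m \<ge> N + d" "m mod 2^Suc k = ik (Suc k) mod 2^Suc k" "(f^^m) z \<in> {y<..<y + 1}"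
    using right_visit[of 1 "Suc k" "N + d"] by auto
  have "(ik (Suc k) + 2^k + d) mod 2^Suc k = (ik (Suc k) + 2^Suc k * (j + 1)) mod 2^Suc k"
    by (simp add: d algebra_simps)
  also have "\<dots> = ik (Suc k) mod 2^Suc k" by (rule mod_mult_self2)
  finally have "(m - d + d) mod 2^Suc k = (ik (Suc k) + 2^k + d) mod 2^Suc k" using m by simp
  then have "(m - d) mod 2^Suc k = (ik (Suc k) + 2^k) mod 2^Suc k" by (rule mod_add_rcancel_nat)
  then have "(f^^(m - d)) z \<in> {x - e<..<x}" using m(1) by (intro N) auto
  moreover have "(f^^d) ((f^^(m - d)) z) = (f^^m) z" using m(1) by (simp add: funpow_apply)
  ultimately show ?thesis
    using spreads_step[OF tf, of x x e "(f^^(m - d)) z" y y "(f^^n) z" d] xd left n m(3) e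
    by (auto simp: funpow_apply)
qed

text \<open>It remains to find a left sibling of some level \<open>k\<close> and two orbit points
  just right of \<open>y\<close> whose times differ by an odd multiple of \<open>2^k\<close>. If all
  siblings from \<open>K\<close> on are left, two visits right of \<open>y\<close> with equal
  residue modulo \<open>2^K\<close> will do, and their time difference chooses the level. Otherwise
  some right sibling lies just right of \<open>y\<close>, and its residue class is unchanged by
  adding \<open>2^k\<close> for any higher level \<open>k\<close>.\<close>

lemma spreads_if_left_siblings:
  assumes left: "\<And>K. \<exists>k\<ge>K. \<forall>a\<in>sibling k. a < x"
  shows "spreads f x y"
  unfolding spreads_def
proof (intro allI impI)
  fix e :: real assume e: "0 < e"
  obtain K where K: "1 \<le> K" "\<And>k. K \<le> k \<Longrightarrow> omega_class f z k (ik k) \<subseteq> {x - e<..<y + e}" using omega_class_ik_small[OF e] by blast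
  have small: "sibling k \<subseteq> {x - e<..<y + e}" if "K \<le> k" for k
    using sibling_subset[of k] K that by force
  show "\<exists>n\<ge>1. \<exists>d>0. {x - d..y + d} \<subseteq> (f^^n) ` {x - e..x} \<and> {x - d..y + d} \<subseteq> (f^^n) ` {y..y + e}"
  proof (cases "\<forall>k\<ge>K. \<forall>a\<in>sibling k. a < x")
    case True
    obtain n where n: "n mod 2^K = ik K mod 2^K" "(f^^n) z \<in> {y<..<y + e}"
      using right_visit[OF e K(1), of 0] by blast
    obtain m where m: "m \<ge> Suc n" "m mod 2^K = ik K mod 2^K" "(f^^m) z \<in> {y<..<y + e}"
      using right_visit[OF e K(1), of "Suc n"] by blast
    have "1 \<le> m - n" using m(1) by simp
    then obtain l j where lj: "m - n = 2^l * (2 * j + 1)" by (rule power2_times_odd)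
    have "2^K dvd m - n" using m(1,2) n(1) mod_eq_dvd_iff_nat[of n m "2^K"] by simp
    then have "K \<le> l" unfolding lj by (rule power2_dvd_imp_le)
    then have "\<exists>d>0. {x - d..y + d} \<subseteq> (f^^(m - n)) ` {x - e..x} \<and> {x - d..y + d} \<subseteq> (f^^(m - n)) ` {y..y + e}"
      using spread_at_left_sibling[OF _ small lj, of n] True n m by auto
    then show ?thesis using \<open>1 \<le> m - n\<close> by blast
  next
    case False
    then obtain r where r: "K \<le> r" "\<forall>a\<in>sibling r. y < a" using sibling_left_or_right by blast
    obtain k where k: "Suc r \<le> k" "\<forall>a\<in>sibling k. a < x" using left by blast
    have "sibling r \<subseteq> {y<..<y + e}" using r small[of r] by auto
    then obtain N where N: "\<And>m. m \<ge> N \<Longrightarrow> m mod 2^Suc r = (ik (Suc r) + 2^r) mod 2^Suc r \<Longrightarrow> (f^^m) z \<in> {y<..<y + e}"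
      using omega_class_eventually[OF tf, of "{y<..<y + e}" z "Suc r" "ik (Suc r) + 2^r"] unfolding sibling_def by auto
    define n where "n = ik (Suc r) + 2^r + 2^Suc r * N"
    have "N \<le> n" unfolding n_def by (simp add: trans_le_add2)
    have n: "n mod 2^Suc r = (ik (Suc r) + 2^r) mod 2^Suc r" by (simp add: n_def)
    have "(2::nat)^Suc r dvd 2^k" using k(1) by (rule le_imp_power_dvd)
    then have n2: "(2^k + n) mod 2^Suc r = (ik (Suc r) + 2^r) mod 2^Suc r"
      using n by (metis add.commute dvd_eq_mod_eq_0 mod_add_right_eq add_0_right)
    have "(f^^n) z \<in> {y<..<y + e}" "(f^^(2^k + n)) z \<in> {y<..<y + e}"
      using N[OF _ n] N[OF _ n2] \<open>N \<le> n\<close> by auto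
    then have "\<exists>d>0. {x - d..y + d} \<subseteq> (f^^(2^k)) ` {x - e..x} \<and> {x - d..y + d} \<subseteq> (f^^(2^k)) ` {y..y + e}"
      using spread_at_left_sibling[OF k(2) small, of "2^k" 0 n] k(1) r(1) by auto
    then show ?thesis by (intro exI[of _ "2^k"]) auto
  qed
qed

end

lemma omega_class_mirror: "a \<in> omega_class (mirror f) (- z) k i \<longleftrightarrow> - a \<in> omega_class f z k i"
proof -
  have "\<bar>- u - a\<bar> = \<bar>u + a\<bar>" for u :: real by linarith
  then show ?thesis by (simp add: omega_class_iff funpow_mirror)
qed

lemma solenoidal_pair_mirror:
  assumes "solenoidal_pair f z ik x y" shows "solenoidal_pair (mirror f) (- z) ik (- y) (- x)"
proof -
  have "nonperiodic (mirror f) (- z)"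
    using assms by (simp add: solenoidal_pair_def nonperiodic_def convergent_mirror)
  moreover have "\<exists>k\<ge>1. omega_class (mirror f) (- z) k (ik k) \<subseteq> {- y - e<..<- x + e}" if e: "0 < e" for e
  proof -
    obtain k where k: "1 \<le> k" "omega_class f z k (ik k) \<subseteq> {x - e<..<y + e}"
      using assms e by (auto simp: solenoidal_pair_def)
    have "a \<in> {- y - e<..<- x + e}" if "a \<in> omega_class (mirror f) (- z) k (ik k)" for a
      using that k(2) unfolding omega_class_mirror by force
    then show ?thesis using k(1) by blast
  qed
  ultimately show ?thesis using assms by (auto simp: solenoidal_pair_def omega_class_mirror)
qed

lemma spreads_mirror:
  assumes "spreads (mirror f) (- y) (- x)" shows "spreads f x y"
  unfolding spreads_def
proof (intro allI impI)
  fix e :: real assume "0 < e"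
  then obtain n d where n: "1 \<le> n" "0 < d" "{- y - d..- x + d} \<subseteq> (mirror f^^n) ` {- y - e..- y}"
    "{- y - d..- x + d} \<subseteq> (mirror f^^n) ` {- x..- x + e}"
    using assms unfolding spreads_def by blast
  have "{x - d..y + d} \<subseteq> (f^^n) ` {x - e..x}"
  proof
    fix w assume "w \<in> {x - d..y + d}"
    then have "- w \<in> (mirror f^^n) ` {- x..- x + e}" using n(4) by auto
    then obtain s where "s \<in> {- x..- x + e}" "- w = (mirror f^^n) s" by blast
    then show "w \<in> (f^^n) ` {x - e..x}" by (intro image_eqI[of _ _ "- s"]) (auto simp: funpow_mirror)
  qed
  moreover have "{x - d..y + d} \<subseteq> (f^^n) ` {y..y + e}"
  proof
    fix w assume "w \<in> {x - d..y + d}"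
    then have "- w \<in> (mirror f^^n) ` {- y - e..- y}" using n(3) by auto
    then obtain s where "s \<in> {- y - e..- y}" "- w = (mirror f^^n) s" by blast
    then show "w \<in> (f^^n) ` {y..y + e}" by (intro image_eqI[of _ _ "- s"]) (auto simp: funpow_mirror)
  qed
  ultimately show "\<exists>n\<ge>1. \<exists>d>0. {x - d..y + d} \<subseteq> (f^^n) ` {x - e..x} \<and> {x - d..y + d} \<subseteq> (f^^n) ` {y..y + e}"
    using n by blast
qed

lemma solenoidal_pair_spreads:
  assumes tf: "tame f" and xy: "x < y" and sol: "solenoidal_pair f z ik x y"
  shows "spreads f x y"
proof (cases "\<forall>K. \<exists>k\<ge>K. \<forall>a\<in>omega_class f z (Suc k) (ik (Suc k) + 2^k). a < x")
  case True
  then show ?thesis using spreads_if_left_siblings[OF tf xy sol] unfolding sibling_def[OF tf xy sol] by blast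
next
  case False
  then obtain K where K: "\<And>k. K \<le> k \<Longrightarrow> \<forall>a\<in>omega_class f z (Suc k) (ik (Suc k) + 2^k). y < a"
    using sibling_left_or_right[OF tf xy sol] unfolding sibling_def[OF tf xy sol] by blast
  have xy': "- y < - x" using xy by simp
  note m = tame_mirror[OF tf] xy' solenoidal_pair_mirror[OF sol]
  have "\<exists>k\<ge>K'. \<forall>a\<in>omega_class (mirror f) (- z) (Suc k) (ik (Suc k) + 2^k). a < - y" for K'
    using K[of "max K K'"] unfolding omega_class_mirror by (intro exI[of _ "max K K'"]) (force simp: omega_class_mirror)
  then have "spreads (mirror f) (- y) (- x)"
    using spreads_if_left_siblings[OF m] unfolding sibling_def[OF m] by blast
  then show ?thesis by (rule spreads_mirror)
qed

section \<open>Horseshoes and entropy\<close>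

lemma horseshoe_itinerary:
  fixes f :: "'a \<Rightarrow> 'a" and J :: "bool \<Rightarrow> 'a set"
  assumes ne: "\<And>a. J a \<noteq> {}" and cover: "\<And>a b. J b \<subseteq> (f^^N) ` J a"
  shows "\<exists>x\<in>J (s 0). \<forall>i\<le>k. (f^^(N * i)) x \<in> J (s i)"
proof (induction k arbitrary: s)
  case 0
  then show ?case using ne[of "s 0"] by auto
next
  case (Suc k)
  from Suc[of "\<lambda>i. s (Suc i)"] obtain y where y: "y \<in> J (s (Suc 0))" "\<And>i. i \<le> k \<Longrightarrow> (f^^(N * i)) y \<in> J (s (Suc i))" by blast
  then obtain x where x: "x \<in> J (s 0)" "(f^^N) x = y" using cover[of "s (Suc 0)" "s 0"] by blast
  have "(f^^(N * i)) x \<in> J (s i)" if "i \<le> Suc k" for i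
  proof (cases i)
    case (Suc i')
    have "(f^^(N * i)) x = (f^^(N * i')) ((f^^N) x)" unfolding Suc by (simp add: funpow_apply add.commute)
    then show ?thesis using y(2)[of i'] x(2) Suc that by simp
  qed (use x in simp)
  then show ?case using x(1) by blast
qed

text \<open>Each subset of \<open>{..<k}\<close> prescribes an itinerary, and different itineraries
  are more than \<open>e\<close> apart at some multiple of \<open>N\<close>. These
  \<open>2^k\<close> separated points for \<open>N * k\<close> steps give a growth rate of at least
  \<open>ln 2 / N\<close> along the multiples of \<open>N\<close>.\<close>

lemma horseshoe_top_entropy_pos:
  fixes J :: "bool \<Rightarrow> real set"
  assumes J: "\<And>a. J a \<noteq> {}" "\<And>a. J a \<subseteq> {0..1}" "\<And>a b. J b \<subseteq> (f^^N) ` J a"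
    and gap: "0 < e" "\<And>u v. u \<in> J True \<Longrightarrow> v \<in> J False \<Longrightarrow> e < \<bar>u - v\<bar>" and N: "1 \<le> N"
  shows "0 < top_entropy f"
proof -
  define C where "C = ln 2 / real N"
  have "0 < C" using N by (simp add: C_def)
  have sep: "ereal (2^k) \<le> max_sep f (N * k) e" for k
  proof -
    have "\<exists>x\<in>{0..1}. \<forall>i<k. (f^^(N * i)) x \<in> J (i \<in> S)" for S
      using horseshoe_itinerary[of J N f "\<lambda>i. i \<in> S" k] J by (meson less_imp_le subsetD)
    then obtain X where X: "\<And>S. X S \<in> {0..1}" "\<And>S i. i < k \<Longrightarrow> (f^^(N * i)) (X S) \<in> J (i \<in> S)" by metis
    have far: "\<exists>j<N * k. e < \<bar>(f^^j) (X S) - (f^^j) (X S')\<bar>" if SS: "S \<subseteq> {..<k}" "S' \<subseteq> {..<k}" "S \<noteq> S'" for S S'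
    proof -
      obtain i where i: "i < k" "(i \<in> S) \<noteq> (i \<in> S')" using SS by blast
      then have "e < \<bar>(f^^(N * i)) (X S) - (f^^(N * i)) (X S')\<bar>"
        using X(2)[OF i(1), of S] X(2)[OF i(1), of S'] gap(2)[of "(f^^(N * i)) (X S)" "(f^^(N * i)) (X S')"]
          gap(2)[of "(f^^(N * i)) (X S')" "(f^^(N * i)) (X S)"] by (cases "i \<in> S") (auto simp: abs_minus_commute)
      then show ?thesis using i(1) N by (intro exI[of _ "N * i"]) auto
    qed
    define E where "E = X ` Pow {..<k}"
    have "inj_on X (Pow {..<k})"
      using far gap(1) by (intro inj_onI) (metis PowD abs_zero diff_self less_asym)
    then have "card E = 2^k" by (simp add: E_def card_image card_Pow)
    moreover have "separated_set f (N * k) e E"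
      unfolding separated_set_def
    proof (intro conjI ballI impI)
      show "E \<subseteq> {0..1}" using X(1) by (auto simp: E_def)
      fix x y assume "x \<in> E" "y \<in> E" and xy: "x \<noteq> y"
      then obtain S S' where "S \<subseteq> {..<k}" "S' \<subseteq> {..<k}" "x = X S" "y = X S'" by (auto simp: E_def)
      then show "\<exists>j<N * k. e < \<bar>(f^^j) x - (f^^j) y\<bar>" using far[of S S'] xy by blast
    qed
    moreover have "finite E" by (simp add: E_def)
    ultimately show ?thesis unfolding max_sep_def by (intro SUP_upper2[of E]) auto
  qed
  define L where "L n = (if max_sep f n e = \<infinity> then \<infinity> else ereal (ln (real_of_ereal (max_sep f n e)) / real n))" for n
  have LC: "ereal C \<le> L (N * k)" if "1 \<le> k" for k
  proof (cases "max_sep f (N * k) e")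
    case (real r)
    then have "2^k \<le> r" using sep[of k] by simp
    then have "ln (2^k) \<le> ln r" by (subst ln_le_cancel_iff) (auto intro: less_le_trans[of 0 "2^k"])
    then have "real k * ln 2 \<le> ln r" by (simp add: ln_realpow)
    then have "C \<le> ln r / real (N * k)" using that N by (simp add: C_def field_simps)
    then show ?thesis using real by (simp add: L_def)
  next
    case MInf
    then show ?thesis using sep[of k] by simp
  qed (simp add: L_def)
  have "ereal C \<le> limsup L"
  proof (rule ccontr)
    assume "\<not> ?thesis"
    then have "\<forall>\<^sub>F n in sequentially. L n < ereal C" by (intro Limsup_lessD) simp
    then obtain n0 where "\<And>n. n0 \<le> n \<Longrightarrow> L n < ereal C" by (auto simp: eventually_sequentially)
    moreover have "n0 \<le> N * Suc n0" using N by (metis Suc_leD mult_le_mono1 nat_mult_1)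
    ultimately have "L (N * Suc n0) < ereal C" by blast
    then show False using LC[of "Suc n0"] by simp
  qed
  also have "limsup L \<le> top_entropy f"
    unfolding top_entropy_def L_def using gap(1) by (intro SUP_upper) simp
  finally show ?thesis using \<open>0 < C\<close> by (metis ereal_less(2) order.strict_trans2)
qed

text \<open>Constant continuation of \<open>f\<close> beyond the endpoints of I, written as clamping
  the argument: iterates on I are unchanged, and the map becomes continuous on the whole line, as
  \<open>tame\<close> demands.\<close>

definition extend :: "(real \<Rightarrow> real) \<Rightarrow> real \<Rightarrow> real" where
  "extend f t = f (max 0 (min 1 t))"

lemma extend_range: "interval_map f \<Longrightarrow> extend f t \<in> {0..1}"
  by (force simp: extend_def interval_map_def image_subset_iff)

lemma funpow_interval_map: "interval_map f \<Longrightarrow> t \<in> {0..1} \<Longrightarrow> (f^^n) t \<in> {0..1}"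
  by (induction n) (force simp: interval_map_def image_subset_iff)+

lemma funpow_extend:
  assumes "interval_map f" "t \<in> {0..1}" shows "(extend f^^n) t = (f^^n) t"
proof (induction n)
  case (Suc n)
  then show ?case using funpow_interval_map[OF assms, of n] by (simp add: extend_def)
qed simp

lemma continuous_extend: "interval_map f \<Longrightarrow> continuous_on UNIV (extend f)"
  unfolding extend_def[abs_def] interval_map_def
  by (intro continuous_on_compose2[of "{0..1}" f UNIV] continuous_intros) auto

lemma extend_funpow_range:
  assumes "interval_map f" "1 \<le> n" shows "(extend f^^n) t \<in> {0..1}"
  using assms extend_range[OF assms(1)] by (cases n) auto

text \<open>The preimages \<open>s\<close> of \<open>p\<close> in \<open>[c, p]\<close> and
  \<open>r\<close> in \<open>[p, q]\<close> differ from \<open>p\<close>. In one step each of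
  \<open>[c, s]\<close> and \<open>[r, q]\<close> covers \<open>[c, p]\<close>, and in a second one
  \<open>[c, p]\<close> covers \<open>[c, q]\<close>. As \<open>c\<close> is a value of the map and
  \<open>q\<close> is below one, all this happens in I, and the horseshoe belongs to
  \<open>f\<close> itself.\<close>

lemma tame_extend:
  assumes im: "interval_map f" and ent: "top_entropy f = 0"
  shows "tame (extend f)"
proof -
  have horseshoe: False
    if n: "1 \<le> n" and J: "s1 \<le> s2" "r1 \<le> r2" "{s1..s2} \<subseteq> {u..v}" "{r1..r2} \<subseteq> {u..v}" "{u..v} \<subseteq> {0..1}"
      and gap: "s2 < r1 \<or> r2 < s1"
      and cov: "{u..v} \<subseteq> (extend f^^(n + n)) ` {s1..s2}" "{u..v} \<subseteq> (extend f^^(n + n)) ` {r1..r2}"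
    for n s1 s2 r1 r2 u v
  proof -
    define K where "K a = (if a then {s1..s2} else {r1..r2})" for a
    define e where "e = max (r1 - s2) (s1 - r2) / 2"
    have K01: "K a \<subseteq> {0..1}" for a using J by (auto simp: K_def)
    have "(extend f^^(n + n)) ` K a = (f^^(n + n)) ` K a" for a
      using K01[of a] funpow_extend[OF im] by (intro image_cong) auto
    moreover have "K b \<subseteq> {u..v}" for b using J(3,4) by (simp add: K_def)
    moreover have "{u..v} \<subseteq> (extend f^^(n + n)) ` K a" for a using cov by (simp add: K_def)
    ultimately have "K b \<subseteq> (f^^(n + n)) ` K a" for a b by blast
    moreover have "0 < e" using gap by (auto simp: e_def)
    moreover have "e < \<bar>p - q\<bar>" if "p \<in> K True" "q \<in> K False" for p q
      using that gap J(1,2) by (auto simp: K_def e_def abs_if max_def)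
    ultimately have "0 < top_entropy f"
      using horseshoe_top_entropy_pos[of K "n + n" f e] K01 J n by (auto simp: K_def)
    then show False using ent by simp
  qed
  have "homoclinic_free (extend f)"
    unfolding homoclinic_free_def
  proof (intro allI impI conjI notI)
    fix n :: nat and c p q :: real
    assume n: "1 \<le> n" and c: "(extend f^^n) c = c"
      and h: "c < p \<and> p < q \<and> q \<le> (extend f^^n) p \<and> (extend f^^n) q \<le> c"
    let ?g = "extend f^^n"
    have cont: "continuous_on UNIV ?g" by (rule continuous_on_funpow[OF continuous_extend[OF im]])
    have g2: "extend f^^(n + n) = ?g \<circ> ?g" by (simp add: funpow_add)
    have I: "{c..q} \<subseteq> {0..1}" using extend_funpow_range[OF im n, of c] extend_funpow_range[OF im n, of p] c h by auto
    obtain s where s: "c \<le> s" "s \<le> p" "?g s = p" by (rule ivt_between[OF cont, of c p p]) (use h c in auto)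
    obtain r where r: "p \<le> r" "r \<le> q" "?g r = p" by (rule ivt_between[OF cont, of p p q]) (use h in auto)
    have ne: "s \<noteq> p" "r \<noteq> p" using s r h by auto
    have big: "{c..q} \<subseteq> ?g ` {c..p}" by (rule segment_covered[OF cont, of c _ _ p]) (use h c in auto)
    have "{c..p} \<subseteq> ?g ` {c..s}" by (rule segment_covered[OF cont, of c _ _ s]) (use h c s in auto)
    then have 1: "{c..q} \<subseteq> (extend f^^(n + n)) ` {c..s}" using big unfolding g2 image_comp[symmetric] by (meson image_mono order.trans)
    have "{c..p} \<subseteq> ?g ` {r..q}" by (rule segment_covered[OF cont, of q _ _ r]) (use h r in auto)
    then have 2: "{c..q} \<subseteq> (extend f^^(n + n)) ` {r..q}" using big unfolding g2 image_comp[symmetric] by (meson image_mono order.trans)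
    show False by (rule horseshoe[OF n, of c s r q c q]) (use s r h ne I 1 2 in auto)
  next
    fix n :: nat and c p q :: real
    assume n: "1 \<le> n" and c: "(extend f^^n) c = c"
      and h: "q < p \<and> p < c \<and> (extend f^^n) p \<le> q \<and> c \<le> (extend f^^n) q"
    let ?g = "extend f^^n"
    have cont: "continuous_on UNIV ?g" by (rule continuous_on_funpow[OF continuous_extend[OF im]])
    have g2: "extend f^^(n + n) = ?g \<circ> ?g" by (simp add: funpow_add)
    have I: "{q..c} \<subseteq> {0..1}" using extend_funpow_range[OF im n, of c] extend_funpow_range[OF im n, of p] c h by auto
    obtain s where s: "p \<le> s" "s \<le> c" "?g s = p" by (rule ivt_between[OF cont, of p p c]) (use h c in auto)
    obtain r where r: "q \<le> r" "r \<le> p" "?g r = p" by (rule ivt_between[OF cont, of q p p]) (use h in auto)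
    have ne: "s \<noteq> p" "r \<noteq> p" using s r h by auto
    have big: "{q..c} \<subseteq> ?g ` {p..c}" by (rule segment_covered[OF cont, of p _ _ c]) (use h c in auto)
    have "{p..c} \<subseteq> ?g ` {s..c}" by (rule segment_covered[OF cont, of s _ _ c]) (use h c s in auto)
    then have 1: "{q..c} \<subseteq> (extend f^^(n + n)) ` {s..c}" using big unfolding g2 image_comp[symmetric] by (meson image_mono order.trans)
    have "{p..c} \<subseteq> ?g ` {q..r}" by (rule segment_covered[OF cont, of r _ _ q]) (use h r in auto)
    then have 2: "{q..c} \<subseteq> (extend f^^(n + n)) ` {q..r}" using big unfolding g2 image_comp[symmetric] by (meson image_mono order.trans)
    show False by (rule horseshoe[OF n, of s c q r q c]) (use s r h ne I 1 2 in auto)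
  qed
  moreover have "\<bar>extend f t\<bar> \<le> 1" for t using extend_range[OF im, of t] by auto
  ultimately show ?thesis using continuous_extend[OF im] by (simp add: tame_def)
qed

section \<open>Counting crossings of a fixed point\<close>

text \<open>Uniform continuity makes every interval \<open>[a j, b j]\<close> at least
  \<open>h\<close> long. As they do not overlap, their left endpoints fall in different cells of
  length \<open>h\<close>, of which finitely many meet \<open>[-1, 1]\<close>.\<close>

lemma oscillations_bounded:
  fixes f :: "real \<Rightarrow> real"
  assumes "continuous_on UNIV f" "0 < d"
  obtains M :: nat where "\<And>(S :: nat set) a b. \<lbrakk>finite S;
      \<And>j. j \<in> S \<Longrightarrow> \<bar>a j\<bar> \<le> 1 \<and> \<bar>b j\<bar> \<le> 1 \<and> a j < b j \<and> d \<le> \<bar>f (a j) - f (b j)\<bar>;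
      \<And>i j. i \<in> S \<Longrightarrow> j \<in> S \<Longrightarrow> i < j \<Longrightarrow> b i \<le> a j \<or> b j \<le> a i\<rbrakk> \<Longrightarrow> card S \<le> M"
proof -
  have "uniformly_continuous_on {-1..1} f"
    using assms(1) by (intro compact_uniformly_continuous) (auto intro: continuous_on_subset)
  then obtain h where h: "0 < h" "\<And>s t. s \<in> {-1..1} \<Longrightarrow> t \<in> {-1..1} \<Longrightarrow> \<bar>s - t\<bar> < h \<Longrightarrow> \<bar>f s - f t\<bar> < d"
    using assms(2) unfolding uniformly_continuous_on_def dist_real_def by metis
  define R where "R = {\<lfloor>- 1 / h\<rfloor>..\<lfloor>1 / h\<rfloor>}"
  show ?thesis
  proof (rule that[of "card R"])
    fix S :: "nat set" and a b :: "nat \<Rightarrow> real"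
    assume fin: "finite S"
      and ab: "\<And>j. j \<in> S \<Longrightarrow> \<bar>a j\<bar> \<le> 1 \<and> \<bar>b j\<bar> \<le> 1 \<and> a j < b j \<and> d \<le> \<bar>f (a j) - f (b j)\<bar>"
      and sep: "\<And>i j. i \<in> S \<Longrightarrow> j \<in> S \<Longrightarrow> i < j \<Longrightarrow> b i \<le> a j \<or> b j \<le> a i"
    have long: "a j + h \<le> b j" if "j \<in> S" for j
    proof (rule ccontr)
      assume "\<not> ?thesis"
      then have "\<bar>a j - b j\<bar> < h" using ab[OF that] by auto
      moreover have "a j \<in> {-1..1}" "b j \<in> {-1..1}" using ab[OF that] by (auto simp: abs_le_iff)
      ultimately show False using h(2)[of "a j" "b j"] ab[OF that] by auto
    qed
    have apart: "\<lfloor>u / h\<rfloor> \<noteq> \<lfloor>v / h\<rfloor>" if "u + h \<le> v" for u v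
    proof -
      have "u / h + 1 \<le> v / h" using divide_right_mono[OF that, of h] h(1) by (simp add: add_divide_distrib)
      then show ?thesis by linarith
    qed
    have "\<lfloor>a i / h\<rfloor> \<noteq> \<lfloor>a j / h\<rfloor>" if "i \<in> S" "j \<in> S" "i < j" for i j
      using sep[OF that] apart[of "a i" "a j"] apart[of "a j" "a i"] long[OF that(1)] long[OF that(2)] by fastforce
    then have inj: "inj_on (\<lambda>j. \<lfloor>a j / h\<rfloor>) S" by (rule linorder_inj_onI') auto
    have sub: "(\<lambda>j. \<lfloor>a j / h\<rfloor>) ` S \<subseteq> R"
    proof
      fix v assume "v \<in> (\<lambda>j. \<lfloor>a j / h\<rfloor>) ` S"
      then obtain j where j: "j \<in> S" "v = \<lfloor>a j / h\<rfloor>" by blast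
      have "- 1 \<le> a j" "a j \<le> 1" using ab[OF j(1)] by (auto simp: abs_le_iff)
      then have "- 1 / h \<le> a j / h" "a j / h \<le> 1 / h"
        using h(1) divide_right_mono[of "- 1" "a j" h] divide_right_mono[of "a j" 1 h] by simp_all
      then show "v \<in> R" unfolding R_def j(2) by (auto intro: floor_mono)
    qed
    have "finite R" by (simp add: R_def)
    then show "card S \<le> card R" using card_inj_on_le[OF inj sub] by simp
  qed
qed

lemma orbit_not_fixed:
  assumes "f c = c" "i \<le> j" "(f^^j) z \<noteq> c" shows "(f^^i) z \<noteq> c"
  using assms funpow_fixed[of f c "j - i"] funpow_apply[of "j - i" f i z] by auto

text \<open>Strict alternation from \<open>b j\<close> on would put the orbit right of
  \<open>c\<close> at time \<open>k j\<close>, an even number of steps later. So the period from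
  \<open>b j\<close> to \<open>b (Suc j)\<close> contains a run on the left, or else a run on the
  right before \<open>k j\<close>. Either kind leaves a preimage \<open>q\<close> of
  \<open>c\<close> as a barrier for the future, which makes the oscillations found in different
  periods of the same kind disjoint. The bound depends only on \<open>f\<close> and
  \<open>d\<close>, not on \<open>c\<close>, \<open>z\<close> or the times.\<close>

lemma crossings_bounded:
  assumes tf: "tame f" and d: "0 < d"
  obtains m where "\<And>c z b k. \<lbrakk>separates f c z; \<bar>z\<bar> \<le> 1;
      \<And>j. j < m \<Longrightarrow> b j < k j \<and> k j < b (Suc j) \<and> even (k j - b j);
      \<And>j. j \<le> m \<Longrightarrow> c < (f^^(b j)) z; \<And>j. j < m \<Longrightarrow> (f^^(k j)) z < c - d\<rbrakk> \<Longrightarrow> False"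
proof -
  obtain M where M: "\<And>(S :: nat set) a b. \<lbrakk>finite S;
      \<And>j. j \<in> S \<Longrightarrow> \<bar>a j\<bar> \<le> 1 \<and> \<bar>b j\<bar> \<le> 1 \<and> a j < b j \<and> d \<le> \<bar>f (a j) - f (b j)\<bar>;
      \<And>i j. i \<in> S \<Longrightarrow> j \<in> S \<Longrightarrow> i < j \<Longrightarrow> b i \<le> a j \<or> b j \<le> a i\<rbrakk> \<Longrightarrow> card S \<le> M"
    using oscillations_bounded[OF tame_continuous[OF tf] d] by metis
  \<comment> \<open>There are at most \<open>M + 1\<close> counted periods with a run on the left
    and \<open>M\<close> without. The last period is not counted, and
    \<open>m - 1 = 2 * M + 2\<close> is one too many.\<close>
  define m where "m = 2 * M + 3"
  show ?thesis
  proof (rule that[of m])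
    fix c z b k
    assume sep: "separates f c z" and z1: "\<bar>z\<bar> \<le> 1"
      and bk: "\<And>j. j < m \<Longrightarrow> b j < k j \<and> k j < b (Suc j) \<and> even (k j - b j)"
      and R: "\<And>j. j \<le> m \<Longrightarrow> c < (f^^(b j)) z" and L: "\<And>j. j < m \<Longrightarrow> (f^^(k j)) z < c - d"
    have fc: "f c = c" using sep by (simp add: separates_def)
    have zb: "\<bar>(f^^n) z\<bar> \<le> 1" for n using z1 tame_funpow_bound[OF tf, of n z] by (cases n) auto
    have bmono: "b i \<le> b j" if "i \<le> j" "j \<le> m" for i j
      using that
    proof (induction j rule: dec_induct)
      case (step j)
      then show ?case using bk[of j] by simp
    qed simp
    have nc: "(f^^n) z \<noteq> c" if "n \<le> b m" for n
      using orbit_not_fixed[where f = f, OF fc that, of z] R[of m] by simp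
    define lrun where "lrun j \<longleftrightarrow> (\<exists>n. b j \<le> n \<and> n < b (Suc j) \<and> (f^^n) z < c \<and> (f^^Suc n) z < c)" for j
    define ev where "ev j r q \<longleftrightarrow> b j \<le> r \<and> r + 2 \<le> b (Suc j) \<and> (f^^r) z < q \<and> q < (f^^Suc r) z \<and>
      (f^^Suc r) z < c \<and> f q = c" for j r q
    define rev where "rev j r q \<longleftrightarrow> b j \<le> r \<and> r + 2 \<le> k j \<and> q < (f^^r) z \<and> (f^^Suc r) z < q \<and>
      c < (f^^Suc r) z \<and> f q = c \<and> c < (f^^(k j - 1)) z" for j r q
    have evI: "\<exists>r q. ev j r q" if "lrun j" "j < m" for j
    proof -
      obtain n where n: "b j \<le> n" "n < b (Suc j)" "(f^^n) z < c" "(f^^Suc n) z < c" using \<open>lrun j\<close> lrun_def by auto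
      have "c < (f^^(b (Suc j))) z" using R[of "Suc j"] \<open>j < m\<close> by simp
      from left_run_event[OF tf sep n(3,4,2) this] obtain r q where "n \<le> r" "r + 2 \<le> b (Suc j)"
        "(f^^r) z < q" "q < (f^^Suc r) z" "(f^^Suc r) z < c" "f q = c" by metis
      then have "ev j r q" using n(1) unfolding ev_def by simp
      then show ?thesis by blast
    qed
    have revI: "\<exists>r q. rev j r q" if nl: "\<not> lrun j" and j: "j < m" for j
    proof -
      have kb: "b j < k j" "k j < b (Suc j)" "even (k j - b j)" using bk[OF j] by auto
      have le: "b (Suc j) \<le> b m" using bmono[of "Suc j" m] j by simp
      have "\<exists>n. b j \<le> n \<and> n < k j \<and> c < (f^^n) z \<and> c < (f^^Suc n) z"
      proof (rule ccontr)
        assume no: "\<not> ?thesis"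
        have "if even i then c < (f^^(b j + i)) z else (f^^(b j + i)) z < c" if "b j + i \<le> k j" for i
          using that
        proof (induction i)
          case 0
          then show ?case using R[of j] j by simp
        next
          case (Suc i)
          have n1: "(f^^(b j + i)) z \<noteq> c" "(f^^Suc (b j + i)) z \<noteq> c" using nc[of "b j + i"] nc[of "Suc (b j + i)"] Suc.prems kb le by auto
          have n2: "\<not> ((f^^(b j + i)) z < c \<and> (f^^Suc (b j + i)) z < c)"
            using nl Suc.prems kb unfolding lrun_def by (metis Suc_lessD add_Suc_right le_add1 order.strict_trans1 less_Suc_eq_le order.strict_trans2)
          have n3: "\<not> (c < (f^^(b j + i)) z \<and> c < (f^^Suc (b j + i)) z)"
            using no Suc.prems by (metis Suc_le_lessD add_Suc_right le_add1)
          show ?case using n1 n2 n3 Suc by (auto simp: not_less split: if_splits)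
        qed
        from this[of "k j - b j"] show False using kb L[OF j] d by simp
      qed
      then obtain n where n: "b j \<le> n" "n < k j" "c < (f^^n) z" "c < (f^^Suc n) z" by blast
      have "(f^^(k j)) z < c" using L[OF j] d by simp
      from right_run_event[OF tf sep n(3,4,2) this] obtain r q where rq: "n \<le> r" "r + 2 \<le> k j"
        "q < (f^^r) z" "(f^^Suc r) z < q" "c < (f^^Suc r) z" "f q = c" by metis
      \<comment> \<open>A predecessor left of \<open>c\<close> would form a run on the left together
        with the dip at time \<open>k j\<close>.\<close>
      have "\<not> (f^^(k j - 1)) z < c"
      proof
        assume "(f^^(k j - 1)) z < c"
        moreover have "(f^^Suc (k j - 1)) z < c" using L[OF j] d kb by simp
        moreover have "b j \<le> k j - 1" "k j - 1 < b (Suc j)" using kb by auto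
        ultimately show False using nl unfolding lrun_def by blast
      qed
      moreover have "(f^^(k j - 1)) z \<noteq> c" using nc[of "k j - 1"] kb le by simp
      ultimately have "rev j r q" using rq n(1) unfolding rev_def by auto
      then show ?thesis by blast
    qed
    obtain r q where rq: "\<And>j. j < m \<Longrightarrow> lrun j \<Longrightarrow> ev j (r j) (q j)" "\<And>j. j < m \<Longrightarrow> \<not> lrun j \<Longrightarrow> rev j (r j) (q j)"
    proof -
      have "\<forall>j. \<exists>p. j < m \<longrightarrow> (if lrun j then ev j (fst p) (snd p) else rev j (fst p) (snd p))"
      proof
        fix j show "\<exists>p. j < m \<longrightarrow> (if lrun j then ev j (fst p) (snd p) else rev j (fst p) (snd p))"
          using evI[of j] revI[of j] by (cases "lrun j") auto
      qed
      then obtain p where "\<And>j. j < m \<Longrightarrow> if lrun j then ev j (fst (p j)) (snd (p j)) else rev j (fst (p j)) (snd (p j))" by metis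
      then show ?thesis using that[of "\<lambda>j. fst (p j)" "\<lambda>j. snd (p j)"] by (metis (full_types))
    qed
    \<comment> \<open>In a period with a run on the left, \<open>f\<close> oscillates between \<open>z_r\<close> and \<open>q\<close>; otherwise it oscillates
      between the predecessor of the visit below \<open>c - d\<close> and \<open>q\<close>.\<close>
    define A where "A = {j. j < m - 1 \<and> lrun j}"
    define B where "B = {j. j < m - 1 \<and> \<not> lrun j}"
    have fin: "finite A" "finite B" by (auto simp: A_def B_def)
    have "card B \<le> M"
    proof (rule M[OF fin(2), of "\<lambda>j. (f^^(k j - 1)) z" q])
      fix j assume "j \<in> B"
      then have j: "j < m" and e: "rev j (r j) (q j)" using rq by (auto simp: B_def)
      have "(f^^(k j - 1)) z < q j"
      proof (cases "k j - 1 = Suc (r j)")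
        case True
        then show ?thesis using e unfolding rev_def by metis
      next
        case False
        then have "Suc (r j) < k j - 1" using e by (auto simp: rev_def)
        then show ?thesis using later_left_of_preimage[OF tf fc, of "Suc (r j)" z "q j"] e unfolding rev_def by blast
      qed
      moreover have "f ((f^^(k j - 1)) z) = (f^^(k j)) z" using bk[OF j] by (cases "k j") auto
      moreover have "\<bar>q j\<bar> \<le> 1" using e zb[of "r j"] zb[of "Suc (r j)"] unfolding rev_def abs_le_iff by linarith
      moreover have "f (q j) = c" using e by (simp add: rev_def)
      ultimately show "\<bar>(f^^(k j - 1)) z\<bar> \<le> 1 \<and> \<bar>q j\<bar> \<le> 1 \<and> (f^^(k j - 1)) z < q j \<and> d \<le> \<bar>f ((f^^(k j - 1)) z) - f (q j)\<bar>"
        using zb L[OF j] by auto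
    next
      fix i j assume "i \<in> B" "j \<in> B" and ij: "i < j"
      then have e: "rev i (r i) (q i)" "rev j (r j) (q j)" and jm: "j < m" using rq by (auto simp: B_def)
      \<comment> \<open>If \<open>q j\<close> were larger, it would confine the orbit below it from
        that time on; but the event of period \<open>j\<close> starts above
        \<open>q j\<close>.\<close>
      have "q j \<le> (f^^(k i - 1)) z"
      proof (rule ccontr)
        assume "\<not> ?thesis"
        moreover have "k i - 1 < r j" using bk[of i] bmono[of "Suc i" j] e ij jm by (auto simp: rev_def)
        ultimately have "(f^^(r j)) z < q j"
          using later_left_of_preimage[OF tf fc, of "k i - 1" z "q j" "r j"] e unfolding rev_def by auto
        then show False using e by (auto simp: rev_def)
      qed
      then show "q i \<le> (f^^(k j - 1)) z \<or> q j \<le> (f^^(k i - 1)) z" by blast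
    qed
    moreover have "card A \<le> Suc M"
    proof (cases "A = {}")
      case False
      \<comment> \<open>Earlier left events cannot jump past the barrier \<open>q l\<close> of the
        last one, and \<open>q l\<close> is below the next dip, at time \<open>k (Suc l)\<close>,
        hence below \<open>c - d\<close>. So their start is mapped below \<open>c - d\<close> while
        \<open>q j\<close> is mapped to \<open>c\<close>. This costs the event \<open>l\<close>
        itself, and requires one more period after it.\<close>
      define l where "l = Max A"
      have l: "l \<in> A" "\<And>j. j \<in> A \<Longrightarrow> j \<le> l" using False fin by (auto simp: l_def)
      have later: "q i < (f^^n) z" if "i \<in> A" "Suc (r i) < n" for i n
        using later_right_of_preimage[OF tf fc, of "q i" "Suc (r i)" z n] that rq(1)[of i] unfolding A_def ev_def by auto
      have "card (A - {l}) \<le> M"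
      proof (rule M[of _ "\<lambda>j. (f^^(r j)) z" q])
        show "finite (A - {l})" using fin by simp
        fix j assume "j \<in> A - {l}"
        then have j: "j \<in> A" "j < l" using l by (auto simp: le_neq_implies_less)
        have e: "ev j (r j) (q j)" "ev l (r l) (q l)" using rq(1) j l(1) by (auto simp: A_def)
        have lm: "Suc l < m" using l(1) by (auto simp: A_def m_def)
        have "(f^^Suc (r j)) z \<le> q l"
        proof (rule ccontr)
          assume "\<not> ?thesis"
          moreover have "Suc (r j) < r l" using bmono[of "Suc j" l] e j lm by (auto simp: ev_def)
          ultimately have "q l < (f^^(r l)) z"
            using later_right_of_preimage[OF tf fc, of "q l" "Suc (r j)" z "r l"] e unfolding ev_def by auto
          then show False using e by (auto simp: ev_def)
        qed
        also have "q l < (f^^(k (Suc l))) z" using later[OF l(1)] e(2) bk[OF lm] by (auto simp: ev_def)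
        also have "\<dots> < c - d" by (rule L[OF lm])
        finally have "f ((f^^(r j)) z) < c - d" by simp
        moreover have "f (q j) = c" "(f^^(r j)) z < q j" "q j < (f^^Suc (r j)) z" using e by (auto simp: ev_def)
        moreover have "\<bar>q j\<bar> \<le> 1" using e(1) zb[of "r j"] zb[of "Suc (r j)"] unfolding ev_def abs_le_iff by linarith
        ultimately show "\<bar>(f^^(r j)) z\<bar> \<le> 1 \<and> \<bar>q j\<bar> \<le> 1 \<and> (f^^(r j)) z < q j \<and> d \<le> \<bar>f ((f^^(r j)) z) - f (q j)\<bar>"
          using zb by auto
      next
        fix i j assume "i \<in> A - {l}" "j \<in> A - {l}" and ij: "i < j"
        then have e: "ev i (r i) (q i)" "ev j (r j) (q j)" "i \<in> A" and jm: "j < m" using rq by (auto simp: A_def)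
        have "Suc (r i) < r j" using bmono[of "Suc i" j] e ij jm by (auto simp: ev_def)
        then show "q i \<le> (f^^(r j)) z \<or> q j \<le> (f^^(r i)) z" using later[OF e(3)] by force
      qed
      then show ?thesis using card_Suc_Diff1[OF fin(1) l(1)] by simp
    qed simp
    moreover have "A \<union> B = {..<m - 1}" "A \<inter> B = {}" by (auto simp: A_def B_def)
    then have "card A + card B = m - 1" using card_Un_disjoint[OF fin] by simp
    ultimately show False by (simp add: m_def)
  qed
qed

section \<open>Stretching at IN-pairs\<close>

text \<open>Here \<open>t\<close> witnesses that \<open>(x, y)\<close> is not wandering: it forces the separating fixed point to lie
  between the neighbourhoods of \<open>x\<close> and \<open>y\<close>.\<close>

lemma return_left_of_separator:
  assumes tf: "tame f" and sep: "separates f c z" and b: "(f^^b) z < c" "t < (f^^b) z" and t: "f t < c"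
    and k: "b < k" "(f^^k) z < t"
  shows False
proof -
  have fc: "f c = c" using sep by (simp add: separates_def)
  have kc: "(f^^k) z < c" using b k by simp
  have "(f^^Suc b) z \<noteq> c" using orbit_not_fixed[where f = f, OF fc, of "Suc b" k z] k kc by auto
  \<comment> \<open>If the next point is right of \<open>c\<close>, a preimage of \<open>c\<close>
    lies between \<open>t\<close> and \<open>(f^^b) z\<close>. If it is left of \<open>c\<close>,
    either the orbit does not get right of \<open>c\<close> up to time \<open>k\<close> and so never
    falls, or the run ends with a preimage of \<open>c\<close> above \<open>(f^^b) z\<close>. In no
    case can the orbit be below \<open>t\<close> at time \<open>k\<close>.\<close>
  then consider "c < (f^^Suc b) z" | "(f^^Suc b) z < c" by linarith
  then show False
  proof cases
    case 1
    obtain q where q: "t \<le> q" "q \<le> (f^^b) z" "f q = c"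
      by (rule ivt_between[OF tame_continuous[OF tf], of t c "(f^^b) z"]) (use 1 t b in auto)
    have "q \<noteq> (f^^b) z" using q 1 by auto
    moreover have "(f^^(k - b)) ((f^^b) z) \<le> q" using k q by (simp add: funpow_apply)
    ultimately show False using no_homoclinic_left[OF tf fc, of q "(f^^b) z" 1 "k - b"] q b by simp
  next
    case 2
    have "\<exists>j. b < j \<and> j \<le> k \<and> c < (f^^j) z"
    proof (rule ccontr)
      assume no: "\<not> ?thesis"
      have "(f^^b) z \<le> (f^^j) z" if "b \<le> j" "j \<le> k" for j
        using that
      proof (induction j rule: dec_induct)
        case (step j)
        have "\<not> c < (f^^j) z" using no step b by (cases "j = b") auto
        then have "(f^^j) z \<le> (f^^Suc j) z" using sep unfolding separates_def by (meson linorder_not_less)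
        then show ?case using step by simp
      qed simp
      from this[of k] show False using k b by simp
    qed
    then obtain j where j: "b < j" "j \<le> k" "c < (f^^j) z" by blast
    obtain r q where rq: "b \<le> r" "r + 2 \<le> j" "(f^^b) z \<le> (f^^r) z" "(f^^r) z < q" "q < (f^^Suc r) z"
      "(f^^Suc r) z < c" "f q = c"
      using left_run_event[OF tf sep b(1) 2 j(1,3)] by metis
    have "q < (f^^k) z" using later_right_of_preimage[OF tf fc, of q "Suc r" z k] rq j by simp
    then show False using rq b k by simp
  qed
qed

lemma return_right_of_separator:
  assumes tf: "tame f" and sep: "separates f c z" and "c < (f^^b) z" "(f^^b) z < t" and "c < f t"
    and "b < k" "t < (f^^k) z"
  shows False
  using return_left_of_separator[OF tame_mirror[OF tf] separates_mirror[OF sep], of b "- t" k] assms(3-)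
  by (simp add: funpow_mirror mirror_def)

text \<open>Divisibility of the times by \<open>n\<close> lets the property pass to iterates:
  multiples of \<open>n * 2\<close> become even times for \<open>f^^n\<close>, and evenness is what
  \<open>crossings_bounded\<close> needs.\<close>

definition indep_returns :: "(real \<Rightarrow> real) \<Rightarrow> nat \<Rightarrow> real \<Rightarrow> real \<Rightarrow> bool" where
  "indep_returns f n x y \<longleftrightarrow> (\<forall>e>0. \<forall>m. \<exists>T :: nat \<Rightarrow> nat.
     (\<forall>i<m. \<forall>j<m. i < j \<longrightarrow> T i < T j) \<and> (\<forall>i<m. n dvd T i) \<and>
     (\<forall>s :: nat \<Rightarrow> bool. \<exists>w. \<bar>w\<bar> \<le> 1 \<and>
        (\<forall>i<m. (f^^(T i)) w \<in> (if s i then {x - e<..<x + e} else {y - e<..<y + e}))))"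

lemma orbit_descends:
  fixes f :: "real \<Rightarrow> real"
  assumes "b < k" "(f^^k) z < (f^^b) z" obtains i where "(f^^Suc i) z < (f^^i) z"
proof (rule ccontr)
  assume "\<not> thesis"
  then have "(f^^i) z \<le> (f^^Suc i) z" for i using that by (meson linorder_not_less)
  then have "incseq (\<lambda>i. (f^^i) z)" by (intro incseq_SucI)
  then show False using assms by (auto simp: incseq_def) (metis less_imp_le linorder_not_less)
qed

lemma orbit_ascends:
  fixes f :: "real \<Rightarrow> real"
  assumes "b < k" "(f^^b) z < (f^^k) z" obtains i where "(f^^i) z < (f^^Suc i) z"
proof (rule ccontr)
  assume "\<not> thesis"
  then have "(f^^Suc i) z \<le> (f^^i) z" for i using that by (meson linorder_not_less)
  then have "decseq (\<lambda>i. (f^^i) z)" by (intro decseq_SucI)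
  then show False using assms by (auto simp: decseq_def) (metis less_imp_le linorder_not_less)
qed

text \<open>Prescribe visits near \<open>y\<close>, \<open>x\<close>, \<open>y\<close>,
  \<open>x\<close> and so on at even times. Since \<open>t\<close> and \<open>f t\<close> lie
  between the two neighbourhoods, the separating fixed point \<open>c\<close> has the visits near
  \<open>y\<close> on its right and those near \<open>x\<close> on its left. One of \<open>x\<close>
  and \<open>y\<close> is at least half of \<open>y - x\<close> away from \<open>c\<close>, and the
  crossings to that side exceed their bound.\<close>

lemma no_return_if_indep_returns:
  assumes tf: "tame f" and ind: "indep_returns f 2 x y" and t: "t \<in> {x<..<y}" "f t \<in> {x<..<y}"
  shows False
proof -
  \<comment> \<open>A quarter of the length: the farther of \<open>x\<close> and \<open>y\<close> is
    at least two quarters away from \<open>c\<close>, and the radius \<open>e\<close> uses up at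
    most one of them.\<close>
  define d where "d = (y - x) / 4"
  define e where "e = min d (min (min (t - x) (f t - x)) (min (y - t) (y - f t)))"
  have d: "0 < d" and e: "0 < e" using t by (auto simp: d_def e_def)
  have ed: "e \<le> d" "x + e \<le> t" "x + e \<le> f t" "t \<le> y - e" "f t \<le> y - e"
    by (auto simp: e_def min_def)
  obtain m1 where m1: "\<And>c z b k. \<lbrakk>separates f c z; \<bar>z\<bar> \<le> 1;
      \<And>j. j < m1 \<Longrightarrow> b j < k j \<and> k j < b (Suc j) \<and> even (k j - b j);
      \<And>j. j \<le> m1 \<Longrightarrow> c < (f^^(b j)) z; \<And>j. j < m1 \<Longrightarrow> (f^^(k j)) z < c - d\<rbrakk> \<Longrightarrow> False"
    using crossings_bounded[OF tf d] by blast
  obtain m2 where m2: "\<And>c z b k. \<lbrakk>separates (mirror f) c z; \<bar>z\<bar> \<le> 1;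
      \<And>j. j < m2 \<Longrightarrow> b j < k j \<and> k j < b (Suc j) \<and> even (k j - b j);
      \<And>j. j \<le> m2 \<Longrightarrow> c < (mirror f^^(b j)) z; \<And>j. j < m2 \<Longrightarrow> (mirror f^^(k j)) z < c - d\<rbrakk> \<Longrightarrow> False"
    using crossings_bounded[OF tame_mirror[OF tf] d] by blast
  define P where "P = 2 * max m1 m2 + 4"
  obtain T where T: "\<And>i j. j < Suc P \<Longrightarrow> i < j \<Longrightarrow> T i < T j" "\<And>i. i < Suc P \<Longrightarrow> even (T i)"
    and Ts: "\<forall>s :: nat \<Rightarrow> bool. \<exists>w. \<bar>w\<bar> \<le> 1 \<and>
        (\<forall>i<Suc P. (f^^(T i)) w \<in> (if s i then {x - e<..<x + e} else {y - e<..<y + e}))"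
  proof -
    obtain T where "\<forall>i<Suc P. \<forall>j<Suc P. i < j \<longrightarrow> T i < T j" "\<forall>i<Suc P. 2 dvd T i"
      "\<forall>s :: nat \<Rightarrow> bool. \<exists>w. \<bar>w\<bar> \<le> 1 \<and>
        (\<forall>i<Suc P. (f^^(T i)) w \<in> (if s i then {x - e<..<x + e} else {y - e<..<y + e}))"
      using ind[unfolded indep_returns_def, rule_format, OF e, of "Suc P"] by blast
    then show ?thesis using that[of T] by simp
  qed
  obtain z where z: "\<bar>z\<bar> \<le> 1"
    and zs: "\<And>i. i < Suc P \<Longrightarrow> (f^^(T i)) z \<in> (if odd i then {x - e<..<x + e} else {y - e<..<y + e})"
    using Ts[rule_format, of odd] by blast
  have A: "(f^^(T i)) z < x + e" if "odd i" "i < Suc P" for i using zs[of i] that by auto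
  have B: "y - e < (f^^(T i)) z" if "even i" "i < Suc P" for i using zs[of i] that by auto
  have xye: "x + e < y - e" using ed(1) e by (auto simp: d_def)
  have AB: "(f^^(T i)) z < (f^^(T j)) z" if "odd i" "even j" "i < Suc P" "j < Suc P" for i j
    using A[OF that(1,3)] B[OF that(2,4)] xye by simp
  obtain i where i: "(f^^Suc i) z < (f^^i) z"
    by (rule orbit_descends[of "T 0" "T 1" f z]) (use T(1)[of 1 0] AB[of 1 0] in \<open>auto simp: P_def\<close>)
  obtain j where j: "(f^^j) z < (f^^Suc j) z"
    by (rule orbit_ascends[of "T 1" "T 2" f z]) (use T(1)[of 2 1] AB[of 1 2] in \<open>auto simp: P_def\<close>)
  obtain c where sep: "separates f c z" using separating_fixed_point[OF tf j i] by blast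
  have fc: "f c = c" using sep by (simp add: separates_def)
  have ne: "(f^^(T i)) z \<noteq> c" if "i < P" for i
  proof
    assume h: "(f^^(T i)) z = c"
    have "(f^^(T (Suc i))) z = c"
      using orbit_not_fixed[where f = f, OF fc, of "T i" "T (Suc i)" z] h T(1)[of "Suc i" i] that
        funpow_fixed[where f = f, OF fc] funpow_apply[of "T (Suc i) - T i" f "T i" z] by simp
    then show False using AB[of i "Suc i"] AB[of "Suc i" i] h that by (cases "odd i") auto
  qed
  have Bc: "c < (f^^(T i)) z" if "even i" "i < P" for i
  proof (rule ccontr)
    assume "\<not> ?thesis"
    then have "(f^^(T i)) z < c" using ne[OF that(2)] by simp
    moreover have "y - e < (f^^(T i)) z" using B that by simp
    moreover have "(f^^(T (Suc i))) z < x + e" using A[of "Suc i"] that by simp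
    ultimately show False
      using return_left_of_separator[OF tf sep, of "T i" t "T (Suc i)"] T(1)[of "Suc i" i] that ed by simp
  qed
  have Ac: "(f^^(T i)) z < c" if "odd i" "i < P" for i
  proof (rule ccontr)
    assume "\<not> ?thesis"
    then have "c < (f^^(T i)) z" using ne[OF that(2)] by simp
    moreover have "(f^^(T i)) z < x + e" using A that by simp
    moreover have "y - e < (f^^(T (Suc i))) z" using B[of "Suc i"] that by simp
    ultimately show False
      using return_right_of_separator[OF tf sep, of "T i" t "T (Suc i)"] T(1)[of "Suc i" i] that ed by simp
  qed
  show False
  proof (cases "(x + y) / 2 \<le> c")
    case True
    show False
    proof (rule m1[OF sep z, of "\<lambda>j. T (2 * j)" "\<lambda>j. T (2 * j + 1)"])
      show "T (2 * j) < T (2 * j + 1) \<and> T (2 * j + 1) < T (2 * Suc j) \<and> even (T (2 * j + 1) - T (2 * j))" if "j < m1" for j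
        using T(1)[of "2 * j + 1" "2 * j"] T(1)[of "2 * Suc j" "2 * j + 1"] T(2)[of "2 * j"] T(2)[of "2 * j + 1"] that
        by (auto simp: P_def)
      show "c < (f^^(T (2 * j))) z" if "j \<le> m1" for j using Bc[of "2 * j"] that by (auto simp: P_def)
      show "(f^^(T (2 * j + 1))) z < c - d" if "j < m1" for j
      proof -
        have "(f^^(T (2 * j + 1))) z < x + e" using A[of "2 * j + 1"] that by (auto simp: P_def)
        moreover have "x + e \<le> c - d" using True ed(1) by (simp add: d_def field_simps)
        ultimately show ?thesis by simp
      qed
    qed
  next
    case False
    have z': "\<bar>- z\<bar> \<le> 1" using z by simp
    show False
    proof (rule m2[OF separates_mirror[OF sep] z', of "\<lambda>j. T (2 * j + 1)" "\<lambda>j. T (2 * j + 2)"])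
      show "T (2 * j + 1) < T (2 * j + 2) \<and> T (2 * j + 2) < T (2 * Suc j + 1) \<and> even (T (2 * j + 2) - T (2 * j + 1))" if "j < m2" for j
        using T(1)[of "2 * j + 2" "2 * j + 1"] T(1)[of "2 * Suc j + 1" "2 * j + 2"] T(2)[of "2 * j + 1"] T(2)[of "2 * j + 2"] that
        by (auto simp: P_def)
      show "- c < (mirror f^^(T (2 * j + 1))) (- z)" if "j \<le> m2" for j
        using Ac[of "2 * j + 1"] that by (auto simp: P_def funpow_mirror)
      show "(mirror f^^(T (2 * j + 2))) (- z) < - c - d" if "j < m2" for j
      proof -
        have "y - e < (f^^(T (2 * j + 2))) z" using B[of "2 * j + 2"] that by (auto simp: P_def)
        moreover have "c + d \<le> y - e" using False ed(1) by (simp add: d_def field_simps)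
        ultimately show ?thesis by (simp add: funpow_mirror)
      qed
    qed
  qed
qed

lemma segment_wandering_if_indep_returns:
  assumes tf: "tame f" and ind: "\<And>n. 1 \<le> n \<Longrightarrow> indep_returns f n x y"
    and n: "1 \<le> n" and t: "t \<in> {x<..<y}"
  shows "(f^^n) t \<notin> {x<..<y}"
proof
  assume ft: "(f^^n) t \<in> {x<..<y}"
  have "indep_returns (f^^n) 2 x y"
    unfolding indep_returns_def
  proof (intro allI impI)
    fix e :: real and m :: nat assume "0 < e"
    moreover have "indep_returns f (n * 2) x y" using ind[of "n * 2"] n by simp
    ultimately obtain T where T: "\<forall>i<m. \<forall>j<m. i < j \<longrightarrow> T i < T j" "\<And>i. i < m \<Longrightarrow> n * 2 dvd T i"
      "\<forall>s :: nat \<Rightarrow> bool. \<exists>w. \<bar>w\<bar> \<le> 1 \<and>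
        (\<forall>i<m. (f^^(T i)) w \<in> (if s i then {x - e<..<x + e} else {y - e<..<y + e}))"
      unfolding indep_returns_def by metis
    define T' where "T' i = T i div n" for i
    have nT: "T i = n * T' i" if "i < m" for i
      using T(2)[OF that] by (metis T'_def dvd_mult_div_cancel dvd_mult_left)
    have "\<forall>i<m. \<forall>j<m. i < j \<longrightarrow> T' i < T' j"
    proof (intro allI impI)
      fix i j assume "i < m" "j < m" "i < j"
      then have "n * T' i < n * T' j" using T(1) nT by metis
      then show "T' i < T' j" by simp
    qed
    moreover have "2 dvd T' i" if "i < m" for i
      using T(2)[OF that] nT[OF that] n by simp
    moreover have "((f^^n)^^(T' i)) w = (f^^(T i)) w" if "i < m" for i w
      using nT[OF that] by (simp add: funpow_mult)
    ultimately show "\<exists>T. (\<forall>i<m. \<forall>j<m. i < j \<longrightarrow> T i < T j) \<and> (\<forall>i<m. 2 dvd T i) \<and>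
       (\<forall>s :: nat \<Rightarrow> bool. \<exists>w. \<bar>w\<bar> \<le> 1 \<and> (\<forall>i<m. ((f^^n)^^(T i)) w \<in> (if s i then {x - e<..<x + e} else {y - e<..<y + e})))"
      using T(3) by (intro exI[of _ T']) simp
  qed
  then show False using no_return_if_indep_returns[OF tame_funpow[OF tf n] _ t ft] by blast
qed

text \<open>By closure, the images of the endpoints avoid \<open>(x, y)\<close> as well. The image
  of \<open>[x, y]\<close> is connected, so it lies on one side.\<close>

lemma wandering_image_side:
  assumes tf: "tame f" and w: "\<And>t. t \<in> {x<..<y} \<Longrightarrow> (f^^n) t \<notin> {x<..<y}" and xy: "x < y"
  shows "(\<forall>t\<in>{x..y}. (f^^n) t \<le> x) \<or> (\<forall>t\<in>{x..y}. y \<le> (f^^n) t)"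
proof -
  have cont: "continuous_on S (f^^n)" for S by (rule tame_funpow_continuous[OF tf])
  have "open {t. x < (f^^n) t}" "open {t. (f^^n) t < y}"
    by (intro open_Collect_less cont continuous_intros)+
  then have "open ({t. x < (f^^n) t} \<inter> {t. (f^^n) t < y})" by blast
  then have op: "open {t. (f^^n) t \<in> {x<..<y}}" by (simp add: Int_def)
  have out: "(f^^n) t \<notin> {x<..<y}" if "t \<in> {x..y}" for t
  proof
    assume "(f^^n) t \<in> {x<..<y}"
    then have "t \<in> {t. (f^^n) t \<in> {x<..<y}} \<inter> closure {x<..<y}" using that xy by simp
    then have "{t. (f^^n) t \<in> {x<..<y}} \<inter> {x<..<y} \<noteq> {}"
      using open_Int_closure_eq_empty[OF op] by blast
    then show False using w by blast
  qed
  show ?thesis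
  proof (rule ccontr)
    assume "\<not> ?thesis"
    then obtain s t where st: "s \<in> {x..y}" "t \<in> {x..y}" "(f^^n) s > x" "(f^^n) t < y" by (auto simp: not_le)
    then have "(f^^n) t \<le> x" "y \<le> (f^^n) s" using out[of s] out[of t] by auto
    then have "{x..y} \<subseteq> (f^^n) ` {x..y}" using segment_covered[OF cont st(2,1)] by blast
    then have "(x + y) / 2 \<in> (f^^n) ` {x..y}" using xy by (auto simp: field_simps)
    then obtain u where "u \<in> {x..y}" "(f^^n) u = (x + y) / 2" by auto
    then show False using out[of u] xy by simp
  qed
qed

text \<open>The visits at \<open>T 1\<close> and \<open>T 3\<close> only serve to push the preceding
  ones out of \<open>[x, y]\<close>: each iterate maps \<open>[x, y]\<close> to one side, so a point
  that goes near the endpoint on the other side does not start in it. A visit near \<open>x\<close>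
  at \<open>T 0\<close> or \<open>T 2\<close> is then strictly left of \<open>x\<close>, one near
  \<open>y\<close> strictly right of \<open>y\<close>, and the four choices for these two visits are
  the four points of \<open>spreads_step\<close>.\<close>

lemma spreads_if_indep_returns:
  assumes tf: "tame f" and xy: "x < y" and ind: "\<And>n. 1 \<le> n \<Longrightarrow> indep_returns f n x y"
  shows "spreads f x y"
  unfolding spreads_def
proof (intro allI impI)
  fix e0 :: real assume "0 < e0"
  define e where "e = min e0 ((y - x) / 2)"
  have "0 < e" using \<open>0 < e0\<close> xy by (simp add: e_def)
  moreover have "e \<le> e0" "e \<le> (y - x) / 2" unfolding e_def by (rule min.cobounded1, rule min.cobounded2)
  ultimately have e: "0 < e" "e \<le> e0" "e \<le> (y - x) / 2" by auto
  obtain T where T: "\<And>i j. j < 4 \<Longrightarrow> i < j \<Longrightarrow> T i < T j"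
    and Ts: "\<forall>s :: nat \<Rightarrow> bool. \<exists>w. \<bar>w\<bar> \<le> 1 \<and>
        (\<forall>i<4. (f^^(T i)) w \<in> (if s i then {x - e<..<x + e} else {y - e<..<y + e}))"
  proof -
    obtain T where "\<forall>i<4. \<forall>j<4. i < j \<longrightarrow> T i < T j"
      "\<forall>s :: nat \<Rightarrow> bool. \<exists>w. \<bar>w\<bar> \<le> 1 \<and>
        (\<forall>i<4. (f^^(T i)) w \<in> (if s i then {x - e<..<x + e} else {y - e<..<y + e}))"
      using ind[of 1, unfolded indep_returns_def, rule_format, OF _ e(1), of 4] by auto
    then show ?thesis using that[of T] by simp
  qed
  have side: "(\<forall>t\<in>{x..y}. (f^^n) t \<le> x) \<or> (\<forall>t\<in>{x..y}. y \<le> (f^^n) t)" if n: "1 \<le> n" for n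
    by (rule wandering_image_side[OF tf _ xy]) (rule segment_wandering_if_indep_returns[OF tf ind n])
  have far: "\<exists>s::bool. \<forall>w. (f^^n) w \<in> (if s then {x - e<..<x + e} else {y - e<..<y + e}) \<longrightarrow> w \<notin> {x..y}"
    if "1 \<le> n" for n
    using side[OF that]
  proof
    assume "\<forall>t\<in>{x..y}. (f^^n) t \<le> x"
    then show ?thesis using e(3) xy by (intro exI[of _ False]) (force simp: field_simps)
  next
    assume "\<forall>t\<in>{x..y}. y \<le> (f^^n) t"
    then show ?thesis using e(3) xy by (intro exI[of _ True]) (force simp: field_simps)
  qed
  obtain s1 where s1: "\<And>w. (f^^(T 1 - T 0)) w \<in> (if s1 then {x - e<..<x + e} else {y - e<..<y + e}) \<Longrightarrow> w \<notin> {x..y}"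
  proof -
    have "1 \<le> T 1 - T 0" using T[of 1 0] by simp
    from far[OF this] show ?thesis using that by blast
  qed
  obtain s3 where s3: "\<And>w. (f^^(T 3 - T 2)) w \<in> (if s3 then {x - e<..<x + e} else {y - e<..<y + e}) \<Longrightarrow> w \<notin> {x..y}"
  proof -
    have "1 \<le> T 3 - T 2" using T[of 3 2] by simp
    from far[OF this] show ?thesis using that by blast
  qed
  have pts: "\<exists>w. (if a then w \<in> {x - e<..<x} else w \<in> {y<..<y + e}) \<and> (if b then (f^^(T 2 - T 0)) w < x else y < (f^^(T 2 - T 0)) w)" for a b
  proof -
    define s where "s i = (if i = 0 then a else if i = 1 then s1 else if i = 2 then b else s3)" for i :: nat
    obtain w where w: "\<forall>i<4. (f^^(T i)) w \<in> (if s i then {x - e<..<x + e} else {y - e<..<y + e})"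
      using Ts by blast
    have w0: "(f^^(T 0)) w \<in> (if a then {x - e<..<x + e} else {y - e<..<y + e})"
      and w1: "(f^^(T 1)) w \<in> (if s1 then {x - e<..<x + e} else {y - e<..<y + e})"
      and w2: "(f^^(T 2)) w \<in> (if b then {x - e<..<x + e} else {y - e<..<y + e})"
      and w3: "(f^^(T 3)) w \<in> (if s3 then {x - e<..<x + e} else {y - e<..<y + e})"
      using w[rule_format, of 0] w[rule_format, of 1] w[rule_format, of 2] w[rule_format, of 3] by (simp_all add: s_def)
    have "(f^^(T 0)) w \<notin> {x..y}" by (rule s1) (use w1 T[of 1 0] in \<open>simp add: funpow_apply\<close>)
    moreover have "(f^^(T 2)) w \<notin> {x..y}" by (rule s3) (use w3 T[of 3 2] in \<open>simp add: funpow_apply\<close>)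
    moreover have "(f^^(T 2 - T 0)) ((f^^(T 0)) w) = (f^^(T 2)) w" using T[of 2 0] by (simp add: funpow_apply)
    ultimately show ?thesis using w0 w2 e(3) xy
      by (intro exI[of _ "(f^^(T 0)) w"]) (auto split: if_splits simp: field_simps)
  qed
  obtain p1 where p1: "p1 \<in> {x - e<..<x}" "(f^^(T 2 - T 0)) p1 < x" using pts[of True True] by auto
  obtain p2 where p2: "p2 \<in> {x - e<..<x}" "y < (f^^(T 2 - T 0)) p2" using pts[of True False] by auto
  obtain p3 where p3: "p3 \<in> {y<..<y + e}" "(f^^(T 2 - T 0)) p3 < x" using pts[of False True] by auto
  obtain p4 where p4: "p4 \<in> {y<..<y + e}" "y < (f^^(T 2 - T 0)) p4" using pts[of False False] by auto
  have "1 \<le> T 2 - T 0" using T[of 2 0] by simp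
  moreover have "\<exists>d>0. {x - d..y + d} \<subseteq> (f^^(T 2 - T 0)) ` {x - e0..x} \<and> {x - d..y + d} \<subseteq> (f^^(T 2 - T 0)) ` {y..y + e0}"
    by (rule spreads_step[OF tf, of p1 _ _ p2 p3 _ p4]) (use p1 p2 p3 p4 e in auto)
  ultimately show "\<exists>n\<ge>1. \<exists>d>0. {x - d..y + d} \<subseteq> (f^^n) ` {x - e0..x} \<and> {x - d..y + d} \<subseteq> (f^^n) ` {y..y + e0}"
    by blast
qed

section \<open>The equivalence\<close>

lemma covering_chain:
  fixes f :: "'a \<Rightarrow> 'a"
  assumes "\<And>i. V (Suc i) \<subseteq> (f^^(n i)) ` V i" and "v \<in> V k"
  shows "\<exists>w\<in>V 0. (f^^(sum n {..<k})) w = v \<and> (\<forall>i\<le>k. (f^^(sum n {..<i})) w \<in> V i)"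
  using assms(2)
proof (induction k arbitrary: v)
  case (Suc k)
  then obtain u where u: "u \<in> V k" "(f^^(n k)) u = v" using assms(1)[of k] by blast
  from Suc.IH[OF u(1)] obtain w where w: "w \<in> V 0" "(f^^(sum n {..<k})) w = u"
    "\<And>i. i \<le> k \<Longrightarrow> (f^^(sum n {..<i})) w \<in> V i" by blast
  have "(f^^(sum n {..<Suc k})) w = v" using u w by (simp add: add.commute funpow_add)
  then show ?case using w Suc.prems by (metis le_Suc_eq)
qed simp

text \<open>Taking the next radius below the margin \<open>d\<close> of the previous step makes each
  collar cover both collars of the next stage, so every finite itinerary is realised; compactness of
  the first collar gives the infinite ones. The bound \<open>e / Suc i\<close> lets the visits
  approach \<open>x\<close> and \<open>y\<close>.\<close>

lemma spreads_orbits: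
  assumes tf: "tame f" and xy: "x < y" and sp: "spreads f x y" and e: "0 < e"
  obtains E :: "nat \<Rightarrow> real" and T :: "nat \<Rightarrow> nat" where "strict_mono T" "\<And>i. E i \<le> e / Suc i"
    "\<And>s :: nat \<Rightarrow> bool. \<exists>w. \<forall>i. (f^^(T i)) w \<in> (if s i then {x - E i..x} else {y..y + E i})"
proof -
  have "\<exists>p. \<forall>i. (0 < fst (p i) \<and> fst (p i) \<le> e / Suc i) \<and>
      (1 \<le> snd (p i) \<and> {x - fst (p (Suc i))..y + fst (p (Suc i))} \<subseteq> (f^^(snd (p i))) ` {x - fst (p i)..x} \<and>
       {x - fst (p (Suc i))..y + fst (p (Suc i))} \<subseteq> (f^^(snd (p i))) ` {y..y + fst (p i)})"
  proof -
    have "\<exists>p. \<forall>i. (0 < fst (p i) \<and> fst (p i) \<le> e / Suc i \<and> 1 \<le> snd (p i) \<and>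
        (\<exists>d>0. {x - d..y + d} \<subseteq> (f^^(snd (p i))) ` {x - fst (p i)..x} \<and> {x - d..y + d} \<subseteq> (f^^(snd (p i))) ` {y..y + fst (p i)})) \<and>
      ({x - fst (p (Suc i))..y + fst (p (Suc i))} \<subseteq> (f^^(snd (p i))) ` {x - fst (p i)..x} \<and>
       {x - fst (p (Suc i))..y + fst (p (Suc i))} \<subseteq> (f^^(snd (p i))) ` {y..y + fst (p i)})"
    proof (rule dependent_nat_choice)
      obtain n d where "1 \<le> n" "0 < d" "{x - d..y + d} \<subseteq> (f^^n) ` {x - e..x}" "{x - d..y + d} \<subseteq> (f^^n) ` {y..y + e}"
        using sp e unfolding spreads_def by blast
      then show "\<exists>p. 0 < fst p \<and> fst p \<le> e / Suc 0 \<and> 1 \<le> snd p \<and>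
        (\<exists>d>0. {x - d..y + d} \<subseteq> (f^^(snd p)) ` {x - fst p..x} \<and> {x - d..y + d} \<subseteq> (f^^(snd p)) ` {y..y + fst p})"
        using e by (intro exI[of _ "(e, n)"]) auto
    next
      fix p :: "real \<times> nat" and i :: nat
      assume "0 < fst p \<and> fst p \<le> e / Suc i \<and> 1 \<le> snd p \<and>
        (\<exists>d>0. {x - d..y + d} \<subseteq> (f^^(snd p)) ` {x - fst p..x} \<and> {x - d..y + d} \<subseteq> (f^^(snd p)) ` {y..y + fst p})"
      then obtain d where d: "0 < d" "{x - d..y + d} \<subseteq> (f^^(snd p)) ` {x - fst p..x}" "{x - d..y + d} \<subseteq> (f^^(snd p)) ` {y..y + fst p}" by blast
      define d' where "d' = min d (e / Suc (Suc i))"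
      have d': "0 < d'" "d' \<le> e / Suc (Suc i)" "d' \<le> d" using d e unfolding d'_def by (simp_all del: of_nat_Suc)
      have sub: "{x - d'..y + d'} \<subseteq> {x - d..y + d}" using d'(3) by auto
      obtain n d2 where "1 \<le> n" "0 < d2" "{x - d2..y + d2} \<subseteq> (f^^n) ` {x - d'..x}" "{x - d2..y + d2} \<subseteq> (f^^n) ` {y..y + d'}"
        using sp d'(1) unfolding spreads_def by blast
      then show "\<exists>q. (0 < fst q \<and> fst q \<le> e / Suc (Suc i) \<and> 1 \<le> snd q \<and>
        (\<exists>d>0. {x - d..y + d} \<subseteq> (f^^(snd q)) ` {x - fst q..x} \<and> {x - d..y + d} \<subseteq> (f^^(snd q)) ` {y..y + fst q})) \<and>
        ({x - fst q..y + fst q} \<subseteq> (f^^(snd p)) ` {x - fst p..x} \<and> {x - fst q..y + fst q} \<subseteq> (f^^(snd p)) ` {y..y + fst p})"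
        using d' order.trans[OF sub d(2)] order.trans[OF sub d(3)] by (intro exI[of _ "(d', n)"]) auto
    qed
    then show ?thesis by blast
  qed
  then obtain p where p: "\<And>i. 0 < fst (p i)" "\<And>i. fst (p i) \<le> e / Suc i" "\<And>i. 1 \<le> snd (p i)"
    "\<And>i. {x - fst (p (Suc i))..y + fst (p (Suc i))} \<subseteq> (f^^(snd (p i))) ` {x - fst (p i)..x}"
    "\<And>i. {x - fst (p (Suc i))..y + fst (p (Suc i))} \<subseteq> (f^^(snd (p i))) ` {y..y + fst (p i)}" by blast
  define E where "E i = fst (p i)" for i
  define n where "n i = snd (p i)" for i
  define T where "T i = sum n {..<i}" for i
  note p = p[folded E_def n_def]
  show ?thesis
  proof (rule that[of T E])
    have "T i < T (Suc i)" for i using p(3)[of i] by (simp add: T_def)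
    then show "strict_mono T" by (simp add: strict_mono_Suc_iff)
    show "E i \<le> e / Suc i" for i by (rule p(2))
    fix s :: "nat \<Rightarrow> bool"
    define V where "V i = (if s i then {x - E i..x} else {y..y + E i})" for i
    have cl: "closed (V i)" for i by (simp add: V_def)
    show "\<exists>w. \<forall>i. (f^^(T i)) w \<in> (if s i then {x - E i..x} else {y..y + E i})"
    proof -
      have cov: "V (Suc i) \<subseteq> (f^^(n i)) ` V i" for i
      proof -
        have "V (Suc i) \<subseteq> {x - E (Suc i)..y + E (Suc i)}" using xy p(1)[of "Suc i"] by (auto simp: V_def)
        then show ?thesis using p(4)[of i] p(5)[of i] unfolding V_def[of i] by (cases "s i") auto
      qed
      have "(if s k then x else y) \<in> V k" for k using p(1)[of k] by (auto simp: V_def)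
      then have "\<exists>w\<in>V 0. \<forall>i\<le>k. (f^^(T i)) w \<in> V i" for k
        using covering_chain[where V = V and f = f and n = n, OF cov] unfolding T_def by blast
      then obtain w where w: "\<And>k. w k \<in> V 0" "\<And>k i. i \<le> k \<Longrightarrow> (f^^(T i)) (w k) \<in> V i" by metis
      have "compact (V 0)" by (simp add: V_def)
      then obtain u r where r: "strict_mono r" "(w \<circ> r) \<longlonglongrightarrow> u"
        using w(1) compact_imp_seq_compact unfolding seq_compact_def by metis
      have "(f^^(T i)) u \<in> V i" for i
      proof (rule Lim_in_closed_set[OF cl])
        show "(\<lambda>k. (f^^(T i)) ((w \<circ> r) k)) \<longlonglongrightarrow> (f^^(T i)) u"
          by (rule continuous_on_tendsto_compose[OF tame_funpow_continuous[OF tf, of UNIV] r(2)]) auto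
        show "\<forall>\<^sub>F k in sequentially. (f^^(T i)) ((w \<circ> r) k) \<in> V i"
          unfolding eventually_sequentially
        proof (intro exI[of _ i] allI impI)
          fix k assume "i \<le> k"
          then have "i \<le> r k" using seq_suble[OF r(1), of k] by simp
          then show "(f^^(T i)) ((w \<circ> r) k) \<in> V i" using w(2) by simp
        qed
      qed simp
      then show ?thesis unfolding V_def by blast
    qed
  qed
qed


lemma strict_mono_pred:
  assumes "strict_mono (T :: nat \<Rightarrow> nat)"
  shows "strict_mono (\<lambda>i. T (Suc i) - 1)"
  unfolding strict_mono_Suc_iff
proof
  fix i
  have "T 0 < T (Suc i)" "T (Suc i) < T (Suc (Suc i))" using assms by (simp_all add: strict_mono_def)
  then show "T (Suc i) - 1 < T (Suc (Suc i)) - 1" by linarith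
qed

lemma funpow_pred_apply: "0 < n \<Longrightarrow> (f^^(n - 1)) (f w) = (f^^n) w"
  by (cases n) (simp_all add: funpow_swap1)

lemma IT_pair_if_spreads:
  assumes im: "interval_map f" and tf: "tame (extend f)" and xy: "x < y" and sp: "spreads (extend f) x y"
  shows "IT_pair f x y"
  unfolding IT_pair_def
proof (intro allI impI)
  fix U1 U2 assume U: "open U1 \<and> x \<in> U1 \<and> open U2 \<and> y \<in> U2"
  obtain e1 where e1: "0 < e1" "\<And>t. \<bar>t - x\<bar> < e1 \<Longrightarrow> t \<in> U1" using U unfolding open_dist dist_real_def by blast
  obtain e2 where e2: "0 < e2" "\<And>t. \<bar>t - y\<bar> < e2 \<Longrightarrow> t \<in> U2" using U unfolding open_dist dist_real_def by blast
  define e where "e = min e1 e2 / 2"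
  have e: "0 < e" "e < e1" "e < e2" using e1 e2 by (auto simp: e_def)
  obtain E :: "nat \<Rightarrow> real" and T :: "nat \<Rightarrow> nat" where T: "strict_mono T" and E: "\<And>i. E i \<le> e / Suc i"
    and w: "\<And>s :: nat \<Rightarrow> bool. \<exists>w. \<forall>i. (extend f^^(T i)) w \<in> (if s i then {x - E i..x} else {y..y + E i})"
    using spreads_orbits[OF tf xy sp e(1)] by metis
  have Ee: "E i \<le> e" for i
  proof -
    have "e / Suc i \<le> e" using e(1) by (simp add: divide_le_eq mult_le_cancel_left1)
    then show ?thesis using E[of i] by linarith
  qed
  \<comment> \<open>The point \<open>w\<close> may lie outside I, but \<open>extend f w\<close> does
    not; starting there lowers all times by one. Time \<open>T 0\<close> may be 0 and is left
    out.\<close>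
  define T' where "T' i = T (Suc i) - 1" for i
  have T': "strict_mono T'" unfolding T'_def by (rule strict_mono_pred[OF T])
  have pos: "0 < T (Suc i)" for i using strict_mono_less[OF T, of 0 "Suc i"] by simp
  have "indep_set f U1 U2 (range T')"
    unfolding indep_set_def
  proof (intro allI impI)
    fix F and s :: "nat \<Rightarrow> bool" assume F: "F \<subseteq> range T' \<and> finite F \<and> F \<noteq> {}"
    obtain w where w: "\<And>i. (extend f^^(T i)) w \<in> (if s (T i - 1) then {x - E i..x} else {y..y + E i})"
      using w[of "\<lambda>i. s (T i - 1)"] by blast
    have u: "extend f w \<in> {0..1}" by (rule extend_range[OF im])
    have "(f^^j) (extend f w) \<in> (if s j then U1 else U2)" if "j \<in> F" for j
    proof -
      obtain i where j: "j = T (Suc i) - 1" using F \<open>j \<in> F\<close> by (auto simp: T'_def)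
      have "(f^^j) (extend f w) = (extend f^^(T (Suc i))) w"
        unfolding j funpow_extend[OF im u, symmetric] by (rule funpow_pred_apply[OF pos])
      then show ?thesis using w[of "Suc i"] Ee[of "Suc i"] e e1(2) e2(2) j by (auto split: if_splits)
    qed
    then show "\<exists>u\<in>{0..1}. \<forall>i\<in>F. (f^^i) u \<in> (if s i then U1 else U2)" using u by blast
  qed
  moreover have "infinite (range T')" using T' by (simp add: range_inj_infinite strict_mono_imp_inj_on)
  ultimately show "\<exists>J. infinite J \<and> indep_set f U1 U2 J" by blast
qed

text \<open>An itinerary alternating between the collars accumulates at both points. Starting at
  \<open>f w\<close> guarantees that, for an extended map, the orbit begins in I.\<close>

lemma spreads_omega_limit:
  assumes tf: "tame f" and xy: "x < y" and sp: "spreads f x y"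
  obtains w where "x \<in> omega_limit f (f w)" "y \<in> omega_limit f (f w)"
proof -
  obtain E :: "nat \<Rightarrow> real" and T :: "nat \<Rightarrow> nat" where T: "strict_mono T" and E: "\<And>i. E i \<le> 1 / Suc i"
    and w: "\<And>s :: nat \<Rightarrow> bool. \<exists>w. \<forall>i. (f^^(T i)) w \<in> (if s i then {x - E i..x} else {y..y + E i})"
    using spreads_orbits[OF tf xy sp, of 1] by (metis zero_less_one)
  obtain w where w: "\<And>i. (f^^(T i)) w \<in> (if even i then {x - E i..x} else {y..y + E i})" using w[of even] by blast
  have near: "\<exists>n\<ge>N. \<bar>(f^^n) (f w) - (if b then x else y)\<bar> < e" if e: "0 < e" for b e N
  proof -
    obtain m where m: "inverse (real (Suc m)) < e" using reals_Archimedean[OF e] by blast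
    define i where "i = 2 * (m + N + 1) + (if b then 0 else 1)"
    have i: "even i = b" "m \<le> i" "Suc N \<le> i" by (auto simp: i_def)
    have Ti: "Suc N \<le> T i" using seq_suble[OF T, of i] i(3) by simp
    have "E i \<le> 1 / Suc i" by (rule E)
    also have "\<dots> \<le> inverse (real (Suc m))" using i(2) by (simp add: inverse_eq_divide frac_le)
    finally have "E i < e" using m by simp
    moreover have "(f^^(T i - 1)) (f w) = (f^^(T i)) w" using Ti by (intro funpow_pred_apply) simp
    ultimately have "\<bar>(f^^(T i - 1)) (f w) - (if b then x else y)\<bar> < e" using w[of i] i(1) by (cases b) auto
    then show ?thesis using Ti by (intro exI[of _ "T i - 1"]) auto
  qed
  have "x \<in> omega_limit f (f w)" "y \<in> omega_limit f (f w)"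
    unfolding omega_limit_iff using near[of _ _ True] near[of _ _ False] by auto
  then show ?thesis by (rule that)
qed

section \<open>Portions as hulls of limit sets along residue classes\<close>

lemma omega_class_nonempty: assumes tf: "tame f" shows "omega_class f z k i \<noteq> {}"
proof -
  have "\<exists>n\<ge>N. n mod 2^k = i mod 2^k" for N
    by (intro exI[of _ "i + 2^k * N"]) (simp add: trans_le_add2)
  then obtain a where "\<And>e N. 0 < e \<Longrightarrow> \<exists>n\<ge>N. n mod 2^k = i mod 2^k \<and> \<bar>(f^^n) z - a\<bar> < e"
    using orbit_cluster_point[OF tf, of "\<lambda>n. n mod 2^k = i mod 2^k" z] by metis
  then have "a \<in> omega_class f z k i" by (simp add: omega_class_iff)
  then show ?thesis by blast
qed

lemma compact_omega_class: assumes tf: "tame f" shows "compact (omega_class f z k i)"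
proof -
  have "a \<in> omega_class f z k i" if "a \<in> closure (omega_class f z k i)" for a
    using that unfolding closure_approachable dist_real_def by (intro omega_class_closed) auto
  then have "closed (omega_class f z k i)" by (metis closure_subset closed_closure subsetI subset_antisym)
  moreover have "bounded (omega_class f z k i)" unfolding bounded_real using omega_class_bounded[OF tf] by blast
  ultimately show ?thesis by (simp add: compact_eq_bounded_closed)
qed

lemma Icc_Inf_Sup_eq_ord_hull:
  assumes "compact S" "S \<noteq> {}" shows "{Inf S..Sup S} = ord_hull S"
proof -
  have c: "closed S" "bdd_above S" "bdd_below S"
    using assms(1) by (auto simp: compact_eq_bounded_closed bounded_imp_bdd_above bounded_imp_bdd_below)
  have "Inf S \<in> S" using c assms(2) by (intro closed_contains_Inf)
  moreover have "Sup S \<in> S" using c assms(2) by (intro closed_contains_Sup)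
  moreover have "Inf S \<le> a" "a \<le> Sup S" if "a \<in> S" for a using that c cInf_lower cSup_upper by blast+
  ultimately show ?thesis unfolding ord_hull_def by auto (meson order.trans)+
qed

lemma omega_class_extend:
  assumes im: "interval_map f" and z: "z \<in> {0..1}"
  shows "omega_limit (f^^(2^k)) ((f^^i) z) = omega_class (extend f) z k i"
  unfolding omega_class_def omega_limit_def funpow_mult funpow_apply
  unfolding funpow_extend[OF im z] by (rule refl)

lemma omega_limit_extend:
  assumes "interval_map f" "z \<in> {0..1}" shows "omega_limit f z = omega_limit (extend f) z"
  using omega_class_extend[OF assms, of 0 0] by (simp add: omega_class_def)

lemma periodic_portion_eq:
  assumes im: "interval_map f" and tf: "tame (extend f)" and z: "z \<in> {0..1}"
  shows "periodic_portion f z k i = ord_hull (omega_class (extend f) z k i)"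
  unfolding periodic_portion_def omega_class_extend[OF im z]
  by (rule Icc_Inf_Sup_eq_ord_hull[OF compact_omega_class[OF tf] omega_class_nonempty[OF tf]])

text \<open>Nested portions force coherent residues, since classes with different residues are
  separated by a point. The endpoints of the intersection lie in every class: deep classes have no
  point below \<open>x - e\<close>, yet some point at or below \<open>x\<close> because
  \<open>x\<close> is in the hull; similarly for \<open>y\<close>. This gives a
  \<open>solenoidal_pair\<close>.\<close>

lemma spreads_if_nonseparable:
  assumes im: "interval_map f" and tf: "tame (extend f)" and xy: "x < y" and ns: "nonseparable f x y"
  shows "spreads (extend f) x y"
proof -
  obtain z ik where z: "z \<in> {0..1}" and inf: "infinite (omega_limit f z)"
    and ik: "\<And>k. 1 \<le> k \<Longrightarrow> periodic_portion f z (k + 1) (ik (k + 1)) \<subseteq> periodic_portion f z k (ik k)"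
    and int: "(\<Inter>k\<in>{1..}. periodic_portion f z k (ik k)) = {x..y} \<or> (\<Inter>k\<in>{1..}. periodic_portion f z k (ik k)) = {y..x}"
  proof -
    obtain z where "z \<in> {0..1}" "infinite (omega_limit f z)" and
      ex: "\<exists>ik. (\<forall>k\<ge>1. ik k < 2^k \<and> periodic_portion f z (k + 1) (ik (k + 1)) \<subseteq> periodic_portion f z k (ik k)) \<and>
        ((\<Inter>k\<in>{1..}. periodic_portion f z k (ik k)) = {x..y} \<or> (\<Inter>k\<in>{1..}. periodic_portion f z k (ik k)) = {y..x})"
      using ns[unfolded nonseparable_def] by (elim conjE bexE)
    from ex obtain ik where "\<forall>k\<ge>1. ik k < 2^k \<and> periodic_portion f z (k + 1) (ik (k + 1)) \<subseteq> periodic_portion f z k (ik k)"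
      "(\<Inter>k\<in>{1..}. periodic_portion f z k (ik k)) = {x..y} \<or> (\<Inter>k\<in>{1..}. periodic_portion f z k (ik k)) = {y..x}"
      by (elim exE conjE)
    then show ?thesis using that[of z ik] \<open>z \<in> {0..1}\<close> \<open>infinite (omega_limit f z)\<close> by simp
  qed
  define A where "A k = omega_class (extend f) z k (ik k)" for k
  have P: "periodic_portion f z k (ik k) = ord_hull (A k)" for k
    unfolding A_def by (rule periodic_portion_eq[OF im tf z])
  have np: "nonperiodic (extend f) z"
    using nonperiodic_if_infinite_omega[OF tf] inf omega_limit_extend[OF im z] by simp
  have coh: "ik (Suc k) mod 2^k = ik k mod 2^k" if k: "1 \<le> k" for k
  proof (rule ccontr)
    assume "\<not> ?thesis"
    then have ne: "ik k mod 2^k \<noteq> ik (Suc k) mod 2^k" by simp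
    obtain a where a: "a \<in> A (Suc k)" using omega_class_nonempty[OF tf, of z "Suc k" "ik (Suc k)"] by (auto simp: A_def)
    then have a1: "a \<in> omega_class (extend f) z k (ik (Suc k))" using omega_class_mono[of k "Suc k"] by (auto simp: A_def)
    have "a \<in> ord_hull (A k)" using in_ord_hull[OF a] ik[OF k] unfolding P by auto
    then obtain u v where uv: "u \<in> A k" "v \<in> A k" "u \<le> a" "a \<le> v" by (auto simp: ord_hull_def)
    obtain c where "(\<forall>a\<in>A k. \<forall>b\<in>omega_class (extend f) z k (ik (Suc k)). a < c \<and> c < b) \<or>
      (\<forall>a\<in>A k. \<forall>b\<in>omega_class (extend f) z k (ik (Suc k)). b < c \<and> c < a)"
      unfolding A_def by (rule omega_class_separated[OF tf np ne])
    then show False using a1 uv by force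
  qed
  have A_Suc: "A (Suc k) \<subseteq> A k" if "1 \<le> k" for k
    unfolding A_def using omega_class_mono[of k "Suc k" "extend f" z "ik (Suc k)"] omega_class_cong[OF coh[OF that], of "extend f" z] by auto
  have A_mono: "A l \<subseteq> A k" if "1 \<le> k" "k \<le> l" for k l
    using that(2,1)
  proof (induction l rule: dec_induct)
    case (step l)
    then show ?case using A_Suc[of l] by auto
  qed simp
  \<comment> \<open>Nonemptiness rules out the alternative \<open>{y..x}\<close>.\<close>
  have "(\<Inter>k. A (Suc k)) \<noteq> {}"
  proof -
    have "\<Inter>(range (\<lambda>k. A (Suc k))) \<noteq> {}"
    proof (rule compact_nest)
      show "compact (A (Suc k))" "A (Suc k) \<noteq> {}" for k
        unfolding A_def by (rule compact_omega_class[OF tf], rule omega_class_nonempty[OF tf])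
      show "A (Suc l) \<subseteq> A (Suc k)" if "k \<le> l" for k l using A_mono[of "Suc k" "Suc l"] that by simp
    qed
    then show ?thesis .
  qed
  then obtain w where w: "\<And>k. w \<in> A (Suc k)" by auto
  have "w \<in> ord_hull (A k)" if "k \<in> {1..}" for k using w[of "k - 1"] that by (intro in_ord_hull) simp
  then have "(\<Inter>k\<in>{1..}. ord_hull (A k)) \<noteq> {}" by blast
  then have int: "(\<Inter>k\<in>{1..}. ord_hull (A k)) = {x..y}" using int xy unfolding P by (elim disjE) simp_all
  have inx: "x \<in> ord_hull (A k)" and iny: "y \<in> ord_hull (A k)" if "1 \<le> k" for k
  proof -
    have "x \<in> (\<Inter>k\<in>{1..}. ord_hull (A k))" "y \<in> (\<Inter>k\<in>{1..}. ord_hull (A k))" unfolding int using xy by auto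
    then show "x \<in> ord_hull (A k)" "y \<in> ord_hull (A k)" using that by auto
  qed
  have lower: "\<exists>K\<ge>1. \<forall>k\<ge>K. \<forall>a\<in>A k. x - e < a" if e: "0 < e" for e
  proof -
    have "x - e \<notin> (\<Inter>k\<in>{1..}. ord_hull (A k))" unfolding int using e by auto
    then obtain K where K: "1 \<le> K" "x - e \<notin> ord_hull (A K)" by auto
    have "x - e < a" if ka: "K \<le> k" "a \<in> A k" for k a
    proof (rule ccontr)
      assume "\<not> ?thesis"
      moreover have "a \<in> A K" using A_mono[OF K(1) ka(1)] ka(2) by blast
      moreover obtain v where "v \<in> A K" "x \<le> v" using inx[OF K(1)] by (auto simp: ord_hull_def)
      ultimately have "x - e \<in> ord_hull (A K)" using e by (intro ord_hullI[of a _ v]) auto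
      then show False using K(2) by blast
    qed
    then show ?thesis using K(1) by blast
  qed
  have upper: "\<exists>K\<ge>1. \<forall>k\<ge>K. \<forall>a\<in>A k. a < y + e" if e: "0 < e" for e
  proof -
    have "y + e \<notin> (\<Inter>k\<in>{1..}. ord_hull (A k))" unfolding int using e by auto
    then obtain K where K: "1 \<le> K" "y + e \<notin> ord_hull (A K)" by auto
    have "a < y + e" if ka: "K \<le> k" "a \<in> A k" for k a
    proof (rule ccontr)
      assume "\<not> ?thesis"
      moreover have "a \<in> A K" using A_mono[OF K(1) ka(1)] ka(2) by blast
      moreover obtain v where "v \<in> A K" "v \<le> y" using iny[OF K(1)] by (auto simp: ord_hull_def)
      ultimately have "y + e \<in> ord_hull (A K)" using e by (intro ord_hullI[of v _ a]) auto
      then show False using K(2) by blast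
    qed
    then show ?thesis using K(1) by blast
  qed
  have xA: "x \<in> A k" if k: "1 \<le> k" for k
    unfolding A_def
  proof (rule omega_class_closed)
    fix e :: real assume "0 < e"
    then obtain K where K: "1 \<le> K" "\<forall>k\<ge>K. \<forall>a\<in>A k. x - e < a" using lower by blast
    obtain a where a: "a \<in> A (max K k)" "a \<le> x" using inx[of "max K k"] k by (auto simp: ord_hull_def le_max_iff_disj)
    have "x - e < a" using K(2) a(1) by (meson max.cobounded1)
    moreover have "a \<in> A k" using A_mono[OF k, of "max K k"] a(1) by auto
    ultimately show "\<exists>b\<in>omega_class (extend f) z k (ik k). \<bar>b - x\<bar> < e" using a(2) unfolding A_def by force
  qed
  have yA: "y \<in> A k" if k: "1 \<le> k" for k
    unfolding A_def
  proof (rule omega_class_closed)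
    fix e :: real assume "0 < e"
    then obtain K where K: "1 \<le> K" "\<forall>k\<ge>K. \<forall>a\<in>A k. a < y + e" using upper by blast
    obtain a where a: "a \<in> A (max K k)" "y \<le> a" using iny[of "max K k"] k by (auto simp: ord_hull_def le_max_iff_disj)
    have "a < y + e" using K(2) a(1) by (meson max.cobounded1)
    moreover have "a \<in> A k" using A_mono[OF k, of "max K k"] a(1) by auto
    ultimately show "\<exists>b\<in>omega_class (extend f) z k (ik k). \<bar>b - y\<bar> < e" using a(2) unfolding A_def by force
  qed
  have small: "\<exists>k\<ge>1. A k \<subseteq> {x - e<..<y + e}" if e: "0 < e" for e
  proof -
    obtain K1 where K1: "1 \<le> K1" "\<forall>k\<ge>K1. \<forall>a\<in>A k. x - e < a" using lower[OF e] by blast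
    obtain K2 where K2: "1 \<le> K2" "\<forall>k\<ge>K2. \<forall>a\<in>A k. a < y + e" using upper[OF e] by blast
    have "A (max K1 K2) \<subseteq> {x - e<..<y + e}" using K1(2) K2(2) by (meson greaterThanLessThan_iff max.cobounded1 max.cobounded2 subsetI)
    then show ?thesis using K1(1) by (intro exI[of _ "max K1 K2"]) auto
  qed
  have "solenoidal_pair (extend f) z ik x y"
    unfolding solenoidal_pair_def using np coh xA yA small unfolding A_def by simp
  then show ?thesis by (rule solenoidal_pair_spreads[OF tf xy])
qed

text \<open>A neighbourhood of \<open>a\<close> would lie in all the hulls, and the orbit visits it
  twice, although the hulls wander.\<close>

lemma omega_limit_not_inside_hulls:
  assumes tf: "tame f" and np: "nonperiodic f z" and a: "a \<in> omega_limit f z" and ua: "u < a" "a < v"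
    and uv: "\<And>k. 1 \<le> k \<Longrightarrow> u \<in> ord_hull (omega_class f z k (ik k))" "\<And>k. 1 \<le> k \<Longrightarrow> v \<in> ord_hull (omega_class f z k (ik k))"
  shows False
proof -
  have e: "0 < min (a - u) (v - a)" using ua by simp
  obtain n where n: "\<bar>(f^^n) z - a\<bar> < min (a - u) (v - a)" using omega_limitD[OF a e, of 0] by blast
  obtain m where m: "Suc n \<le> m" "\<bar>(f^^m) z - a\<bar> < min (a - u) (v - a)" using omega_limitD[OF a e] by blast
  have "t \<in> ord_hull (omega_class f z k (ik k))" if "\<bar>t - a\<bar> < min (a - u) (v - a)" "1 \<le> k" for t k
  proof -
    have "u \<le> t" "t \<le> v" using that(1) by auto
    then show ?thesis using uv[OF that(2)] unfolding ord_hull_def by (auto intro: order.trans)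
  qed
  then have "(f^^(m - n)) ((f^^n) z) \<noteq> (f^^m) z"
    using nested_hull_wandering[OF tf np, of "m - n" "(f^^n) z" ik "(f^^m) z"] n m by simp
  then show False using m(1) by (simp add: funpow_apply)
qed

text \<open>A wandering \<open>(x, y)\<close> contains no periodic point, so by
  \<open>omega_class_separated\<close> the points \<open>x\<close> and \<open>y\<close> share their
  class at each level, which determines the portions. Were the intersection larger than
  \<open>[x, y]\<close>, one of the limit points \<open>x\<close> and \<open>y\<close> would lie in
  its interior.\<close>

lemma nonseparable_if_wandering:
  assumes im: "interval_map f" and tf: "tame (extend f)" and xy: "x < y" and z: "z \<in> {0..1}"
    and xz: "x \<in> omega_limit (extend f) z" and yz: "y \<in> omega_limit (extend f) z"
    and wand: "\<And>n t. 1 \<le> n \<Longrightarrow> t \<in> {x<..<y} \<Longrightarrow> (extend f^^n) t \<notin> {x<..<y}"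
  shows "nonseparable f x y"
proof -
  let ?F = "extend f"
  have np: "nonperiodic ?F z"
    unfolding nonperiodic_def
  proof (intro allI notI)
    fix k i assume "convergent (\<lambda>n. (?F^^(2^k * n + i)) z)"
    then obtain L where L: "(\<lambda>n. (?F^^(2^k * n + i)) z) \<longlonglongrightarrow> L" by (auto simp: convergent_def)
    have "(?F^^(2^k)) x = x" "(?F^^(2^k)) y = y"
      using convergent_class_omega(2)[OF tf L xz] convergent_class_omega(2)[OF tf L yz] by auto
    moreover have "(\<forall>t\<in>{x..y}. (?F^^(2^k)) t \<le> x) \<or> (\<forall>t\<in>{x..y}. y \<le> (?F^^(2^k)) t)"
      by (rule wandering_image_side[OF tf _ xy]) (rule wand, auto)
    ultimately show False using xy by (metis atLeastAtMost_iff less_imp_le linorder_not_less order.refl)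
  qed
  have no_fixed: "\<not> (x < c \<and> c < y)" if "(?F^^(2^l)) c = c" for c l
    using wand[of "2^l" c] that by auto
  have "\<forall>k. \<exists>i. i < 2^k \<and> x \<in> omega_class ?F z k i" using omega_limit_subset_omega_class[OF xz] by metis
  then obtain ik where ik: "\<And>k. ik k < 2^k" "\<And>k. x \<in> omega_class ?F z k (ik k)" by metis
  have yk: "y \<in> omega_class ?F z k (ik k)" for k
  proof -
    obtain j where j: "y \<in> omega_class ?F z k j" using omega_limit_subset_omega_class[OF yz] by blast
    have "ik k mod 2^k = j mod 2^k"
    proof (rule ccontr)
      assume ne: "ik k mod 2^k \<noteq> j mod 2^k"
      obtain c l where "(?F^^(2^l)) c = c" "(\<forall>a\<in>omega_class ?F z k (ik k). \<forall>b\<in>omega_class ?F z k j. a < c \<and> c < b) \<or>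
          (\<forall>a\<in>omega_class ?F z k (ik k). \<forall>b\<in>omega_class ?F z k j. b < c \<and> c < a)" by (rule omega_class_separated[OF tf np ne])
      then show False using ik(2)[of k] j no_fixed xy by force
    qed
    then show ?thesis using j omega_class_cong by blast
  qed
  have coh: "ik (Suc k) mod 2^k = ik k mod 2^k" for k
  proof (rule ccontr)
    assume ne: "ik (Suc k) mod 2^k \<noteq> ik k mod 2^k"
    obtain c where "(\<forall>a\<in>omega_class ?F z k (ik (Suc k)). \<forall>b\<in>omega_class ?F z k (ik k). a < c \<and> c < b) \<or>
        (\<forall>a\<in>omega_class ?F z k (ik (Suc k)). \<forall>b\<in>omega_class ?F z k (ik k). b < c \<and> c < a)" by (rule omega_class_separated[OF tf np ne])
    moreover have "x \<in> omega_class ?F z k (ik (Suc k))" using ik(2)[of "Suc k"] omega_class_mono[of k "Suc k"] by auto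
    ultimately show False using ik(2)[of k] by force
  qed
  have nest: "omega_class ?F z (Suc k) (ik (Suc k)) \<subseteq> omega_class ?F z k (ik k)" for k
    using omega_class_mono[of k "Suc k" ?F z "ik (Suc k)"] omega_class_cong[OF coh[of k], of ?F z] by auto
  have hx: "x \<in> ord_hull (omega_class ?F z k (ik k))" and hy: "y \<in> ord_hull (omega_class ?F z k (ik k))" for k
    using ik(2) yk by (auto intro: in_ord_hull)
  have int: "(\<Inter>k\<in>{1..}. ord_hull (omega_class ?F z k (ik k))) = {x..y}"
  proof
    show "{x..y} \<subseteq> (\<Inter>k\<in>{1..}. ord_hull (omega_class ?F z k (ik k)))"
      using ik(2) yk unfolding ord_hull_def by auto
    show "(\<Inter>k\<in>{1..}. ord_hull (omega_class ?F z k (ik k))) \<subseteq> {x..y}"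
    proof
      fix t assume "t \<in> (\<Inter>k\<in>{1..}. ord_hull (omega_class ?F z k (ik k)))"
      then have t: "t \<in> ord_hull (omega_class ?F z k (ik k))" if "1 \<le> k" for k using that by auto
      have "\<not> t < x" using omega_limit_not_inside_hulls[OF tf np xz _ xy, of t ik] t hy by blast
      moreover have "\<not> y < t" using omega_limit_not_inside_hulls[OF tf np yz xy, of t ik] t hx by blast
      ultimately show "t \<in> {x..y}" by simp
    qed
  qed
  have inf: "infinite (omega_limit f z)"
    using infinite_omega_if_nonperiodic[OF tf np xz] omega_limit_extend[OF im z] by simp
  note P = periodic_portion_eq[OF im tf z]
  show ?thesis
    unfolding nonseparable_def
  proof (intro conjI bexI[of _ z] exI[of _ ik] allI impI)
    show "ik k < 2^k" for k by (rule ik(1))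
    show "periodic_portion f z (k + 1) (ik (k + 1)) \<subseteq> periodic_portion f z k (ik k)" for k
      unfolding P using ord_hull_mono[OF nest] by simp
    show "(\<Inter>k\<in>{1..}. periodic_portion f z k (ik k)) = {x..y} \<or> (\<Inter>k\<in>{1..}. periodic_portion f z k (ik k)) = {y..x}"
      unfolding P using int by blast
  qed (use xy z inf in auto)
qed

text \<open>Among \<open>n * m\<close> independent times, \<open>m\<close> have the same residue
  \<open>r\<close> modulo \<open>n\<close>. Subtracting \<open>r\<close> makes them divisible by
  \<open>n\<close>, at the price of starting at \<open>(f^^r) u\<close> in place of
  \<open>u\<close>.\<close>

lemma indep_returns_if_IN_pair:
  assumes im: "interval_map f" and inp: "IN_pair f x y" and n: "1 \<le> n"
  shows "indep_returns (extend f) n x y"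
  unfolding indep_returns_def
proof (intro allI impI)
  fix e :: real and m :: nat assume e: "0 < e"
  let ?U = "{x - e<..<x + e}" and ?V = "{y - e<..<y + e}"
  obtain J where J: "finite J" "n * m \<le> card J" "indep_set f ?U ?V J"
    using inp[unfolded IN_pair_def, rule_format, of ?U ?V "n * m"] e by auto
  define R where "R r = {j \<in> J. j mod n = r}" for r
  have "\<exists>r<n. m \<le> card (R r)"
  proof (rule ccontr)
    assume "\<not> ?thesis"
    then have small: "card (R r) \<le> m - 1" "1 \<le> m" if "r < n" for r using that by force+
    have "J = (\<Union>r\<in>{..<n}. R r)" using n by (auto simp: R_def)
    then have "card J \<le> (\<Sum>r<n. card (R r))" using card_UN_le[of "{..<n}" R] by simp
    also have "\<dots> \<le> n * (m - 1)" using sum_bounded_above[of "{..<n}" "\<lambda>r. card (R r)" "m - 1"] small by simp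
    also have "\<dots> < n * m" using small(2)[of 0] n by simp
    finally show False using J(2) by simp
  qed
  then obtain r where r: "r < n" "m \<le> card (R r)" by blast
  define L where "L = sorted_list_of_set (R r)"
  have finR: "finite (R r)" using J(1) by (simp add: R_def)
  have L: "set L = R r" "sorted_wrt (<) L" "distinct L" "length L = card (R r)"
    using finR by (auto simp: L_def)
  have Lm: "L ! i \<in> R r" if "i < m" for i using that r(2) L(1,4) nth_mem[of i L] by simp
  have Lr: "r \<le> L ! i" if "i < m" for i using Lm[OF that] by (auto simp: R_def)
  define T where "T i = L ! i - r" for i
  have inc: "T i < T j" if "j < m" "i < j" for i j
    using sorted_wrt_nth_less[OF L(2) that(2)] that r(2) L(4) Lr[of i] Lr[of j] by (simp add: T_def diff_less_mono)
  have dv: "n dvd T i" if "i < m" for i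
    using Lm[OF that] unfolding T_def R_def by (auto simp: mod_eq_dvd_iff_nat[symmetric])
  have wit: "\<exists>w. \<bar>w\<bar> \<le> 1 \<and> (\<forall>i<m. (extend f^^(T i)) w \<in> (if s i then ?U else ?V))" for s :: "nat \<Rightarrow> bool"
  proof (cases "m = 0")
    case False
    \<comment> \<open>Neighbourhoods are assigned to times in \<open>indep_set\<close> but to
      positions in \<open>indep_returns\<close>; distinctness of \<open>L\<close> makes the
      translation consistent.\<close>
    define s' where "s' t = (\<exists>i<length L. L ! i = t \<and> s i)" for t
    have s': "s' (L ! i) = s i" if "i < m" for i
      unfolding s'_def using that r(2) L(3,4) nth_eq_iff_index_eq[OF L(3)] by (metis order.strict_trans2)
    have "R r \<noteq> {}" using Lm[of 0] False by blast
    moreover have "R r \<subseteq> J" by (auto simp: R_def)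
    ultimately obtain u where u: "u \<in> {0..1}" "\<forall>t\<in>R r. (f^^t) u \<in> (if s' t then ?U else ?V)"
      using J(3) finR unfolding indep_set_def by blast
    have "(extend f^^(T i)) ((f^^r) u) \<in> (if s i then ?U else ?V)" if i: "i < m" for i
    proof -
      have "(extend f^^(T i)) ((f^^r) u) = (f^^(T i)) ((f^^r) u)"
        by (rule funpow_extend[OF im funpow_interval_map[OF im u(1)]])
      also have "\<dots> = (f^^(L ! i)) u" using Lr[OF i] by (simp add: funpow_apply T_def)
      finally show ?thesis using u(2) Lm[OF i] s'[OF i] by metis
    qed
    moreover have "\<bar>(f^^r) u\<bar> \<le> 1" using funpow_interval_map[OF im u(1), of r] by auto
    ultimately show ?thesis by blast
  qed (auto intro: exI[of _ 0])
  show "\<exists>T. (\<forall>i<m. \<forall>j<m. i < j \<longrightarrow> T i < T j) \<and> (\<forall>i<m. n dvd T i) \<and>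
      (\<forall>s :: nat \<Rightarrow> bool. \<exists>w. \<bar>w\<bar> \<le> 1 \<and> (\<forall>i<m. (extend f^^(T i)) w \<in> (if s i then ?U else ?V)))"
    using inc dv wit by blast
qed

lemma IN_pair_if_IT_pair:
  assumes "IT_pair f x y" shows "IN_pair f x y"
  unfolding IN_pair_def
proof (intro allI impI)
  fix U1 U2 and m :: nat assume "open U1 \<and> x \<in> U1 \<and> open U2 \<and> y \<in> U2"
  then obtain J where J: "infinite J" "indep_set f U1 U2 J" using assms unfolding IT_pair_def by blast
  obtain K where K: "K \<subseteq> J" "finite K" "card K = m" using infinite_arbitrarily_large[OF J(1)] by blast
  have "indep_set f U1 U2 K"
    unfolding indep_set_def
  proof (intro allI impI)
    fix F s assume "F \<subseteq> K \<and> finite F \<and> F \<noteq> {}"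
    then have "F \<subseteq> J \<and> finite F \<and> F \<noteq> {}" using K(1) by auto
    then show "\<exists>x\<in>{0..1}. \<forall>i\<in>F. (f^^i) x \<in> (if s i then U1 else U2)"
      using J(2) unfolding indep_set_def by (elim allE[of _ F] impE) auto
  qed
  then show "\<exists>J. finite J \<and> m \<le> card J \<and> indep_set f U1 U2 J" using K by (intro exI[of _ K]) simp
qed

theorem mainTheorem15:
  fixes f :: "real \<Rightarrow> real" and x y :: real
  assumes "interval_map f"
    and "top_entropy f = 0"
    and "x \<in> {0..1}" and "y \<in> {0..1}" and "x < y"
  shows "(nonseparable f x y \<longleftrightarrow> IT_pair f x y) \<and> (IT_pair f x y \<longleftrightarrow> IN_pair f x y)"
proof -
  have tf: "tame (extend f)" using assms by (intro tame_extend)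
  have "IT_pair f x y" if "nonseparable f x y"
    by (rule IT_pair_if_spreads[OF assms(1) tf assms(5) spreads_if_nonseparable[OF assms(1) tf assms(5) that]])
  moreover have "nonseparable f x y" if "IN_pair f x y"
  proof -
    note ind = indep_returns_if_IN_pair[OF assms(1) that]
    obtain w where w: "x \<in> omega_limit (extend f) (extend f w)" "y \<in> omega_limit (extend f) (extend f w)"
      using spreads_omega_limit[OF tf assms(5) spreads_if_indep_returns[OF tf assms(5) ind]] by blast
    show ?thesis
      by (rule nonseparable_if_wandering[OF assms(1) tf assms(5) extend_range[OF assms(1)] w])
        (rule segment_wandering_if_indep_returns[OF tf ind])
  qed
  ultimately show ?thesis using IN_pair_if_IT_pair by blast
qed

end
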